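(* There is an absolute constant $K>0$ such that, for each $\mathbb F\in\{\mathbb R,\mathbb C\}$, every positive integer $n$, and every matrix $A\in M_n(\mathbb F)$ with $\operatorname{Tr}A=0$, there exist $B,C\in M_n(\mathbb F)$ with $A=BC-CB$ and $\|B\|\,\|C\|\le K\|A\|$.
   Context: $\|\cdot\|$ denotes the operator norm (with respect to the Euclidean norm on $\mathbb F^n$). "Absolute" means that $K$ does not depend on $n$, $A$ or $\mathbb F$. *)

theory Defs
  imports "Jordan_Normal_Form.Matrix" "HOL-Analysis.L2_Norm"
begin

text \<open>
  The constant in the theorem is uniform in the dimension \<open>n\<close>, so \<open>n\<close> has to be quantified
  inside the formula. Hence square matrices are elements of \<^term>\<open>carrier_mat n n\<close>, and
  trace and operator norm are defined for this matrix type; \<open>'a\<close> is only used at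
  \<^typ>\<open>real\<close> and \<^typ>\<open>complex\<close>.
\<close>

definition mat_trace :: "'a::comm_monoid_add mat \<Rightarrow> 'a" where
  "mat_trace A = (\<Sum>i<dim_row A. A $$ (i, i))"

definition vec_l2norm :: "'a::real_normed_field vec \<Rightarrow> real" where
  "vec_l2norm v = L2_set (\<lambda>i. norm (v $ i)) {..<dim_vec v}"

text \<open>The vectors \<open>v\<close> range over the scalar field of \<open>A\<close> itself.\<close>

definition mat_opnorm :: "'a::real_normed_field mat \<Rightarrow> real" where
  "mat_opnorm A = (SUP v \<in> {v \<in> carrier_vec (dim_col A). vec_l2norm v \<le> 1}. vec_l2norm (A *\<^sub>v v))"

text \<open>The supremum above is taken over a nonempty set that is bounded above, so it is a genuine one.\<close>

lemma vec_l2norm_nonneg [simp]: "0 \<le> vec_l2norm v"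
  by (simp add: vec_l2norm_def L2_set_nonneg)

lemma vec_l2norm_zero [simp]: "vec_l2norm (0\<^sub>v n) = 0"
  by (simp add: vec_l2norm_def L2_set_def)

lemma norm_vec_index_le: "i < dim_vec v \<Longrightarrow> norm (v $ i) \<le> vec_l2norm v"
  unfolding vec_l2norm_def
  by (rule member_le_L2_set[where f = "\<lambda>i. norm (v $ i)"]) auto

lemma vec_l2norm_smult: "vec_l2norm (c \<cdot>\<^sub>v v) = norm c * vec_l2norm v"
proof -
  have "vec_l2norm (c \<cdot>\<^sub>v v) = L2_set (\<lambda>i. norm c * norm (v $ i)) {..<dim_vec v}"
    unfolding vec_l2norm_def by (rule L2_set_cong) (auto simp: norm_mult)
  then show ?thesis
    by (simp add: vec_l2norm_def L2_set_right_distrib)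
qed

lemma mat_opnorm_bdd_above:
  fixes A :: "'a::real_normed_field mat"
  shows "bdd_above ((\<lambda>v. vec_l2norm (A *\<^sub>v v)) ` {v \<in> carrier_vec (dim_col A). vec_l2norm v \<le> 1})"
proof (rule bdd_aboveI2)
  fix v :: "'a vec"
  assume v: "v \<in> {v \<in> carrier_vec (dim_col A). vec_l2norm v \<le> 1}"
  then have d: "dim_vec v = dim_col A" and v1: "vec_l2norm v \<le> 1" by auto
  have entry: "norm ((A *\<^sub>v v) $ i) \<le> (\<Sum>j<dim_col A. norm (A $$ (i, j)))"
    if i: "i < dim_row A" for i
  proof -
    have "(A *\<^sub>v v) $ i = (\<Sum>j<dim_col A. A $$ (i, j) * v $ j)"
      using i d by (auto simp: scalar_prod_def atLeast0LessThan intro!: sum.cong)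
    also have "norm \<dots> \<le> (\<Sum>j<dim_col A. norm (A $$ (i, j)))"
    proof (rule sum_norm_le)
      fix j assume "j \<in> {..<dim_col A}"
      then have "norm (v $ j) \<le> 1"
        using norm_vec_index_le[of j v] d v1 by auto
      then show "norm (A $$ (i, j) * v $ j) \<le> norm (A $$ (i, j))"
        by (simp add: norm_mult mult_left_le)
    qed
    finally show ?thesis .
  qed
  have "vec_l2norm (A *\<^sub>v v) \<le> (\<Sum>i<dim_row A. norm ((A *\<^sub>v v) $ i))"
    unfolding vec_l2norm_def by (rule order_trans[OF L2_set_le_sum]) auto
  also have "\<dots> \<le> (\<Sum>i<dim_row A. \<Sum>j<dim_col A. norm (A $$ (i, j)))"
    by (rule sum_mono) (use entry in auto)
  finally show "vec_l2norm (A *\<^sub>v v) \<le> (\<Sum>i<dim_row A. \<Sum>j<dim_col A. norm (A $$ (i, j)))" .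
qed

lemma vec_l2norm_mult_le:
  assumes "v \<in> carrier_vec (dim_col A)"
  shows "vec_l2norm (A *\<^sub>v v) \<le> mat_opnorm A * vec_l2norm v"
proof (cases "vec_l2norm v = 0")
  case True
  have "v $ i = 0" if "i < dim_vec v" for i
    using norm_vec_index_le[OF that] True by simp
  then have "v = 0\<^sub>v (dim_col A)"
    using assms by auto
  then have "A *\<^sub>v v = 0\<^sub>v (dim_row A)"
    by (auto simp: scalar_prod_def)
  then show ?thesis using True by simp
next
  case False
  define r where "r = vec_l2norm v"
  have r: "r > 0" using False by (simp add: r_def order_less_le)
  define w where "w = of_real (1 / r) \<cdot>\<^sub>v v"
  have w: "w \<in> carrier_vec (dim_col A)" "vec_l2norm w \<le> 1"
    using assms r by (auto simp: w_def vec_l2norm_smult norm_divide simp flip: r_def)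
  have "vec_l2norm (A *\<^sub>v w) \<le> mat_opnorm A"
    unfolding mat_opnorm_def by (rule cSUP_upper[OF _ mat_opnorm_bdd_above]) (use w in auto)
  moreover have "A *\<^sub>v w = of_real (1 / r) \<cdot>\<^sub>v (A *\<^sub>v v)"
    unfolding w_def using assms by (intro mult_mat_vec) auto
  ultimately have "vec_l2norm (A *\<^sub>v v) / r \<le> mat_opnorm A"
    using r by (simp add: vec_l2norm_smult norm_divide)
  then show ?thesis
    using r by (simp add: r_def field_simps)
qed

end

theory Submission
  imports "HOL-Analysis.Analysis" Defs
begin

text \<open>
  A zero block can be split off a commutator representation at a small cost: a Sylvester equation with
  well separated diagonal blocks absorbs the off-diagonal part.

  Over the reals, an orthonormal basis of pairs adapted to the skew part splits the space into two
  halves on which the matrix is symmetric of trace zero, and a symmetric matrix of trace zero is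
  unitarily a diagonal one whose partial sums are bounded, that is, a commutator of weighted shifts.

  Over the complex numbers the proof is by induction on the dimension. If the matrix can be cut into
  \<open>s\<^sup>2\<close> diagonal blocks of trace zero and norm of order \<open>1/s\<^sup>2\<close>, the inductive representations of the
  blocks, rescaled so that the first factors have norm of order \<open>1/s\<close>, fit together with an additive constant and
  a multiplicative loss of order \<open>1/s\<close>, which closes the induction for large \<open>s\<close>. By convexity of the
  numerical range, a matrix either has a zero block of proportional size or its form is one-sided, up to few
  directions. In the one-sided case, trace zero makes it a small perturbation of a diagonal
  skew-adjoint matrix, up to few directions, and averaging over groups of basis vectors cuts it as wanted. Otherwise
  zero blocks are peeled off a bounded number of times, until the rest is one-sided or so small that
  it can be spread over the first zero block.
\<close>

text \<open>The bookkeeping is additive. Splitting off a zero block turns the bounds b, c of the two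
  factors into b + \<eta> and c + 4/\<eta>. A bounded number of splittings is harmless, while
  splitting off single vectors costs a multiple of the dimension. Zero blocks must therefore have
  size proportional to n, and a rest without such blocks has to be treated as a whole. The gain in
  the induction comes from C having real dimension two. If k blocks of norm 1/k get first factors of
  norm b, they are kept apart by scalars in the unit disc with mutual distances of order b. The
  plane has room for b of order k^(-1/2), and with the inductive constant K the second factors have
  norm of order K (1/k) / b, that is, K k^(-1/2). On the real line b is at most of order 1/k and
  nothing is gained, hence the separate real argument.\<close>

section \<open>Real and complex scalars\<close>

text \<open>One class for both fields keeps the linear algebra common. Completeness serves the
  Neumann series of the Sylvester equation, \<open>heine_borel\<close> the compactness of the unit
  sphere.\<close>

class star_field = real_normed_field + banach + heine_borel +
  fixes cj :: "'a \<Rightarrow> 'a"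
  assumes cj_add [simp]: "cj (x + y) = cj x + cj y"
    and cj_mult [simp]: "cj (x * y) = cj x * cj y"
    and cj_cj [simp]: "cj (cj x) = x"
    and cj_mult_self_scaleR: "cj x * x = scaleR ((norm x)\<^sup>2) 1"

context star_field
begin

lemma cj_0 [simp]: "cj 0 = 0"
  using cj_add[of 0 0] by simp

lemma cj_minus [simp]: "cj (- x) = - cj x"
  using cj_add[of x "- x"] by (simp add: eq_neg_iff_add_eq_0 add.commute)

lemma cj_diff [simp]: "cj (x - y) = cj x - cj y"
  using cj_add[of x "- y"] by simp

lemma cj_sum: "cj (sum f I) = (\<Sum>i\<in>I. cj (f i))"
  by (induction I rule: infinite_finite_induct) auto

end

lemma cj_mult_self: "cj x * x = of_real ((norm x)\<^sup>2)" for x :: "'a::star_field"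
  by (simp add: cj_mult_self_scaleR of_real_def)

lemma norm_cj [simp]: "norm (cj x) = norm x" for x :: "'a::star_field"
proof (cases "x = 0")
  case False
  have "norm (cj x * x) = norm (of_real ((norm x)\<^sup>2) :: 'a)"
    by (simp only: cj_mult_self)
  then have "norm (cj x) * norm x = norm x * norm x"
    by (simp only: norm_mult norm_of_real) (simp add: power2_eq_square)
  then show ?thesis using False by simp
qed simp

lemma cj_eq_0_iff [simp]: "cj x = 0 \<longleftrightarrow> x = 0" for x :: "'a::star_field"
  by (metis norm_cj norm_eq_zero)

lemma cj_1 [simp]: "cj 1 = (1 :: 'a::star_field)"
proof -
  have "cj (1 :: 'a) * 1 = of_real ((norm (1 :: 'a))\<^sup>2)" by (rule cj_mult_self)
  then show ?thesis by simp
qed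

lemma cj_of_real [simp]: "cj (of_real r) = (of_real r :: 'a::star_field)"
proof (cases "r = 0")
  case False
  have "cj (of_real r) * of_real r = (of_real ((norm (of_real r :: 'a))\<^sup>2) :: 'a)"
    by (rule cj_mult_self)
  also have "\<dots> = of_real r * of_real r"
    by (simp only: norm_of_real power2_abs) (simp only: power2_eq_square of_real_mult)
  finally have "(cj (of_real r) - of_real r) * of_real r = (0 :: 'a)"
    by (simp only: left_diff_distrib diff_self)
  then show ?thesis using False by (simp only: mult_eq_0_iff of_real_eq_0_iff right_minus_eq) simp
qed simp

instantiation real :: star_field
begin
definition cj_real :: "real \<Rightarrow> real" where "cj_real x = x"
instance by standard (auto simp: cj_real_def power2_eq_square)
end

instantiation complex :: star_field
begin
definition cj_complex :: "complex \<Rightarrow> complex" where "cj_complex = cnj"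
instance
proof
  fix x y :: complex
  show "cj x * x = scaleR ((norm x)\<^sup>2) 1"
    using complex_norm_square[of x] by (simp add: cj_complex_def scaleR_conv_of_real mult.commute)
qed (simp_all add: cj_complex_def)
end

subsection \<open>Vectors and matrices on finite index sets\<close>

text \<open>Vectors are functions of which only the values on the index set count. Index sets may
  have any type, so sums \<open>T <+> R\<close> and products carry block decompositions and bases of
  mixed origin without renumbering.\<close>

definition ip :: "'i set \<Rightarrow> ('i \<Rightarrow> 'a::star_field) \<Rightarrow> ('i \<Rightarrow> 'a) \<Rightarrow> 'a" where
  "ip S x y = (\<Sum>i\<in>S. cj (x i) * y i)"

definition nrm :: "'i set \<Rightarrow> ('i \<Rightarrow> 'a::real_normed_vector) \<Rightarrow> real" where
  "nrm S x = L2_set (\<lambda>i. norm (x i)) S"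

definition mv :: "'i set \<Rightarrow> ('k \<Rightarrow> 'i \<Rightarrow> 'a::comm_ring) \<Rightarrow> ('i \<Rightarrow> 'a) \<Rightarrow> 'k \<Rightarrow> 'a" where
  "mv S M x = (\<lambda>i. \<Sum>j\<in>S. M i j * x j)"

definition mm :: "'i set \<Rightarrow> ('k \<Rightarrow> 'i \<Rightarrow> 'a::comm_ring) \<Rightarrow> ('i \<Rightarrow> 'j \<Rightarrow> 'a) \<Rightarrow> 'k \<Rightarrow> 'j \<Rightarrow> 'a" where
  "mm S A B = (\<lambda>i k. \<Sum>j\<in>S. A i j * B j k)"

definition adj :: "('i \<Rightarrow> 'k \<Rightarrow> 'a::star_field) \<Rightarrow> 'k \<Rightarrow> 'i \<Rightarrow> 'a" where
  "adj M = (\<lambda>i j. cj (M j i))"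

definition bnd :: "'k set \<Rightarrow> 'i set \<Rightarrow> ('k \<Rightarrow> 'i \<Rightarrow> 'a::real_normed_field) \<Rightarrow> real \<Rightarrow> bool" where
  "bnd T S M c \<longleftrightarrow> (\<forall>x. nrm T (mv S M x) \<le> c * nrm S x)"

text \<open>The two bounds are kept apart although only their product matters in the end: peeling
  and block assembly change each of them additively, and \<open>cm_rescale\<close> trades one for
  the other.\<close>

definition cm :: "'i set \<Rightarrow> ('i \<Rightarrow> 'i \<Rightarrow> 'a::real_normed_field) \<Rightarrow> real \<Rightarrow> real \<Rightarrow> bool" where
  "cm S M b c \<longleftrightarrow> (\<exists>B C. (\<forall>i\<in>S. \<forall>j\<in>S. M i j = mm S B C i j - mm S C B i j) \<and>
     bnd S S B b \<and> bnd S S C c)"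

lemma nrm_nonneg [simp]: "0 \<le> nrm S x"
  by (simp add: nrm_def L2_set_nonneg)

lemma nrm_sq: "(nrm S x)\<^sup>2 = (\<Sum>i\<in>S. (norm (x i))\<^sup>2)"
  by (simp add: nrm_def L2_set_def sum_nonneg)

lemma nrm_cong: "(\<And>i. i \<in> S \<Longrightarrow> x i = y i) \<Longrightarrow> nrm S x = nrm S y"
  unfolding nrm_def by (rule L2_set_cong) auto

lemma nrm_zero [simp]: "nrm S (\<lambda>i. 0) = 0"
  by (simp add: nrm_def L2_set_def)

lemma nrm_empty [simp]: "nrm {} x = 0"
  by (simp add: nrm_def)

lemma nrm_add: "nrm S (\<lambda>i. x i + y i) \<le> nrm S x + nrm S y"
proof -
  have "nrm S (\<lambda>i. x i + y i) \<le> L2_set (\<lambda>i. norm (x i) + norm (y i)) S"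
    unfolding nrm_def by (rule L2_set_mono) (auto intro: norm_triangle_ineq)
  also have "\<dots> \<le> nrm S x + nrm S y"
    unfolding nrm_def by (rule L2_set_triangle_ineq)
  finally show ?thesis .
qed

lemma nrm_smult: "nrm S (\<lambda>i. c * x i) = norm c * nrm S x" for c :: "'a::real_normed_field"
  unfolding nrm_def norm_mult by (rule L2_set_right_distrib[symmetric]) auto

lemma nrm_sum: "nrm S (\<lambda>i. \<Sum>k\<in>K. f k i) \<le> (\<Sum>k\<in>K. nrm S (f k))"
proof (induction K rule: infinite_finite_induct)
  case (insert k K)
  then show ?case
    using nrm_add[of S "f k" "\<lambda>i. \<Sum>k\<in>K. f k i"] by simp
qed auto

lemma nrm_mono_set: "S' \<subseteq> S \<Longrightarrow> finite S \<Longrightarrow> nrm S' x \<le> nrm S x"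
  unfolding nrm_def L2_set_def by (intro real_sqrt_le_mono sum_mono2) auto

lemma nrm_zero_outside:
  assumes "finite S" "S' \<subseteq> S" "\<And>i. i \<in> S - S' \<Longrightarrow> x i = 0"
  shows "nrm S x = nrm S' x"
  unfolding nrm_def L2_set_def
  by (intro arg_cong[where f = sqrt] sum.mono_neutral_right) (use assms in auto)

lemma nrm_component_le: "finite S \<Longrightarrow> i \<in> S \<Longrightarrow> norm (x i) \<le> nrm S x"
  unfolding nrm_def by (rule member_le_L2_set[where f = "\<lambda>i. norm (x i)"]) auto

lemma nrm_eq_0_iff: "finite S \<Longrightarrow> nrm S x = 0 \<longleftrightarrow> (\<forall>i\<in>S. x i = 0)"
  unfolding nrm_def by (simp add: L2_set_eq_0_iff)

lemma nrm_le_cw: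
  assumes "\<And>i. i \<in> S \<Longrightarrow> norm (x i) \<le> c * norm (y i)" "0 \<le> c"
  shows "nrm S x \<le> c * nrm S y"
proof -
  have "nrm S x \<le> L2_set (\<lambda>i. c * norm (y i)) S"
    unfolding nrm_def by (rule L2_set_mono) (use assms in auto)
  also have "\<dots> = c * nrm S y"
    unfolding nrm_def by (rule L2_set_right_distrib[symmetric]) (use assms in auto)
  finally show ?thesis .
qed

lemma ip_self: "ip S x x = of_real ((nrm S x)\<^sup>2)"
  by (simp add: ip_def cj_mult_self nrm_sq del: of_real_power)

lemma cj_ip [simp]: "cj (ip S x y) = ip S y x"
  by (simp add: ip_def cj_sum mult.commute)

lemma ip_add_right: "ip S x (\<lambda>i. y i + z i) = ip S x y + ip S x z"
  by (simp add: ip_def algebra_simps sum.distrib)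

lemma ip_add_left: "ip S (\<lambda>i. y i + z i) x = ip S y x + ip S z x"
  by (simp add: ip_def algebra_simps sum.distrib)

lemma ip_diff_right: "ip S x (\<lambda>i. y i - z i) = ip S x y - ip S x z"
  by (simp add: ip_def algebra_simps sum_subtractf)

lemma ip_diff_left: "ip S (\<lambda>i. y i - z i) x = ip S y x - ip S z x"
  by (simp add: ip_def algebra_simps sum_subtractf)

lemma ip_smult_right: "ip S x (\<lambda>i. c * y i) = c * ip S x y"
  by (simp add: ip_def algebra_simps sum_distrib_left)

lemma ip_smult_left: "ip S (\<lambda>i. c * y i) x = cj c * ip S y x"
  by (simp add: ip_def algebra_simps sum_distrib_left)

lemma ip_sum_right: "ip S x (\<lambda>i. \<Sum>k\<in>K. f k i) = (\<Sum>k\<in>K. ip S x (f k))"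
  by (simp add: ip_def sum_distrib_left sum.swap[of _ S K])

lemma ip_sum_left: "ip S (\<lambda>i. \<Sum>k\<in>K. f k i) x = (\<Sum>k\<in>K. ip S (f k) x)"
  by (simp add: ip_def sum_distrib_right sum.swap[of _ S K] cj_sum)

lemma ip_zero [simp]: "ip S x (\<lambda>i. 0) = 0" "ip S (\<lambda>i. 0) x = 0"
  by (simp_all add: ip_def)

lemma ip_cong: "(\<And>i. i \<in> S \<Longrightarrow> x i = x' i) \<Longrightarrow> (\<And>i. i \<in> S \<Longrightarrow> y i = y' i) \<Longrightarrow> ip S x y = ip S x' y'"
  unfolding ip_def by (rule sum.cong) auto

lemma ip_CS: "norm (ip S x y) \<le> nrm S x * nrm S y"
proof -
  have "norm (ip S x y) \<le> (\<Sum>i\<in>S. \<bar>norm (x i)\<bar> * \<bar>norm (y i)\<bar>)"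
    unfolding ip_def by (rule sum_norm_le) (simp add: norm_mult)
  also have "\<dots> \<le> nrm S x * nrm S y"
    unfolding nrm_def by (rule L2_set_mult_ineq)
  finally show ?thesis .
qed

lemma nrm_leI_ip:
  assumes "\<And>y. norm (ip S y x) \<le> c * nrm S y" "0 \<le> c"
  shows "nrm S x \<le> c"
proof (cases "nrm S x = 0")
  case True
  then show ?thesis using assms by simp
next
  case False
  have "(nrm S x)\<^sup>2 = norm (ip S x x)" by (simp add: ip_self norm_power)
  also have "\<dots> \<le> c * nrm S x" by (rule assms)
  finally show ?thesis using False
    by (simp add: power2_eq_square order_less_le)
qed

lemma mv_add: "mv S M (\<lambda>i. x i + y i) = (\<lambda>i. mv S M x i + mv S M y i)"
  by (simp add: mv_def algebra_simps sum.distrib)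

lemma mv_smult: "mv S M (\<lambda>i. c * x i) = (\<lambda>i. c * mv S M x i)"
  by (simp add: mv_def algebra_simps sum_distrib_left)

lemma mv_sum: "mv S M (\<lambda>i. \<Sum>k\<in>K. f k i) = (\<lambda>i. \<Sum>k\<in>K. mv S M (f k) i)"
  by (simp add: mv_def sum_distrib_left sum.swap[of _ S K])

lemma mv_cong: "(\<And>j. j \<in> S \<Longrightarrow> x j = y j) \<Longrightarrow> mv S M x = mv S M y"
  unfolding mv_def by (intro ext sum.cong) auto

lemma mv_cong_mat: "(\<And>j. j \<in> S \<Longrightarrow> M i j = M' i j) \<Longrightarrow> mv S M x i = mv S M' x i"
  unfolding mv_def by (intro sum.cong) auto

lemma mv_mm: "mv S (mm T A B) x = mv T A (mv S B x)"
  by (rule ext) (simp add: mv_def mm_def sum_distrib_left sum_distrib_right sum.swap[of _ S T] mult.assoc)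

lemma mm_assoc: "mm S A (mm T B C) = mm T (mm S A B) C"
  by (intro ext) (simp add: mm_def sum_distrib_left sum_distrib_right sum.swap[of _ S T] mult.assoc)

lemma mm_cong: "(\<And>j. j \<in> S \<Longrightarrow> A i j = A' i j) \<Longrightarrow> (\<And>j. j \<in> S \<Longrightarrow> B j k = B' j k) \<Longrightarrow>
    mm S A B i k = mm S A' B' i k"
  unfolding mm_def by (rule sum.cong) auto

lemma ip_adj: "ip T y (mv S M x) = ip S (mv T (adj M) y) x"
  by (simp add: ip_def mv_def adj_def sum_distrib_left sum_distrib_right cj_sum sum.swap[of _ S T] mult.assoc)
    (simp add: mult.left_commute mult.commute)

lemma adj_adj [simp]: "adj (adj M) = M"
  by (simp add: adj_def)

lemma bndD: "bnd T S M c \<Longrightarrow> nrm T (mv S M x) \<le> c * nrm S x"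
  by (simp add: bnd_def)

lemma bnd_form: "bnd T S M c \<Longrightarrow> norm (ip T y (mv S M x)) \<le> c * nrm T y * nrm S x"
proof -
  assume "bnd T S M c"
  have "norm (ip T y (mv S M x)) \<le> nrm T y * nrm T (mv S M x)" by (rule ip_CS)
  also have "\<dots> \<le> nrm T y * (c * nrm S x)"
    by (intro mult_left_mono bndD \<open>bnd T S M c\<close>) auto
  finally show ?thesis by (simp add: mult_ac)
qed

lemma bndI_form:
  assumes "\<And>x y. norm (ip T y (mv S M x)) \<le> c * nrm T y * nrm S x" "0 \<le> c"
  shows "bnd T S M c"
  unfolding bnd_def
proof
  fix x
  show "nrm T (mv S M x) \<le> c * nrm S x"
    by (rule nrm_leI_ip) (use assms(1)[of _ x] assms(2) in \<open>auto simp: mult_ac\<close>)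
qed

lemma bnd_mono: "bnd T S M c \<Longrightarrow> c \<le> c' \<Longrightarrow> bnd T S M c'"
  unfolding bnd_def by (meson mult_right_mono nrm_nonneg order_trans)

lemma bnd_cong:
  assumes "\<And>i j. i \<in> T \<Longrightarrow> j \<in> S \<Longrightarrow> M i j = M' i j"
  shows "bnd T S M c \<longleftrightarrow> bnd T S M' c"
proof -
  have "nrm T (mv S M x) = nrm T (mv S M' x)" for x
    by (intro nrm_cong mv_cong_mat) (use assms in auto)
  then show ?thesis by (simp add: bnd_def)
qed

lemma bnd_adj: "bnd T S M c \<Longrightarrow> 0 \<le> c \<Longrightarrow> bnd S T (adj M) c"
proof (rule bndI_form)
  fix x y
  assume M: "bnd T S M c"
  have "norm (ip S y (mv T (adj M) x)) = norm (ip S (mv T (adj M) x) y)"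
    by (metis cj_ip norm_cj)
  also have "\<dots> = norm (ip T x (mv S M y))" by (simp add: ip_adj)
  also have "\<dots> \<le> c * nrm S y * nrm T x"
    using bnd_form[OF M, of x y] by (simp add: mult_ac)
  finally show "norm (ip S y (mv T (adj M) x)) \<le> c * nrm S y * nrm T x" .
qed auto

lemma bnd_add: "bnd T S A a \<Longrightarrow> bnd T S B b \<Longrightarrow> bnd T S (\<lambda>i j. A i j + B i j) (a + b)"
  unfolding bnd_def
proof
  fix x
  assume A: "\<forall>x. nrm T (mv S A x) \<le> a * nrm S x" and B: "\<forall>x. nrm T (mv S B x) \<le> b * nrm S x"
  have "mv S (\<lambda>i j. A i j + B i j) x = (\<lambda>i. mv S A x i + mv S B x i)"
    by (simp add: mv_def algebra_simps sum.distrib)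
  then show "nrm T (mv S (\<lambda>i j. A i j + B i j) x) \<le> (a + b) * nrm S x"
    using nrm_add[of T "mv S A x" "mv S B x"] A B by (simp add: algebra_simps) (smt (verit))
qed

lemma bnd_smult: "bnd T S A a \<Longrightarrow> bnd T S (\<lambda>i j. c * A i j) (norm c * a)"
  unfolding bnd_def
proof
  fix x
  assume A: "\<forall>x. nrm T (mv S A x) \<le> a * nrm S x"
  have "mv S (\<lambda>i j. c * A i j) x = (\<lambda>i. c * mv S A x i)"
    by (simp add: mv_def sum_distrib_left mult.assoc)
  then show "nrm T (mv S (\<lambda>i j. c * A i j) x) \<le> (norm c * a) * nrm S x"
    using A by (simp add: nrm_smult mult_left_mono mult.assoc)
qed

lemma bnd_minus: "bnd T S A a \<Longrightarrow> bnd T S (\<lambda>i j. - A i j) a"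
  using bnd_smult[of T S A a "-1"] by simp

lemma bnd_diff: "bnd T S A a \<Longrightarrow> bnd T S B b \<Longrightarrow> bnd T S (\<lambda>i j. A i j - B i j) (a + b)"
  using bnd_add[of T S A a "\<lambda>i j. - B i j" b] bnd_minus[of T S B b] by simp

lemma bnd_mm: "bnd T U A a \<Longrightarrow> bnd U S B b \<Longrightarrow> 0 \<le> a \<Longrightarrow> bnd T S (mm U A B) (a * b)"
  unfolding bnd_def mv_mm
proof
  fix x
  assume A: "\<forall>x. nrm T (mv U A x) \<le> a * nrm U x" and B: "\<forall>x. nrm U (mv S B x) \<le> b * nrm S x"
    and "0 \<le> a"
  have "nrm T (mv U A (mv S B x)) \<le> a * nrm U (mv S B x)" using A by auto
  also have "\<dots> \<le> a * (b * nrm S x)" using B \<open>0 \<le> a\<close> by (intro mult_left_mono) auto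
  finally show "nrm T (mv U A (mv S B x)) \<le> a * b * nrm S x" by (simp add: mult.assoc)
qed

lemma bnd_zero: "0 \<le> c \<Longrightarrow> bnd T S (\<lambda>i j. 0) c"
  by (simp add: bnd_def mv_def)

lemma bnd_subset:
  fixes M :: "'k \<Rightarrow> 'i \<Rightarrow> 'a::real_normed_field"
  assumes "bnd T S M c" "T' \<subseteq> T" "S' \<subseteq> S" "finite T" "finite S"
  shows "bnd T' S' M c"
  unfolding bnd_def
proof
  fix x :: "'i \<Rightarrow> 'a"
  define y where "y = (\<lambda>j. if j \<in> S' then x j else 0)"
  have "mv S' M x = mv S M y"
    unfolding mv_def y_def by (intro ext sum.mono_neutral_cong_left) (use assms in auto)
  then have "nrm T' (mv S' M x) \<le> nrm T (mv S M y)"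
    using assms by (auto intro: nrm_mono_set)
  also have "\<dots> \<le> c * nrm S y" by (rule bndD[OF assms(1)])
  also have "nrm S y = nrm S' y"
    by (rule nrm_zero_outside) (use assms in \<open>auto simp: y_def\<close>)
  also have "nrm S' y = nrm S' x" by (rule nrm_cong) (auto simp: y_def)
  finally show "nrm T' (mv S' M x) \<le> c * nrm S' x" .
qed

lemma mv_unit: "finite S \<Longrightarrow> j \<in> S \<Longrightarrow> mv S M (\<lambda>k. if k = j then 1 else 0) i = M i j"
  for M :: "'k \<Rightarrow> 'i \<Rightarrow> 'a::comm_ring_1"
  by (simp add: mv_def if_distrib sum.delta cong: if_cong)

lemma nrm_unit:
  assumes "finite S" "j \<in> S"
  shows "nrm S (\<lambda>k. if k = j then 1 else 0 :: 'a::real_normed_field) = 1"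
proof -
  have "(nrm S (\<lambda>k. if k = j then 1 else 0 :: 'a))\<^sup>2 = (\<Sum>i\<in>S. if i = j then 1 else 0)"
    unfolding nrm_sq by (rule sum.cong) auto
  also have "\<dots> = 1" using assms by simp
  finally show ?thesis by (simp add: power2_eq_1_iff) (smt (verit) nrm_nonneg)
qed

lemma bnd_entry: "bnd T S M c \<Longrightarrow> finite T \<Longrightarrow> finite S \<Longrightarrow> i \<in> T \<Longrightarrow> j \<in> S \<Longrightarrow> norm (M i j) \<le> c"
  using nrm_component_le[of T i "mv S M (\<lambda>k. if k = j then 1 else 0)"]
    bndD[of T S M c "\<lambda>k. if k = j then 1 else 0"] by (simp add: mv_unit nrm_unit)

lemma bnd_diag:
  fixes d :: "'i \<Rightarrow> 'a::real_normed_field"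
  assumes "finite S" "\<And>i. i \<in> S \<Longrightarrow> norm (d i) \<le> c" "0 \<le> c"
  shows "bnd S S (\<lambda>i j. if i = j then d i else 0) c"
  unfolding bnd_def
proof
  fix x :: "'i \<Rightarrow> 'a"
  have "mv S (\<lambda>i j. if i = j then d i else 0) x i = d i * x i" if "i \<in> S" for i
    using that assms(1) by (simp add: mv_def if_distrib[of "\<lambda>z. z * _"] sum.delta cong: if_cong)
  then show "nrm S (mv S (\<lambda>i j. if i = j then d i else 0) x) \<le> c * nrm S x"
    by (intro nrm_le_cw) (use assms in \<open>auto simp: norm_mult intro!: mult_right_mono\<close>)
qed

section \<open>Elementary rules for commutator representations\<close>

lemma cm_mono: "cm S M b c \<Longrightarrow> b \<le> b' \<Longrightarrow> c \<le> c' \<Longrightarrow> cm S M b' c'"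
  unfolding cm_def by (meson bnd_mono)

lemma cm_cong: "(\<And>i j. i \<in> S \<Longrightarrow> j \<in> S \<Longrightarrow> M i j = M' i j) \<Longrightarrow> cm S M b c \<longleftrightarrow> cm S M' b c"
  unfolding cm_def by (intro ex_cong1) auto

lemma cm_zero:
  assumes "\<And>i j. i \<in> S \<Longrightarrow> j \<in> S \<Longrightarrow> M i j = 0" "0 \<le> b" "0 \<le> c"
  shows "cm S M b c"
  unfolding cm_def
  by (rule exI[of _ "\<lambda>i j. 0"], rule exI[of _ "\<lambda>i j. 0"])
    (use assms in \<open>auto simp: mm_def intro: bnd_zero\<close>)

lemma cm_rescale:
  assumes "cm S M b c" "0 < r"
  shows "cm S M (r * b) (c / r)"
proof -
  from assms obtain B C where BC: "\<forall>i\<in>S. \<forall>j\<in>S. M i j = mm S B C i j - mm S C B i j"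
    "bnd S S B b" "bnd S S C c" unfolding cm_def by auto
  show ?thesis unfolding cm_def
  proof (intro exI conjI ballI)
    show "bnd S S (\<lambda>i j. of_real r * B i j) (r * b)"
      using bnd_smult[OF BC(2), of "of_real r"] assms by simp
    show "bnd S S (\<lambda>i j. of_real (1 / r) * C i j) (c / r)"
      using bnd_smult[OF BC(3), of "of_real (1 / r)"] assms by (simp add: norm_divide)
    fix i j assume "i \<in> S" "j \<in> S"
    then show "M i j = mm S (\<lambda>i j. of_real r * B i j) (\<lambda>i j. of_real (1 / r) * C i j) i j -
      mm S (\<lambda>i j. of_real (1 / r) * C i j) (\<lambda>i j. of_real r * B i j) i j"
      using BC(1) assms by (simp add: mm_def)
  qed
qed

lemma cm_smult:
  assumes "cm S M b c"
  shows "cm S (\<lambda>i j. z * M i j) b (norm z * c)"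
proof -
  from assms obtain B C where BC: "\<forall>i\<in>S. \<forall>j\<in>S. M i j = mm S B C i j - mm S C B i j"
    "bnd S S B b" "bnd S S C c" unfolding cm_def by auto
  show ?thesis unfolding cm_def
  proof (intro exI conjI ballI)
    show "bnd S S B b" by (rule BC)
    show "bnd S S (\<lambda>i j. z * C i j) (norm z * c)"
      using bnd_smult[OF BC(3), of z] .
    fix i j assume "i \<in> S" "j \<in> S"
    then show "z * M i j = mm S B (\<lambda>i j. z * C i j) i j - mm S (\<lambda>i j. z * C i j) B i j"
      using BC(1) by (simp add: mm_def sum_distrib_left mult_ac right_diff_distrib)
  qed
qed

subsection \<open>Orthonormal families\<close>

definition onf :: "'i set \<Rightarrow> 'j set \<Rightarrow> ('j \<Rightarrow> 'i \<Rightarrow> 'a::star_field) \<Rightarrow> bool" where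
  "onf S T u \<longleftrightarrow> (\<forall>p\<in>T. \<forall>q\<in>T. ip S (u p) (u q) = (if p = q then 1 else 0))"

definition lin :: "'j set \<Rightarrow> ('j \<Rightarrow> 'i \<Rightarrow> 'a::star_field) \<Rightarrow> ('j \<Rightarrow> 'a) \<Rightarrow> 'i \<Rightarrow> 'a" where
  "lin T u c = (\<lambda>i. \<Sum>p\<in>T. c p * u p i)"

text \<open>For an orthonormal family this is the compression of \<open>M\<close> to its span, and a
  unitary change of basis when the family is a full basis.\<close>

definition fmx :: "'i set \<Rightarrow> ('i \<Rightarrow> 'i \<Rightarrow> 'a::star_field) \<Rightarrow> ('j \<Rightarrow> 'i \<Rightarrow> 'a) \<Rightarrow> 'j \<Rightarrow> 'j \<Rightarrow> 'a" where
  "fmx S M u = (\<lambda>p q. ip S (u p) (mv S M (u q)))"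

definition tr :: "'i set \<Rightarrow> ('i \<Rightarrow> 'i \<Rightarrow> 'a::comm_monoid_add) \<Rightarrow> 'a" where
  "tr S M = (\<Sum>i\<in>S. M i i)"

lemma onfD: "onf S T u \<Longrightarrow> p \<in> T \<Longrightarrow> q \<in> T \<Longrightarrow> ip S (u p) (u q) = (if p = q then 1 else 0)"
  by (simp add: onf_def)

lemma normalizing_factor:
  fixes x :: "'i \<Rightarrow> 'a::real_normed_field"
  assumes "nrm S x \<noteq> 0"
  shows "\<exists>c. c \<noteq> 0 \<and> nrm S (\<lambda>i. c * x i) = 1"
  by (rule exI[of _ "of_real (1 / nrm S x)"])
    (use assms in \<open>simp only: nrm_smult norm_of_real, simp\<close>)

text \<open>Gaussian elimination: a condition with a nonzero coefficient at \<open>s\<close>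
  determines the coordinate \<open>s\<close>, and the others, with \<open>s\<close> eliminated, are
  fewer conditions on \<open>S - {s}\<close>.\<close>

lemma nonzero_null_vector:
  fixes g :: "'j \<Rightarrow> 'i \<Rightarrow> 'a::star_field"
  assumes "finite J" "finite S" "card J < card S"
  shows "\<exists>x. (\<exists>i\<in>S. x i \<noteq> 0) \<and> (\<forall>j\<in>J. ip S (g j) x = 0)"
  using assms
proof (induction J arbitrary: S g rule: finite_induct)
  case empty
  then have "S \<noteq> {}" by auto
  then show ?case by (intro exI[of _ "\<lambda>_. 1"]) auto
next
  case (insert j J)
  show ?case
  proof (cases "\<forall>i\<in>S. g j i = 0")
    case True
    then have "ip S (g j) x = 0" for x by (simp add: ip_def)
    moreover have "card J < card S" using insert by simp
    ultimately show ?thesis using insert.IH[of S g] insert.prems by auto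
  next
    case False
    then obtain s where s: "s \<in> S" "g j s \<noteq> 0" by auto
    define r where "r l = cj (g l s) / cj (g j s)" for l
    define h where "h l = (\<lambda>i. g l i - cj (r l) * g j i)" for l
    have "card J < card (S - {s})" using insert s by simp
    then obtain y where y: "\<exists>i\<in>S - {s}. y i \<noteq> 0" "\<forall>l\<in>J. ip (S - {s}) (h l) y = 0"
      using insert.IH[of "S - {s}" h] insert.prems by auto
    define x where "x = (\<lambda>i. if i = s then - ip (S - {s}) (g j) y / cj (g j s) else y i)"
    have split: "ip S v x = cj (v s) * x s + ip (S - {s}) v y" for v
    proof -
      have "ip S v x = cj (v s) * x s + ip (S - {s}) v x"
        unfolding ip_def using s insert.prems by (simp add: sum.remove)
      also have "ip (S - {s}) v x = ip (S - {s}) v y"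
        by (rule ip_cong) (auto simp: x_def)
      finally show ?thesis .
    qed
    have j0: "ip S (g j) x = 0"
      using s by (simp add: split) (simp add: x_def)
    have "ip S (g l) x = 0" if "l \<in> J" for l
    proof -
      have "ip (S - {s}) (g l) y = r l * ip (S - {s}) (g j) y"
        using y(2) that by (simp add: h_def ip_diff_left ip_smult_left)
      then show ?thesis using s
        by (simp add: split) (simp add: x_def r_def)
    qed
    then show ?thesis using j0 y(1) by (intro exI[of _ x]) (auto simp: x_def)
  qed
qed

lemma null_vector:
  fixes g :: "'j \<Rightarrow> 'i \<Rightarrow> 'a::star_field"
  assumes "finite J" "finite S" "card J < card S"
  shows "\<exists>x. nrm S x = 1 \<and> (\<forall>i. i \<notin> S \<longrightarrow> x i = 0) \<and> (\<forall>j\<in>J. ip S (g j) x = 0)"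
proof -
  obtain x where x: "\<exists>i\<in>S. x i \<noteq> 0" "\<forall>j\<in>J. ip S (g j) x = 0"
    using nonzero_null_vector[OF assms, of g] by auto
  have "nrm S x \<noteq> 0" using x(1) assms nrm_eq_0_iff by blast
  then obtain c where c: "c \<noteq> 0" "nrm S (\<lambda>i. c * x i) = 1" using normalizing_factor by blast
  define y where "y = (\<lambda>i. if i \<in> S then c * x i else 0)"
  have "nrm S y = nrm S (\<lambda>i. c * x i)"
    by (rule nrm_cong) (simp add: y_def)
  then have "nrm S y = 1" using c by simp
  moreover have "ip S (g j) y = 0" if "j \<in> J" for j
  proof -
    have "ip S (g j) y = ip S (g j) (\<lambda>i. c * x i)"
      by (rule ip_cong) (simp_all add: y_def)
    then show ?thesis using x(2) that by (simp add: ip_smult_right)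
  qed
  ultimately show ?thesis by (intro exI[of _ y]) (auto simp: y_def)
qed

lemma ip_self_1: "nrm S x = 1 \<Longrightarrow> ip S x x = 1"
  by (simp add: ip_self)

lemma onf_nrm: "onf S T u \<Longrightarrow> p \<in> T \<Longrightarrow> nrm S (u p) = 1"
proof -
  assume "onf S T u" "p \<in> T"
  then have "(of_real ((nrm S (u p))\<^sup>2) :: 'c) = of_real 1"
    using onfD[of S T u p p] by (simp add: ip_self)
  then have "(nrm S (u p))\<^sup>2 = 1" by (simp only: of_real_eq_iff)
  then show ?thesis by (simp add: power2_eq_1_iff) (smt (verit) nrm_nonneg)
qed

text \<open>This count replaces orthogonal complements and Gram-Schmidt throughout. Vanishing
  outside \<open>S\<close> lets the vectors be read over a larger index set.\<close>

lemma null_family: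
  fixes g :: "'j \<Rightarrow> 'i \<Rightarrow> 'a::star_field"
  assumes "finite J" "finite S" "card J + N \<le> card S"
  shows "\<exists>w. onf S {..<N} w \<and> (\<forall>k<N. \<forall>i. i \<notin> S \<longrightarrow> w k i = 0) \<and> (\<forall>k<N. \<forall>j\<in>J. ip S (g j) (w k) = 0)"
  using assms(3)
proof (induction N)
  case 0
  then show ?case by (auto simp: onf_def)
next
  case (Suc N)
  then obtain w where w: "onf S {..<N} w" "\<forall>k<N. \<forall>i. i \<notin> S \<longrightarrow> w k i = 0"
    "\<forall>k<N. \<forall>j\<in>J. ip S (g j) (w k) = 0" by auto
  obtain x where x: "nrm S x = 1" "\<forall>i. i \<notin> S \<longrightarrow> x i = 0"
     "\<forall>j\<in>J <+> {..<N}. ip S (case_sum g w j) x = 0"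
    using null_vector[of "J <+> {..<N}" S "case_sum g w"] assms Suc.prems by (auto simp: card_Plus)
  have x0: "ip S (w k) x = 0" if "k < N" for k
    using x(3) that by (metis InrI lessThan_iff sum.case(2))
  have x0': "ip S x (w k) = 0" if "k < N" for k
    using x0[OF that] by (metis cj_ip cj_0)
  have xg: "ip S (g j) x = 0" if "j \<in> J" for j
    using x(3) that by (metis InlI sum.case(1))
  show ?case
    by (intro exI[of _ "w(N := x)"] conjI)
      (use w x x0 x0' xg in \<open>auto simp: onf_def less_Suc_eq ip_self_1\<close>)
qed

lemma ip_lin_right: "ip S x (lin T u c) = (\<Sum>p\<in>T. c p * ip S x (u p))"
  by (simp add: lin_def ip_sum_right ip_smult_right)

lemma ip_lin_left: "ip S (lin T u c) x = (\<Sum>p\<in>T. cj (c p) * ip S (u p) x)"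
  by (simp add: lin_def ip_sum_left ip_smult_left)

lemma ip_lin_lin:
  assumes "onf S T u" "finite T"
  shows "ip S (lin T u c) (lin T u d) = ip T c d"
proof -
  have "ip S (u p) (lin T u d) = d p" if "p \<in> T" for p
  proof -
    have "ip S (u p) (lin T u d) = (\<Sum>q\<in>T. if p = q then d q else 0)"
      unfolding ip_lin_right by (rule sum.cong) (use assms that in \<open>auto simp: onfD\<close>)
    then show ?thesis using assms that by simp
  qed
  then show ?thesis unfolding ip_lin_left by (simp add: ip_def[of T])
qed

lemma nrm_lin: "onf S T u \<Longrightarrow> finite T \<Longrightarrow> nrm S (lin T u c) = nrm T c"
proof -
  assume "onf S T u" "finite T"
  then have "(of_real ((nrm S (lin T u c))\<^sup>2) :: 'c) = of_real ((nrm T c)\<^sup>2)"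
    by (simp only: ip_self[symmetric] ip_lin_lin)
  then have "(nrm S (lin T u c))\<^sup>2 = (nrm T c)\<^sup>2" by (simp only: of_real_eq_iff)
  then show ?thesis by (simp add: power2_eq_iff_nonneg)
qed

text \<open>With more vectors than coordinates some combination with coefficients of norm 1 would be
  zero, but \<open>lin\<close> is isometric.\<close>

lemma onf_card_le:
  fixes u :: "'j \<Rightarrow> 'i \<Rightarrow> 'a::star_field"
  assumes "onf S T u" "finite S" "finite T"
  shows "card T \<le> card S"
proof (rule ccontr)
  assume "\<not> card T \<le> card S"
  then obtain c where c: "nrm T c = 1" "\<forall>i\<in>S. ip T (\<lambda>p. cj (u p i)) c = 0"
    using null_vector[of S T "\<lambda>i p. cj (u p i)"] assms by auto
  have "lin T u c i = 0" if "i \<in> S" for i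
    using c(2) that by (simp add: lin_def ip_def mult.commute)
  then have "nrm S (lin T u c) = 0" using nrm_eq_0_iff assms by blast
  then show False using nrm_lin[OF assms(1,3), of c] c by simp
qed

text \<open>If the expansion failed, the normalised residue could be adjoined to the family, against
  \<open>onf_card_le\<close>.\<close>

lemma onf_expand:
  fixes u :: "'j \<Rightarrow> 'i \<Rightarrow> 'a::star_field"
  assumes "onf S T u" "finite S" "finite T" "card T = card S" "i \<in> S"
  shows "x i = (\<Sum>p\<in>T. ip S (u p) x * u p i)"
proof (rule ccontr)
  assume ne: "\<not> ?thesis"
  define r where "r = (\<lambda>i. x i - lin T u (\<lambda>p. ip S (u p) x) i)"
  have rp: "nrm S r \<noteq> 0" using ne assms by (simp add: nrm_eq_0_iff r_def lin_def) (metis eq_iff_diff_eq_0)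
  have ur: "ip S (u p) r = 0" if "p \<in> T" for p
  proof -
    have "ip S (u p) (lin T u (\<lambda>p. ip S (u p) x)) = (\<Sum>q\<in>T. if p = q then ip S (u q) x else 0)"
      unfolding ip_lin_right by (rule sum.cong) (use assms that in \<open>auto simp: onfD\<close>)
    then show ?thesis using that assms by (simp add: r_def ip_diff_right)
  qed
  then have ru: "ip S r (u p) = 0" if "p \<in> T" for p
    using that by (metis cj_ip cj_0)
  obtain c where c: "nrm S (\<lambda>i. c * r i) = 1" using normalizing_factor[OF rp] by blast
  define y where "y = (\<lambda>i. c * r i)"
  have y1: "nrm S y = 1" using c by (simp add: y_def)
  have "onf S (insert None (Some ` T)) (\<lambda>q. case q of None \<Rightarrow> y | Some p \<Rightarrow> u p)"
    unfolding onf_def using assms(1) ur ru y1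
    by (auto simp: onfD ip_self_1) (auto simp: y_def ip_smult_left ip_smult_right)
  then have "card (insert None (Some ` T)) \<le> card S"
    by (rule onf_card_le) (use assms in auto)
  moreover have "card (insert None (Some ` T)) = Suc (card T)"
    using assms by (subst card_insert_disjoint) (auto simp: card_image)
  ultimately show False using assms by simp
qed

lemma fmx_eq_mm: "fmx S M u = mm S (adj (\<lambda>i p. u p i)) (mm S M (\<lambda>i p. u p i))"
  by (intro ext) (simp add: fmx_def mm_def ip_def mv_def adj_def)

lemma mv_col: "mv T (\<lambda>i p. u p i) c = lin T u c"
  by (rule ext) (simp add: mv_def lin_def mult.commute)

lemma onf_bnd: "onf S T u \<Longrightarrow> finite T \<Longrightarrow> bnd S T (\<lambda>i p. u p i) 1"
  by (simp add: bnd_def mv_col nrm_lin)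

lemma bnd_fmx: "onf S T u \<Longrightarrow> finite T \<Longrightarrow> bnd S S M c \<Longrightarrow> bnd T T (fmx S M u) c"
proof -
  assume *: "onf S T u" "finite T" "bnd S S M c"
  show ?thesis unfolding bnd_def
  proof
    fix x
    have "nrm T (mv T (fmx S M u) x) = nrm T (mv S (adj (\<lambda>i p. u p i)) (mv S M (lin T u x)))"
      by (simp add: fmx_eq_mm mv_mm mv_col[of T u])
    also have "\<dots> \<le> 1 * nrm S (mv S M (lin T u x))"
      by (rule bndD[OF bnd_adj[OF onf_bnd]]) (use * in auto)
    also have "\<dots> \<le> c * nrm S (lin T u x)" using bndD[OF *(3)] by simp
    finally show "nrm T (mv T (fmx S M u) x) \<le> c * nrm T x" using * by (simp add: nrm_lin)
  qed
qed

lemma fmx_expand: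
  fixes u :: "'j \<Rightarrow> 'i \<Rightarrow> 'a::star_field"
  assumes "onf S T u" "finite S" "finite T" "card T = card S" "i \<in> S" "j \<in> S"
  shows "M i j = mm T (\<lambda>i p. u p i) (mm T (fmx S M u) (adj (\<lambda>i p. u p i))) i j"
proof -
  define e where "e = (\<lambda>k. if k = j then 1 else 0 :: 'a)"
  have ue: "ip S (u q) e = cj (u q j)" for q
    using assms by (simp add: ip_def e_def if_distrib sum.delta cong: if_cong)
  have "M i j = mv S M e i" unfolding e_def using assms by (simp add: mv_unit)
  also have "\<dots> = (\<Sum>p\<in>T. ip S (u p) (mv S M e) * u p i)"
    by (rule onf_expand) (use assms in auto)
  also have "mv S M e = mv S M (lin T u (\<lambda>q. cj (u q j)))"
    by (rule mv_cong) (use onf_expand[OF assms(1-4)] in \<open>simp add: lin_def ue[symmetric]\<close>)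
  also have "\<dots> = (\<lambda>i. \<Sum>q\<in>T. cj (u q j) * mv S M (u q) i)"
    by (simp add: lin_def mv_sum mv_smult)
  also have "(\<Sum>p\<in>T. ip S (u p) (\<lambda>i. \<Sum>q\<in>T. cj (u q j) * mv S M (u q) i) * u p i) =
     (\<Sum>p\<in>T. u p i * (\<Sum>q\<in>T. fmx S M u p q * cj (u q j)))"
    by (simp add: ip_sum_right ip_smult_right fmx_def mult.commute)
  finally show ?thesis by (simp add: mm_def adj_def)
qed

lemma tr_fmx:
  fixes u :: "'j \<Rightarrow> 'i \<Rightarrow> 'a::star_field"
  assumes "onf S T u" "finite S" "finite T" "card T = card S"
  shows "tr T (fmx S M u) = tr S M"
proof -
  have "tr S M = (\<Sum>i\<in>S. \<Sum>p\<in>T. \<Sum>q\<in>T. fmx S M u p q * (cj (u q i) * u p i))"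
    unfolding tr_def
  proof (rule sum.cong)
    fix i assume "i \<in> S"
    then show "M i i = (\<Sum>p\<in>T. \<Sum>q\<in>T. fmx S M u p q * (cj (u q i) * u p i))"
      using fmx_expand[OF assms, of i i M]
      by (simp add: mm_def adj_def sum_distrib_left mult_ac)
  qed auto
  also have "\<dots> = (\<Sum>p\<in>T. \<Sum>q\<in>T. fmx S M u p q * ip S (u q) (u p))"
    by (simp add: ip_def sum_distrib_left sum.swap[of _ S T])
  also have "\<dots> = (\<Sum>p\<in>T. \<Sum>q\<in>T. if p = q then fmx S M u p q else 0)"
    by (intro sum.cong) (use assms in \<open>auto simp: onfD\<close>)
  also have "\<dots> = tr T (fmx S M u)" using assms by (simp add: tr_def)
  finally show ?thesis by simp
qed

lemma fmx_lin: "fmx S M (\<lambda>r. lin T u (w r)) = fmx T (fmx S M u) w"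
proof (intro ext)
  fix p q
  have "mv S M (lin T u (w q)) = (\<lambda>i. \<Sum>s\<in>T. w q s * mv S M (u s) i)"
    by (simp add: lin_def mv_sum mv_smult)
  then have "fmx S M (\<lambda>r. lin T u (w r)) p q =
      (\<Sum>r\<in>T. cj (w p r) * (\<Sum>s\<in>T. w q s * fmx S M u r s))"
    by (simp add: fmx_def ip_lin_left ip_sum_right ip_smult_right)
  then show "fmx S M (\<lambda>r. lin T u (w r)) p q = fmx T (fmx S M u) w p q"
    by (simp add: fmx_def ip_def mv_def mult.commute)
qed

lemma onf_lin: "onf S T u \<Longrightarrow> finite T \<Longrightarrow> onf T R w \<Longrightarrow> onf S R (\<lambda>r. lin T u (w r))"
  by (simp add: onf_def ip_lin_lin)

text \<open>Let U have the columns \<open>u p\<close>. The factors become U B U' and U C U' with U'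
  the adjoint, and U' U = 1 turns their products into U B C U'. That the family is a full basis
  enters through \<open>fmx_expand\<close>, which recovers \<open>M\<close>.\<close>

lemma cm_transfer:
  fixes u :: "'j \<Rightarrow> 'i \<Rightarrow> 'a::star_field"
  assumes "onf S T u" "finite S" "finite T" "card T = card S" "cm T (fmx S M u) b c"
  shows "cm S M b c"
proof -
  define U where "U = (\<lambda>i p. u p i)"
  have UU: "mm S (adj U) (mm T U X) p q = X p q" if "p \<in> T" for X :: "'j \<Rightarrow> 'i \<Rightarrow> 'a" and p q
  proof -
    have "mm S (adj U) (mm T U X) p q = (\<Sum>r\<in>T. ip S (u p) (u r) * X r q)"
      by (simp add: mm_assoc) (simp add: mm_def adj_def U_def ip_def)
    also have "\<dots> = (\<Sum>r\<in>T. if p = r then X r q else 0)"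
      by (rule sum.cong) (use assms that in \<open>auto simp: onfD\<close>)
    finally show ?thesis using assms that by simp
  qed
  have prod: "mm S (mm T U (mm T B (adj U))) (mm T U (mm T C (adj U))) = mm T U (mm T (mm T B C) (adj U))" for B C
  proof (intro ext)
    fix i j
    have "mm S (mm T U (mm T B (adj U))) (mm T U (mm T C (adj U))) i j =
       mm T U (mm T B (mm S (adj U) (mm T U (mm T C (adj U))))) i j"
      by (simp add: mm_assoc)
    also have "\<dots> = mm T U (mm T B (mm T C (adj U))) i j"
      by (intro mm_cong refl UU)
    finally show "mm S (mm T U (mm T B (adj U))) (mm T U (mm T C (adj U))) i j = mm T U (mm T (mm T B C) (adj U)) i j"
      by (simp add: mm_assoc)
  qed
  obtain B C where BC: "\<forall>p\<in>T. \<forall>q\<in>T. fmx S M u p q = mm T B C p q - mm T C B p q"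
    "bnd T T B b" "bnd T T C c" using assms(5) unfolding cm_def by auto
  have Ub: "bnd S T U 1" unfolding U_def using assms by (intro onf_bnd)
  have U'b: "bnd T S (adj U) 1" by (rule bnd_adj[OF Ub]) simp
  have conj: "bnd S S (mm T U (mm T X (adj U))) d" if "bnd T T X d" for X d
    unfolding bnd_def
  proof
    fix x
    have "nrm S (mv S (mm T U (mm T X (adj U))) x) \<le> 1 * nrm T (mv T X (mv S (adj U) x))"
      unfolding mv_mm by (rule bndD[OF Ub])
    also have "\<dots> \<le> d * nrm T (mv S (adj U) x)" using bndD[OF that] by simp
    finally have *: "nrm S (mv S (mm T U (mm T X (adj U))) x) \<le> d * nrm T (mv S (adj U) x)" .
    show "nrm S (mv S (mm T U (mm T X (adj U))) x) \<le> d * nrm S x"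
    proof (cases "0 \<le> d")
      case True
      have "d * nrm T (mv S (adj U) x) \<le> d * nrm S x"
        using bndD[OF U'b, of x] True by (intro mult_left_mono) auto
      with * show ?thesis by linarith
    next
      case False
      \<comment> \<open>A negative bound is possible only over an empty index set: otherwise a unit
        vector would have an image of negative norm.\<close>
      have "T = {}"
      proof (rule ccontr)
        assume "T \<noteq> {}"
        then obtain p where "p \<in> T" by auto
        then have "nrm T (mv T X (\<lambda>k. if k = p then 1 else 0)) \<le> d"
          using bndD[OF that, of "\<lambda>k. if k = p then 1 else 0"] assms by (simp add: nrm_unit)
        then show False using False nrm_nonneg order_trans by blast
      qed
      then have "S = {}" using assms by auto
      then show ?thesis by simp
    qed
  qed
  show ?thesis unfolding cm_def
  proof (intro exI conjI ballI)
    show "bnd S S (mm T U (mm T B (adj U))) b" "bnd S S (mm T U (mm T C (adj U))) c"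
      using BC by (auto intro: conj)
    fix i j assume ij: "i \<in> S" "j \<in> S"
    have "M i j = mm T U (mm T (fmx S M u) (adj U)) i j"
      unfolding U_def by (rule fmx_expand) (use assms ij in auto)
    also have "\<dots> = mm T U (mm T (\<lambda>p q. mm T B C p q - mm T C B p q) (adj U)) i j"
      by (intro mm_cong refl) (use BC in auto)
    also have "\<dots> = mm T U (mm T (mm T B C) (adj U)) i j - mm T U (mm T (mm T C B) (adj U)) i j"
      by (simp add: mm_def[of T U] mm_def[of T _ "adj U"] left_diff_distrib right_diff_distrib sum_subtractf)
    finally show "M i j = mm S (mm T U (mm T B (adj U))) (mm T U (mm T C (adj U))) i j -
       mm S (mm T U (mm T C (adj U))) (mm T U (mm T B (adj U))) i j"
      by (simp add: prod)
  qed
qed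

subsection \<open>Sylvester equations and block assembly\<close>

text \<open>Neumann series for the map that sends C to (C Y - X C) / c, a contraction with ratio
  (\<alpha> + \<beta>) / |c|. The series converges entrywise, and the bound passes from the partial
  sums to the limit.\<close>

lemma sylvester:
  fixes M :: "'i \<Rightarrow> 'j \<Rightarrow> 'a::star_field"
  assumes fin: "finite S" "finite T"
    and X: "bnd S S X \<alpha>" and Y: "bnd T T Y \<beta>" and M: "bnd S T M \<mu>"
    and nn: "0 \<le> \<alpha>" "0 \<le> \<beta>" "0 \<le> \<mu>" and c: "\<alpha> + \<beta> < norm c"
  shows "\<exists>C. bnd S T C (\<mu> / (norm c - \<alpha> - \<beta>)) \<and>
    (\<forall>i\<in>S. \<forall>j\<in>T. c * C i j + mm S X C i j - mm T C Y i j = M i j)"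
proof -
  define D where "D = rec_nat (\<lambda>i j. M i j / c) (\<lambda>_ D. \<lambda>i j. (mm T D Y i j - mm S X D i j) / c)"
  have D0: "D 0 = (\<lambda>i j. M i j / c)" and DS: "D (Suc m) = (\<lambda>i j. (mm T (D m) Y i j - mm S X (D m) i j) / c)" for m
    by (simp_all add: D_def)
  have cpos: "norm c > 0" "c \<noteq> 0" using c nn by auto
  define q where "q = (\<alpha> + \<beta>) / norm c"
  define r where "r = \<mu> / norm c"
  have q: "0 \<le> q" "q < 1" using nn c cpos by (auto simp: q_def field_simps)
  have r: "0 \<le> r" using nn by (simp add: r_def)
  have Db: "bnd S T (D m) (r * q ^ m)" for m
  proof (induction m)
    case 0
    show ?case using bnd_smult[OF M, of "1 / c"] by (simp add: D0 r_def norm_divide)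
  next
    case (Suc m)
    have a: "0 \<le> r * q ^ m" using q r by simp
    have "bnd S T (\<lambda>i j. mm T (D m) Y i j - mm S X (D m) i j) (r * q ^ m * \<beta> + \<alpha> * (r * q ^ m))"
      by (intro bnd_diff bnd_mm[OF Suc Y a] bnd_mm[OF X Suc nn(1)])
    from bnd_smult[OF this, of "1 / c"]
    have "bnd S T (\<lambda>i j. 1 / c * (mm T (D m) Y i j - mm S X (D m) i j))
      (norm (1 / c) * (r * q ^ m * \<beta> + \<alpha> * (r * q ^ m)))" .
    moreover have "norm (1 / c) * (r * q ^ m * \<beta> + \<alpha> * (r * q ^ m)) = r * q ^ Suc m"
      using cpos by (simp add: norm_divide q_def field_simps)
    ultimately show ?case by (simp add: DS)
  qed
  have summ: "summable (\<lambda>m. D m i j)" if "i \<in> S" "j \<in> T" for i j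
    by (rule summable_comparison_test'[of "\<lambda>m. r * q ^ m" 0])
      (use q bnd_entry[OF Db fin that] in \<open>auto intro!: summable_mult summable_geometric\<close>)
  define C where "C = (\<lambda>i j. \<Sum>m. D m i j)"
  have mmX: "mm S X C i j = (\<Sum>m. mm S X (D m) i j)" if "i \<in> S" "j \<in> T" for i j
    unfolding mm_def C_def using summ that
    by (simp add: suminf_mult[symmetric] suminf_sum[symmetric] summable_mult)
  have mmY: "mm T C Y i j = (\<Sum>m. mm T (D m) Y i j)" if "i \<in> S" "j \<in> T" for i j
    unfolding mm_def C_def using summ that
    by (simp add: suminf_mult2 suminf_sum[symmetric] summable_mult2)
  have eq: "c * C i j + mm S X C i j - mm T C Y i j = M i j" if "i \<in> S" "j \<in> T" for i j
  proof -
    have sX: "summable (\<lambda>m. mm S X (D m) i j)" and sY: "summable (\<lambda>m. mm T (D m) Y i j)"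
      unfolding mm_def using summ that by (auto intro!: summable_sum summable_mult summable_mult2)
    have "C i j = D 0 i j + (\<Sum>m. D (Suc m) i j)"
      unfolding C_def using suminf_split_head[OF summ[OF that]] by simp
    also have "(\<Sum>m. D (Suc m) i j) = (\<Sum>m. mm T (D m) Y i j - mm S X (D m) i j) / c"
      unfolding DS using suminf_divide[OF summable_diff[OF sY sX]] by simp
    also have "(\<Sum>m. mm T (D m) Y i j - mm S X (D m) i j) = mm T C Y i j - mm S X C i j"
      using suminf_diff[OF sY sX] mmX mmY that by simp
    finally show ?thesis using cpos by (simp add: D0 field_simps)
  qed
  have Cb: "bnd S T C (\<mu> / (norm c - \<alpha> - \<beta>))"
    unfolding bnd_def
  proof
    fix x
    define P where "P N = (\<lambda>i. \<Sum>m<N. mv T (D m) x i)" for N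
    have lim: "(\<lambda>N. P N i) \<longlonglongrightarrow> mv T C x i" if "i \<in> S" for i
    proof -
      have "(\<lambda>N. \<Sum>j\<in>T. (\<Sum>m<N. D m i j) * x j) \<longlonglongrightarrow> (\<Sum>j\<in>T. C i j * x j)"
        unfolding C_def
        by (intro tendsto_sum tendsto_mult tendsto_const summable_LIMSEQ summ that)
      then show ?thesis by (simp add: P_def mv_def sum_distrib_right sum.swap[of _ T])
    qed
    have "(\<lambda>N. nrm S (P N)) \<longlonglongrightarrow> nrm S (mv T C x)"
      unfolding nrm_def L2_set_def by (intro tendsto_intros lim)
    moreover have "nrm S (P N) \<le> \<mu> / (norm c - \<alpha> - \<beta>) * nrm T x" for N
    proof -
      have "nrm S (P N) \<le> (\<Sum>m<N. nrm S (mv T (D m) x))"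
        unfolding P_def by (rule nrm_sum)
      also have "\<dots> \<le> (\<Sum>m<N. r * q ^ m * nrm T x)"
        by (intro sum_mono bndD Db)
      also have "\<dots> = r * nrm T x * (\<Sum>m<N. q ^ m)"
        by (simp add: sum_distrib_left mult_ac)
      also have "\<dots> \<le> r * nrm T x * (1 / (1 - q))"
      proof (intro mult_left_mono)
        have "(\<Sum>m<N. q ^ m) \<le> (\<Sum>m. q ^ m)"
          by (rule sum_le_suminf) (use q in auto)
        then show "(\<Sum>m<N. q ^ m) \<le> 1 / (1 - q)"
          using q by (simp add: suminf_geometric)
      qed (use r in auto)
      also have "r * nrm T x * (1 / (1 - q)) = \<mu> / (norm c - \<alpha> - \<beta>) * nrm T x"
        using cpos c by (simp add: r_def q_def field_simps)
      finally show ?thesis .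
    qed
    ultimately show "nrm S (mv T C x) \<le> \<mu> / (norm c - \<alpha> - \<beta>) * nrm T x"
      by (intro LIMSEQ_le_const2) auto
  qed
  show ?thesis using Cb eq by blast
qed

lemma nrm_group:
  assumes "finite S" "finite L" "\<pi> ` S \<subseteq> L"
  shows "(nrm S x)\<^sup>2 = (\<Sum>s\<in>L. (nrm {i\<in>S. \<pi> i = s} x)\<^sup>2)"
  unfolding nrm_sq by (rule sum.group[symmetric]) (use assms in auto)

lemma nrm_group_L2: 
  assumes "finite S" "finite L" "\<pi> ` S \<subseteq> L"
  shows "nrm S x = L2_set (\<lambda>s. nrm {i\<in>S. \<pi> i = s} x) L"
proof -
  have "(nrm S x)\<^sup>2 = (L2_set (\<lambda>s. nrm {i\<in>S. \<pi> i = s} x) L)\<^sup>2"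
    unfolding nrm_group[OF assms] L2_set_def by (simp add: sum_nonneg)
  then show ?thesis by (simp add: power2_eq_iff_nonneg L2_set_nonneg)
qed

text \<open>Off-diagonal blocks are estimated one by one; the loss is the square of the number of labels.\<close>

lemma bnd_blocks:
  fixes C :: "'i \<Rightarrow> 'i \<Rightarrow> 'a::star_field"
  assumes fin: "finite S" "finite L" "\<pi> ` S \<subseteq> L"
    and diag: "\<And>s. s \<in> L \<Longrightarrow> bnd {i\<in>S. \<pi> i = s} {i\<in>S. \<pi> i = s} C \<gamma>"
    and off: "\<And>s t. s \<in> L \<Longrightarrow> t \<in> L \<Longrightarrow> s \<noteq> t \<Longrightarrow> bnd {i\<in>S. \<pi> i = s} {i\<in>S. \<pi> i = t} C \<delta>"
    and nn: "0 \<le> \<gamma>" "0 \<le> \<delta>"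
  shows "bnd S S C (\<gamma> + (real (card L))\<^sup>2 * \<delta>)"
proof (rule bndI_form)
  let ?B = "\<lambda>s. {i\<in>S. \<pi> i = s}"
  fix x y :: "'i \<Rightarrow> 'a"
  define f where "f s t = ip (?B s) y (mv (?B t) C x)" for s t
  have g: "(\<Sum>i\<in>S. h i) = (\<Sum>s\<in>L. \<Sum>i\<in>?B s. h i)" for h :: "'i \<Rightarrow> 'a"
    by (rule sum.group[symmetric]) (use fin in auto)
  have "ip S y (mv S C x) = (\<Sum>s\<in>L. \<Sum>t\<in>L. f s t)"
    unfolding ip_def mv_def f_def g by (simp add: sum_distrib_left sum.swap[of _ _ L])
  also have "\<dots> = (\<Sum>s\<in>L. f s s) + (\<Sum>s\<in>L. \<Sum>t\<in>L - {s}. f s t)"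
    using fin by (simp add: sum.remove sum.distrib)
  also have "norm \<dots> \<le> (\<Sum>s\<in>L. norm (f s s)) + (\<Sum>s\<in>L. \<Sum>t\<in>L - {s}. norm (f s t))"
    by (intro norm_triangle_le add_mono norm_sum sum_norm_le)
  also have "\<dots> \<le> \<gamma> * (nrm S y * nrm S x) + (\<Sum>s\<in>L. \<Sum>t\<in>L. \<delta> * (nrm S y * nrm S x))"
  proof (intro add_mono)
    have "(\<Sum>s\<in>L. norm (f s s)) \<le> (\<Sum>s\<in>L. \<gamma> * (\<bar>nrm (?B s) y\<bar> * \<bar>nrm (?B s) x\<bar>))"
      by (intro sum_mono) (use bnd_form[OF diag] in \<open>auto simp: f_def mult.assoc\<close>)
    also have "\<dots> = \<gamma> * (\<Sum>s\<in>L. \<bar>nrm (?B s) y\<bar> * \<bar>nrm (?B s) x\<bar>)" by (simp add: sum_distrib_left)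
    also have "\<dots> \<le> \<gamma> * (nrm S y * nrm S x)"
      unfolding nrm_group_L2[OF fin] by (intro mult_left_mono L2_set_mult_ineq nn)
    finally show "(\<Sum>s\<in>L. norm (f s s)) \<le> \<gamma> * (nrm S y * nrm S x)" .
    have "norm (f s t) \<le> \<delta> * (nrm S y * nrm S x)" if "s \<in> L" "t \<in> L" "s \<noteq> t" for s t
    proof -
      have "norm (f s t) \<le> \<delta> * (nrm (?B s) y * nrm (?B t) x)"
        using bnd_form[OF off[OF that], of y x] by (simp add: f_def mult.assoc)
      also have "\<dots> \<le> \<delta> * (nrm S y * nrm S x)"
        by (intro mult_left_mono mult_mono nrm_mono_set nn) (use fin in auto)
      finally show ?thesis .
    qed
    then show "(\<Sum>s\<in>L. \<Sum>t\<in>L - {s}. norm (f s t)) \<le> (\<Sum>s\<in>L. \<Sum>t\<in>L. \<delta> * (nrm S y * nrm S x))"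
      by (intro sum_mono order_trans[OF sum_mono[of "L - {_}" _ "\<lambda>_. \<delta> * (nrm S y * nrm S x)"] sum_mono2])
        (use fin nn in auto)
  qed
  also have "\<dots> = (\<gamma> + (real (card L))\<^sup>2 * \<delta>) * nrm S y * nrm S x"
    by (simp add: algebra_simps power2_eq_square)
  finally show "norm (ip S y (mv S C x)) \<le> (\<gamma> + (real (card L))\<^sup>2 * \<delta>) * nrm S y * nrm S x" .
qed (use nn in auto)

text \<open>Adding the scalar \<open>z s\<close> to a first factor does not change its commutator,
  but separates the blocks. The first factor is then block diagonal, and each off-diagonal block of
  \<open>M\<close> is produced by a block of the second factor that solves a Sylvester equation with
  gap at least \<eta>.\<close>

lemma cm_blocks:
  fixes M :: "'i \<Rightarrow> 'i \<Rightarrow> 'a::star_field" and z :: "'l \<Rightarrow> 'a"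
  assumes fin: "finite S" "finite L" "\<pi> ` S \<subseteq> L" and M: "bnd S S M \<mu>"
    and blk: "\<And>s. s \<in> L \<Longrightarrow> cm {i\<in>S. \<pi> i = s} M (\<beta> s) \<gamma>"
    and sep: "\<And>s t. s \<in> L \<Longrightarrow> t \<in> L \<Longrightarrow> s \<noteq> t \<Longrightarrow> \<beta> s + \<beta> t + \<eta> \<le> norm (z s - z t)"
    and b: "\<And>s. s \<in> L \<Longrightarrow> norm (z s) + \<beta> s \<le> b"
    and nn: "0 < \<eta>" "0 \<le> \<gamma>" "0 \<le> \<mu>" "0 \<le> b" "\<And>s. s \<in> L \<Longrightarrow> 0 \<le> \<beta> s"
  shows "cm S M b (\<gamma> + (real (card L))\<^sup>2 * (\<mu> / \<eta>))"
proof -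
  let ?B = "\<lambda>s. {i\<in>S. \<pi> i = s}"
  have "\<forall>s\<in>L. \<exists>B C. (\<forall>i\<in>?B s. \<forall>j\<in>?B s. M i j = mm (?B s) B C i j - mm (?B s) C B i j) \<and>
     bnd (?B s) (?B s) B (\<beta> s) \<and> bnd (?B s) (?B s) C \<gamma>"
    using blk unfolding cm_def by blast
  from bchoice[OF this] obtain Bf where "\<forall>s\<in>L. \<exists>C. (\<forall>i\<in>?B s. \<forall>j\<in>?B s. M i j = mm (?B s) (Bf s) C i j - mm (?B s) C (Bf s) i j) \<and>
     bnd (?B s) (?B s) (Bf s) (\<beta> s) \<and> bnd (?B s) (?B s) C \<gamma>" by blast
  from bchoice[OF this] obtain Cf where BC:
    "\<And>s i j. s \<in> L \<Longrightarrow> i \<in> ?B s \<Longrightarrow> j \<in> ?B s \<Longrightarrow> M i j = mm (?B s) (Bf s) (Cf s) i j - mm (?B s) (Cf s) (Bf s) i j"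
    "\<And>s. s \<in> L \<Longrightarrow> bnd (?B s) (?B s) (Bf s) (\<beta> s)" "\<And>s. s \<in> L \<Longrightarrow> bnd (?B s) (?B s) (Cf s) \<gamma>"
    by blast
  have "\<exists>C. bnd (?B s) (?B t) C (\<mu> / \<eta>) \<and>
      (\<forall>i\<in>?B s. \<forall>j\<in>?B t. (z s - z t) * C i j + mm (?B s) (Bf s) C i j - mm (?B t) C (Bf t) i j = M i j)"
    if st: "s \<in> L" "t \<in> L" "s \<noteq> t" for s t
  proof -
    have "\<exists>C. bnd (?B s) (?B t) C (\<mu> / (norm (z s - z t) - \<beta> s - \<beta> t)) \<and>
      (\<forall>i\<in>?B s. \<forall>j\<in>?B t. (z s - z t) * C i j + mm (?B s) (Bf s) C i j - mm (?B t) C (Bf t) i j = M i j)"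
      by (rule sylvester) (use fin st sep[OF st] nn BC(2) in \<open>auto intro: bnd_subset[OF M]\<close>)
    moreover have "\<mu> / (norm (z s - z t) - \<beta> s - \<beta> t) \<le> \<mu> / \<eta>"
      by (intro divide_left_mono mult_pos_pos) (use sep[OF st] nn in auto)
    ultimately show ?thesis by (meson bnd_mono)
  qed
  then have "\<forall>p\<in>{(s, t). s \<in> L \<and> t \<in> L \<and> s \<noteq> t}. \<exists>C. bnd (?B (fst p)) (?B (snd p)) C (\<mu> / \<eta>) \<and>
      (\<forall>i\<in>?B (fst p). \<forall>j\<in>?B (snd p). (z (fst p) - z (snd p)) * C i j + mm (?B (fst p)) (Bf (fst p)) C i j - mm (?B (snd p)) C (Bf (snd p)) i j = M i j)"
    by auto
  from bchoice[OF this] obtain D' where D': "\<forall>p\<in>{(s, t). s \<in> L \<and> t \<in> L \<and> s \<noteq> t}. bnd (?B (fst p)) (?B (snd p)) (D' p) (\<mu> / \<eta>) \<and>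
      (\<forall>i\<in>?B (fst p). \<forall>j\<in>?B (snd p). (z (fst p) - z (snd p)) * D' p i j + mm (?B (fst p)) (Bf (fst p)) (D' p) i j - mm (?B (snd p)) (D' p) (Bf (snd p)) i j = M i j)"
    by blast
  define D where "D s t = D' (s, t)" for s t
  have Db: "bnd (?B s) (?B t) (D s t) (\<mu> / \<eta>)" if "s \<in> L" "t \<in> L" "s \<noteq> t" for s t
    using D' that by (auto simp: D_def)
  have Deq: "(z s - z t) * D s t i j + mm (?B s) (Bf s) (D s t) i j - mm (?B t) (D s t) (Bf t) i j = M i j"
    if "s \<in> L" "t \<in> L" "s \<noteq> t" "i \<in> ?B s" "j \<in> ?B t" for s t i j
    using D' that by (auto simp: D_def)
  \<comment> \<open>Since \<open>B\<close> is block diagonal, both products with \<open>C\<close>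
    involve one block of \<open>C\<close> at a time.\<close>
  define B where "B = (\<lambda>i j. if \<pi> i = \<pi> j then Bf (\<pi> i) i j + (if i = j then z (\<pi> i) else 0) else 0)"
  define C where "C = (\<lambda>i j. if \<pi> i = \<pi> j then Cf (\<pi> i) i j else D (\<pi> i) (\<pi> j) i j)"
  have BCl: "mm S B C i j = mm (?B (\<pi> i)) (Bf (\<pi> i)) C i j + z (\<pi> i) * C i j" if "i \<in> S" for i j
  proof -
    have "mm S B C i j = (\<Sum>k\<in>?B (\<pi> i). B i k * C k j)"
      unfolding mm_def by (rule sum.mono_neutral_right) (use fin in \<open>auto simp: B_def\<close>)
    also have "\<dots> = (\<Sum>k\<in>?B (\<pi> i). Bf (\<pi> i) i k * C k j + (if k = i then z (\<pi> i) * C i j else 0))"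
      by (rule sum.cong) (auto simp: B_def algebra_simps)
    finally show ?thesis using that fin by (simp add: sum.distrib mm_def)
  qed
  have BCr: "mm S C B i j = mm (?B (\<pi> j)) C (Bf (\<pi> j)) i j + z (\<pi> j) * C i j" if "j \<in> S" for i j
  proof -
    have "mm S C B i j = (\<Sum>k\<in>?B (\<pi> j). C i k * B k j)"
      unfolding mm_def by (rule sum.mono_neutral_right) (use fin in \<open>auto simp: B_def\<close>)
    also have "\<dots> = (\<Sum>k\<in>?B (\<pi> j). C i k * Bf (\<pi> j) k j + (if k = j then z (\<pi> j) * C i j else 0))"
      by (rule sum.cong) (auto simp: B_def algebra_simps)
    finally show ?thesis using that fin by (simp add: sum.distrib mm_def)
  qed
  have "bnd S S B (b + (real (card L))\<^sup>2 * 0)"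
  proof (rule bnd_blocks[OF fin])
    fix s assume s: "s \<in> L"
    have "bnd (?B s) (?B s) (\<lambda>i j. Bf s i j + (if i = j then z s else 0)) (\<beta> s + norm (z s))"
      by (intro bnd_add BC(2)[OF s] bnd_diag) (use fin in auto)
    then have "bnd (?B s) (?B s) B (\<beta> s + norm (z s))"
      by (subst bnd_cong[of _ _ _ "\<lambda>i j. Bf s i j + (if i = j then z s else 0)"]) (auto simp: B_def)
    then show "bnd (?B s) (?B s) B b" using b[OF s] by (elim bnd_mono) simp
  next
    fix s t :: 'l assume "s \<noteq> t"
    then show "bnd (?B s) (?B t) B 0"
      by (subst bnd_cong[of _ _ _ "\<lambda>i j. 0"]) (auto simp: B_def intro: bnd_zero)
  qed (use nn in auto)
  moreover have "bnd S S C (\<gamma> + (real (card L))\<^sup>2 * (\<mu> / \<eta>))"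
  proof (rule bnd_blocks[OF fin])
    fix s assume s: "s \<in> L"
    show "bnd (?B s) (?B s) C \<gamma>"
      using BC(3)[OF s] by (subst bnd_cong[of _ _ _ "Cf s"]) (auto simp: C_def)
  next
    fix s t assume st: "s \<in> L" "t \<in> L" "s \<noteq> t"
    show "bnd (?B s) (?B t) C (\<mu> / \<eta>)"
      using Db[OF st] st by (subst bnd_cong[of _ _ _ "D s t"]) (auto simp: C_def)
  qed (use nn in auto)
  moreover have "M i j = mm S B C i j - mm S C B i j" if ij: "i \<in> S" "j \<in> S" for i j
  proof (cases "\<pi> i = \<pi> j")
    case True
    have "mm (?B (\<pi> i)) (Bf (\<pi> i)) C i j = mm (?B (\<pi> i)) (Bf (\<pi> i)) (Cf (\<pi> i)) i j"
      by (rule mm_cong) (use True in \<open>auto simp: C_def\<close>)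
    moreover have "mm (?B (\<pi> i)) C (Bf (\<pi> i)) i j = mm (?B (\<pi> i)) (Cf (\<pi> i)) (Bf (\<pi> i)) i j"
      by (rule mm_cong) (use True in \<open>auto simp: C_def\<close>)
    ultimately show ?thesis
      using BC(1)[of "\<pi> i" i j] fin ij True by (auto simp: BCl BCr)
  next
    case False
    have "mm (?B (\<pi> i)) (Bf (\<pi> i)) C i j = mm (?B (\<pi> i)) (Bf (\<pi> i)) (D (\<pi> i) (\<pi> j)) i j"
      by (rule mm_cong) (use False in \<open>auto simp: C_def\<close>)
    moreover have "mm (?B (\<pi> j)) C (Bf (\<pi> j)) i j = mm (?B (\<pi> j)) (D (\<pi> i) (\<pi> j)) (Bf (\<pi> j)) i j"
      by (rule mm_cong) (use False in \<open>auto simp: C_def\<close>)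
    moreover have Cij: "C i j = D (\<pi> i) (\<pi> j) i j" using False by (simp add: C_def)
    moreover have "\<pi> i \<in> L" "\<pi> j \<in> L" using fin(3) ij by auto
    ultimately show ?thesis
      using Deq[of "\<pi> i" "\<pi> j" i j] ij False Cij by (auto simp: BCl BCr algebra_simps)
  qed
  ultimately show ?thesis unfolding cm_def by auto
qed

text \<open>The zero block takes the first factor 0, shifted to the scalar b + \<eta>; the other
  block stays at 0 with radius b, which leaves the gap \<eta>. The 4 is the square of the number of
  blocks.\<close>

lemma cm_two_blocks:
  fixes M :: "'i \<Rightarrow> 'i \<Rightarrow> 'a::star_field"
  assumes "finite S" "bnd S S M 1" "S = S1 \<union> S2" "S1 \<inter> S2 = {}"
    and "\<And>i j. i \<in> S1 \<Longrightarrow> j \<in> S1 \<Longrightarrow> M i j = 0" "cm S2 M b c" "0 \<le> b" "0 \<le> c" "0 < \<eta>"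
  shows "cm S M (b + \<eta>) (c + 4 / \<eta>)"
proof -
  define \<pi> where "\<pi> = (\<lambda>i. i \<in> S1)"
  have B: "{i\<in>S. \<pi> i = True} = S1" "{i\<in>S. \<pi> i = False} = S2"
    using assms by (auto simp: \<pi>_def)
  have "cm S M (b + \<eta>) (c + (real (card (UNIV :: bool set)))\<^sup>2 * (1 / \<eta>))"
  proof (rule cm_blocks[where \<pi> = \<pi> and \<beta> = "\<lambda>s. if s then 0 else b" and z = "\<lambda>s. if s then of_real (b + \<eta>) else 0"])
    fix s :: bool
    show "cm {i\<in>S. \<pi> i = s} M (if s then 0 else b) c"
    proof (cases s)
      case True
      then have "{i\<in>S. \<pi> i = s} = S1" using B by simp
      then show ?thesis using assms True by (auto intro: cm_zero)
    next
      case False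
      then have "{i\<in>S. \<pi> i = s} = S2" using B by simp
      then show ?thesis using assms False by simp
    qed
  qed (use assms in \<open>auto split: if_splits simp del: of_real_add\<close>)
  then show ?thesis by (simp add: UNIV_bool)
qed

lemma onf_case_sum:
  assumes "onf S T u" "onf S R w" "\<And>p r. p \<in> T \<Longrightarrow> r \<in> R \<Longrightarrow> ip S (u p) (w r) = 0"
  shows "onf S (T <+> R) (case_sum u w)"
proof -
  have "ip S (w r) (u p) = 0" if "p \<in> T" "r \<in> R" for p r
    using assms(3)[OF that] by (metis cj_ip cj_0)
  then show ?thesis unfolding onf_def[of S "T <+> R"]
    by (intro ballI) (elim PlusE; simp add: assms(3) onfD[OF assms(1)] onfD[OF assms(2)])
qed

lemma fmx_cong: "u p = u' p \<Longrightarrow> u q = u' q \<Longrightarrow> fmx S M u p q = fmx S M u' p q"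
  by (simp add: fmx_def)

lemma cm_reindex:
  fixes M :: "'i \<Rightarrow> 'i \<Rightarrow> 'a::star_field"
  assumes "bij_betw h T S" "finite S" "cm T (\<lambda>p q. M (h p) (h q)) b c"
  shows "cm S M b c"
proof (rule cm_transfer[of S T "\<lambda>p i. if i = h p then 1 else 0"])
  have hS: "h p \<in> S" if "p \<in> T" for p using assms(1) that by (auto simp: bij_betw_def)
  have inj: "h p = h q \<longleftrightarrow> p = q" if "p \<in> T" "q \<in> T" for p q
    using assms(1) that by (auto simp: bij_betw_def inj_on_def)
  have ipu: "ip S (\<lambda>i. if i = s then 1 else 0) y = y s" if "s \<in> S" for s and y :: "'i \<Rightarrow> 'a"
    using assms(2) that by (simp add: ip_def if_distrib[of cj] if_distrib[of "\<lambda>z. z * _"] cong: if_cong)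
  show "onf S T (\<lambda>p i. if i = h p then 1 else 0 :: 'a)"
    unfolding onf_def using hS inj by (simp add: ipu)
  show "finite T" "card T = card S"
    using assms bij_betw_finite bij_betw_same_card by blast+
  have "fmx S M (\<lambda>p i. if i = h p then 1 else 0) p q = M (h p) (h q)" if "p \<in> T" "q \<in> T" for p q
    using hS that assms(2) by (simp add: fmx_def ipu mv_unit)
  then show "cm T (fmx S M (\<lambda>p i. if i = h p then 1 else 0)) b c"
    using assms(3) by (subst cm_cong) auto
qed (use assms in auto)

text \<open>The two-block assembly in an adapted basis: the compression to the span of
  \<open>u\<close> is the zero block, and only the compression to the complement has to be
  represented.\<close>

lemma cm_peel:
  fixes M :: "'i \<Rightarrow> 'i \<Rightarrow> 'a::star_field"
  assumes fin: "finite S" "finite T" "finite R" and card: "card T + card R = card S"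
    and M: "bnd S S M 1"
    and u: "onf S T u" and w: "onf S R w"
    and uw: "\<And>p r. p \<in> T \<Longrightarrow> r \<in> R \<Longrightarrow> ip S (u p) (w r) = 0"
    and zero: "\<And>p q. p \<in> T \<Longrightarrow> q \<in> T \<Longrightarrow> fmx S M u p q = 0"
    and rest: "cm R (fmx S M w) b c" and nn: "0 \<le> b" "0 \<le> c" "0 < \<eta>"
  shows "cm S M (b + \<eta>) (c + 4 / \<eta>)"
proof -
  let ?v = "case_sum u w"
  have v: "onf S (T <+> R) ?v" by (rule onf_case_sum) (use u w uw in auto)
  have "cm (Inr ` R) (fmx S M ?v) b c"
  proof (rule cm_reindex[of Inr R])
    show "cm R (\<lambda>p q. fmx S M ?v (Inr p) (Inr q)) b c"
      using rest by (simp add: fmx_def)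
  qed (use fin in \<open>auto simp: bij_betw_def\<close>)
  then have "cm (T <+> R) (fmx S M ?v) (b + \<eta>) (c + 4 / \<eta>)"
    by (intro cm_two_blocks[of _ _ "Inl ` T" "Inr ` R"])
      (use fin nn zero bnd_fmx[OF v _ M] in \<open>auto simp: Plus_def fmx_def\<close>)
  then show ?thesis
    by (intro cm_transfer[OF v]) (use fin card in \<open>auto simp: card_Plus\<close>)
qed

subsection \<open>Extremal vectors of self-adjoint forms\<close>

text \<open>The real part obtained by polarisation. It is expressed by the norm alone, so it makes
  sense and is continuous over both fields.\<close>

definition rp :: "'a::star_field \<Rightarrow> real" where
  "rp z = ((norm (z + 1))\<^sup>2 - (norm z)\<^sup>2 - 1) / 2"

lemma rp_self_adjoint:
  fixes z :: "'a::star_field"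
  assumes "cj z = z"
  shows "z = of_real (rp z)"
proof -
  have "of_real ((norm (z + 1))\<^sup>2) = cj (z + 1) * (z + 1)" by (simp only: cj_mult_self)
  also have "\<dots> = cj z * z + 2 * z + 1" using assms by (simp add: algebra_simps)
  also have "\<dots> = of_real ((norm z)\<^sup>2) + 2 * z + 1" by (simp only: cj_mult_self)
  finally have "of_real ((norm (z + 1))\<^sup>2 - (norm z)\<^sup>2 - 1) = 2 * z" by simp
  moreover have "(norm (z + 1))\<^sup>2 - (norm z)\<^sup>2 - 1 = 2 * rp z" by (simp add: rp_def)
  ultimately have "of_real (2 * rp z) = 2 * z" by simp
  then show ?thesis by simp
qed

lemma rp_of_real [simp]: "rp (of_real r :: 'a::star_field) = r"
proof -
  have "(of_real r :: 'a) = of_real (rp (of_real r :: 'a))"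
    by (rule rp_self_adjoint) simp
  then show ?thesis by (simp only: of_real_eq_iff)
qed

lemma rp_0 [simp]: "rp (0 :: 'a::star_field) = 0"
  using rp_of_real[of 0, where 'a = 'a] by simp

lemma continuous_on_rp [continuous_intros]: "continuous_on A f \<Longrightarrow> continuous_on A (\<lambda>x. rp (f x))"
  unfolding rp_def by (intro continuous_intros) auto

lemma continuous_on_cj [continuous_intros]:
  fixes f :: "'b::topological_space \<Rightarrow> 'a::star_field"
  assumes "continuous_on A f"
  shows "continuous_on A (\<lambda>x. cj (f x))"
proof -
  have "dist (cj x) (cj y) = dist x y" for x y :: 'a
    unfolding dist_norm by (metis cj_diff norm_cj)
  then have "continuous_on UNIV (cj :: 'a \<Rightarrow> 'a)"
    unfolding continuous_on_iff by auto
  then show ?thesis using assms continuous_on_compose2[of UNIV cj A f] by auto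
qed

text \<open>Vectors live in the product topology over the whole index type. The sphere is closed in
  a product of closed balls and, outside \<open>S\<close>, of the one-point sets {0}, which is
  compact by the theorem of Tychonoff.\<close>

lemma compact_unit_sphere:
  fixes w :: "'j \<Rightarrow> 'i \<Rightarrow> 'a::star_field"
  assumes "finite S"
  shows "compact {x. (\<forall>i. i \<notin> S \<longrightarrow> x i = 0) \<and> nrm S x = 1 \<and> (\<forall>k\<in>J. ip S (w k) x = 0)}" (is "compact ?K")
proof -
  define P where "P = (\<lambda>i. if i \<in> S then cball 0 1 else {0 :: 'a})"
  have "compactin (product_topology (\<lambda>i. euclidean) UNIV) (PiE UNIV P)"
    unfolding compactin_PiE by (auto simp: P_def)
  then have "compact (PiE UNIV P)"
    by (simp add: euclidean_product_topology)
  moreover have "?K \<subseteq> PiE UNIV P"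
  proof
    fix x assume "x \<in> ?K"
    then show "x \<in> PiE UNIV P"
      using nrm_component_le[OF assms, of _ x] by (auto simp: P_def PiE_def Pi_def)
  qed
  moreover have "closed ?K"
  proof -
    have e: "?K = (\<Inter>i\<in>-S. {x. x i = 0}) \<inter> {x. nrm S x = 1} \<inter> (\<Inter>k\<in>J. {x. ip S (w k) x = 0})"
      by auto
    have c: "continuous_on UNIV (\<lambda>x :: 'i \<Rightarrow> 'a. x i)" for i by simp
    show ?thesis unfolding e unfolding nrm_def L2_set_def ip_def
      by (intro closed_Int closed_INT ballI closed_Collect_eq continuous_intros c)
  qed
  ultimately show ?thesis using compact_Int_closed[of "PiE UNIV P" ?K] by (simp add: Int_absorb1)
qed

lemma self_adjoint_form:
  assumes "\<forall>i\<in>S. \<forall>j\<in>S. M j i = cj (M i j)"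
  shows "ip S y (mv S M x) = cj (ip S x (mv S M y))"
proof -
  have "ip S x (mv S M y) = ip S (mv S (adj M) x) y" by (rule ip_adj)
  also have "\<dots> = ip S (mv S M x) y"
  proof (intro ip_cong mv_cong_mat refl)
    fix i j assume "i \<in> S" "j \<in> S"
    then show "adj M i j = M i j" unfolding adj_def using assms by metis
  qed
  finally show ?thesis by simp
qed

text \<open>First order condition at a maximiser \<open>v\<close> of the quadratic form on the unit sphere of the
  orthogonal complement of the \<open>w\<close>: the variation \<open>v + t c x\<close> with \<open>c = \<langle>x, M v\<rangle>\<close>
  increases the form to first order in \<open>t\<close> unless \<open>c = 0\<close>.\<close>

lemma maximizer:
  fixes M :: "'i \<Rightarrow> 'i \<Rightarrow> 'a::star_field" and w :: "'j \<Rightarrow> 'i \<Rightarrow> 'a"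
  assumes fin: "finite S" "finite J" "card J < card S"
    and herm: "\<forall>i\<in>S. \<forall>j\<in>S. M j i = cj (M i j)"
  shows "\<exists>v. (\<forall>i. i \<notin> S \<longrightarrow> v i = 0) \<and> nrm S v = 1 \<and> (\<forall>k\<in>J. ip S (w k) v = 0) \<and>
    (\<forall>x. (\<forall>k\<in>J. ip S (w k) x = 0) \<longrightarrow> rp (ip S x (mv S M x)) \<le> rp (ip S v (mv S M v)) * (nrm S x)\<^sup>2) \<and>
    (\<forall>x. (\<forall>k\<in>J. ip S (w k) x = 0) \<longrightarrow> ip S v x = 0 \<longrightarrow> ip S x (mv S M v) = 0)"
proof -
  have herm': "ip S y (mv S M x) = cj (ip S x (mv S M y))" for x y
    by (rule self_adjoint_form[OF herm])
  let ?K = "{x. (\<forall>i. i \<notin> S \<longrightarrow> x i = 0) \<and> nrm S x = 1 \<and> (\<forall>k\<in>J. ip S (w k) x = 0)}"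
  define \<phi> where "\<phi> x = ip S x (mv S M x)" for x
  have c: "continuous_on UNIV (\<lambda>x :: 'i \<Rightarrow> 'a. x i)" for i by simp
  have "continuous_on UNIV (\<lambda>x. rp (\<phi> x))"
    unfolding \<phi>_def ip_def mv_def by (intro continuous_intros c)
  then have "continuous_on ?K (\<lambda>x. rp (\<phi> x))"
    by (rule continuous_on_subset) simp
  moreover have "?K \<noteq> {}" using null_vector[OF fin(2,1,3), of w] by blast
  ultimately have "\<exists>v\<in>?K. \<forall>x\<in>?K. rp (\<phi> x) \<le> rp (\<phi> v)"
    by (intro continuous_attains_sup compact_unit_sphere fin)
  then obtain v where v: "v \<in> ?K" "\<forall>x\<in>?K. rp (\<phi> x) \<le> rp (\<phi> v)"
    by (rule bexE)
  have real: "\<phi> x = of_real (rp (\<phi> x))" for x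
    unfolding \<phi>_def by (rule rp_self_adjoint, rule herm'[symmetric])
  have hom: "\<phi> (\<lambda>i. a * x i) = of_real ((norm a)\<^sup>2) * \<phi> x" for a x
    by (simp only: \<phi>_def mv_smult ip_smult_right ip_smult_left cj_mult_self[symmetric] mult.assoc mult.left_commute)
  have max: "rp (\<phi> x) \<le> rp (\<phi> v) * (nrm S x)\<^sup>2" if x: "\<forall>k\<in>J. ip S (w k) x = 0" for x
  proof (cases "nrm S x = 0")
    case True
    then have "\<phi> x = 0" using fin by (simp add: nrm_eq_0_iff \<phi>_def ip_def)
    then show ?thesis using True by simp
  next
    case False
    obtain a where a: "a \<noteq> 0" "nrm S (\<lambda>i. a * x i) = 1" using normalizing_factor[OF False] by blast
    define y where "y = (\<lambda>i. if i \<in> S then a * x i else 0)"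
    have "nrm S y = nrm S (\<lambda>i. a * x i)" by (rule nrm_cong) (simp add: y_def)
    moreover have "ip S (w k) y = ip S (w k) (\<lambda>i. a * x i)" for k by (rule ip_cong) (simp_all add: y_def)
    ultimately have "y \<in> ?K" using a x by (auto simp: y_def ip_smult_right)
    moreover have "\<phi> y = \<phi> (\<lambda>i. a * x i)"
    proof -
      have "mv S M y = mv S M (\<lambda>i. a * x i)" by (rule mv_cong) (simp add: y_def)
      then have "\<phi> y = ip S y (mv S M (\<lambda>i. a * x i))" by (simp only: \<phi>_def)
      also have "\<dots> = \<phi> (\<lambda>i. a * x i)"
        unfolding \<phi>_def by (rule ip_cong) (simp_all add: y_def)
      finally show ?thesis .
    qed
    ultimately have "rp (\<phi> (\<lambda>i. a * x i)) \<le> rp (\<phi> v)" using bspec[OF v(2), of y] by simp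
    moreover have "\<phi> (\<lambda>i. a * x i) = of_real ((norm a)\<^sup>2 * rp (\<phi> x))"
      unfolding hom using real[of x] by (metis of_real_mult)
    ultimately have "(norm a)\<^sup>2 * rp (\<phi> x) \<le> rp (\<phi> v)" by (simp only: rp_of_real)
    moreover have "norm a * nrm S x = 1" using a(2) by (simp add: nrm_smult)
    ultimately have "(norm a)\<^sup>2 * rp (\<phi> x) * (nrm S x)\<^sup>2 \<le> rp (\<phi> v) * (nrm S x)\<^sup>2"
      by (intro mult_right_mono) auto
    moreover have "(norm a)\<^sup>2 * rp (\<phi> x) * (nrm S x)\<^sup>2 = (norm a * nrm S x)\<^sup>2 * rp (\<phi> x)"
      by (simp add: power_mult_distrib mult_ac)
    ultimately show ?thesis using \<open>norm a * nrm S x = 1\<close> by simp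
  qed
  have "ip S x (mv S M v) = 0" if x: "\<forall>k\<in>J. ip S (w k) x = 0" "ip S v x = 0" for x
  proof (rule ccontr)
    define c where "c = ip S x (mv S M v)"
    assume "ip S x (mv S M v) \<noteq> 0"
    then have c0: "(norm c)\<^sup>2 > 0" by (simp add: c_def)
    define B where "B = rp (\<phi> v) * (nrm S x)\<^sup>2 - rp (\<phi> x)"
    \<comment> \<open>The form at v + t c x is at most its maximum times the squared norm 1 + t^2
      |c|^2 |x|^2. The linear term 2 t |c|^2 survives on the left, everything quadratic is collected
      in \<open>B\<close>; a small positive t then gives a contradiction.\<close>
    have key: "2 * t * (norm c)\<^sup>2 \<le> t\<^sup>2 * (norm c)\<^sup>2 * B" for t
    proof -
      define a where "a = of_real t * c"
      define y where "y = (\<lambda>i. v i + a * x i)"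
      have xv: "ip S x v = 0" using x(2) by (metis cj_ip cj_0)
      have vv: "ip S v v = 1" using v(1) by (simp add: ip_self)
      have "ip S y y = 1 + of_real ((norm a)\<^sup>2) * ip S x x"
        unfolding y_def using xv x(2) vv
        by (simp add: ip_add_left ip_add_right ip_smult_left ip_smult_right del: of_real_power flip: cj_mult_self)
      then have "(of_real ((nrm S y)\<^sup>2) :: 'a) = of_real (1 + (norm a)\<^sup>2 * (nrm S x)\<^sup>2)"
        by (simp only: ip_self of_real_add of_real_mult of_real_1)
      then have ny: "(nrm S y)\<^sup>2 = 1 + (norm a)\<^sup>2 * (nrm S x)\<^sup>2" by (simp only: of_real_eq_iff)
      have vx: "ip S v (mv S M x) = cj c"
        unfolding c_def by (rule herm')
      have "\<phi> y = \<phi> v + a * ip S v (mv S M x) + cj a * ip S x (mv S M v) + of_real ((norm a)\<^sup>2) * \<phi> x"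
        unfolding y_def \<phi>_def
        by (simp add: mv_add mv_smult ip_add_left ip_add_right ip_smult_left ip_smult_right algebra_simps del: of_real_power flip: cj_mult_self)
      also have "\<dots> = \<phi> v + 2 * (of_real t * (cj c * c)) + of_real ((norm a)\<^sup>2) * \<phi> x"
        unfolding vx c_def[symmetric] by (simp add: a_def mult_ac)
      also have "\<dots> = of_real (rp (\<phi> v) + 2 * (t * (norm c)\<^sup>2) + (norm a)\<^sup>2 * rp (\<phi> x))"
        unfolding cj_mult_self by (subst (1 2) real) simp
      finally have "\<phi> y = of_real (rp (\<phi> v) + 2 * (t * (norm c)\<^sup>2) + (norm a)\<^sup>2 * rp (\<phi> x))" .
      then have "rp (\<phi> y) = rp (\<phi> v) + 2 * (t * (norm c)\<^sup>2) + (norm a)\<^sup>2 * rp (\<phi> x)"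
        by (simp only: rp_of_real)
      moreover have "rp (\<phi> y) \<le> rp (\<phi> v) * (nrm S y)\<^sup>2"
        by (rule max) (use v(1) x(1) in \<open>auto simp: y_def ip_add_right ip_smult_right\<close>)
      moreover have "(norm a)\<^sup>2 = t\<^sup>2 * (norm c)\<^sup>2" by (simp add: a_def norm_mult power_mult_distrib)
      ultimately show ?thesis by (simp add: ny B_def algebra_simps)
    qed
    define t where "t = 1 / (1 + \<bar>B\<bar>)"
    have t: "t > 0" "t * B < 2" by (auto simp: t_def field_simps)
    have "(t * (norm c)\<^sup>2) * 2 \<le> (t * (norm c)\<^sup>2) * (t * B)"
      using key[of t] by (simp add: power2_eq_square mult_ac)
    then have "2 \<le> t * B"
      using t(1) c0 by (simp only: mult_le_cancel_left_pos mult_pos_pos)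
    then show False using t by simp
  qed
  then show ?thesis using v(1) max unfolding \<phi>_def by blast
qed

text \<open>Successive maximisers: the first order condition makes the image of \<open>u q\<close>
  orthogonal to everything orthogonal to \<open>u 0\<close>, ..., \<open>u q\<close>. The matrix is
  thus triangular, and self-adjointness makes it diagonal.\<close>

lemma spectral_basis:
  fixes M :: "'i \<Rightarrow> 'i \<Rightarrow> 'a::star_field"
  assumes fin: "finite S"
    and herm: "\<forall>i\<in>S. \<forall>j\<in>S. M j i = cj (M i j)"
  shows "\<exists>u. onf S {..<card S} u \<and> (\<forall>p<card S. \<forall>q<card S. p \<noteq> q \<longrightarrow> fmx S M u p q = 0)"
proof -
  have herm': "ip S y (mv S M x) = cj (ip S x (mv S M y))" for x y
    by (rule self_adjoint_form[OF herm])
  have sym: "fmx S M u p q = 0 \<longleftrightarrow> fmx S M u q p = 0" for u :: "nat \<Rightarrow> 'i \<Rightarrow> 'a" and p q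
  proof -
    have "fmx S M u p q = cj (fmx S M u q p)"
      unfolding fmx_def by (rule herm')
    then show ?thesis by (metis cj_eq_0_iff)
  qed
  have "N \<le> card S \<Longrightarrow> \<exists>u. onf S {..<N} u \<and>
     (\<forall>x. \<forall>q<N. (\<forall>k\<le>q. ip S (u k) x = 0) \<longrightarrow> ip S x (mv S M (u q)) = 0)" for N
  proof (induction N)
    case 0
    then show ?case by (auto simp: onf_def)
  next
    case (Suc N)
    then obtain u where u: "onf S {..<N} u"
      "\<And>x q. q < N \<Longrightarrow> \<forall>k\<le>q. ip S (u k) x = 0 \<Longrightarrow> ip S x (mv S M (u q)) = 0" by auto
    obtain v where v: "nrm S v = 1" "\<forall>k\<in>{..<N}. ip S (u k) v = 0"
      "\<And>x. \<forall>k\<in>{..<N}. ip S (u k) x = 0 \<Longrightarrow> ip S v x = 0 \<Longrightarrow> ip S x (mv S M v) = 0"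
      using maximizer[OF fin _ _ herm, of "{..<N}" u] Suc.prems by auto
    have v': "ip S v (u k) = 0" if "k < N" for k
      using v(2) that by (metis cj_ip cj_0 lessThan_iff)
    show ?case
    proof (intro exI[of _ "u(N := v)"] conjI allI impI)
      show "onf S {..<Suc N} (u(N := v))"
        using u(1) v v' by (auto simp: onf_def less_Suc_eq ip_self_1)
      fix x q assume q: "q < Suc N" "\<forall>k\<le>q. ip S ((u(N := v)) k) x = 0"
      show "ip S x (mv S M ((u(N := v)) q)) = 0"
      proof (cases "q = N")
        case True
        have "\<forall>k\<in>{..<N}. ip S (u k) x = 0"
        proof
          fix k assume "k \<in> {..<N}"
          then show "ip S (u k) x = 0" using q(2)[rule_format, of k] True by simp
        qed
        moreover have "ip S v x = 0" using q(2)[rule_format, of N] True by simp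
        ultimately show ?thesis using v(3) True by simp
      next
        case False
        then have "q < N" using q by simp
        moreover have "\<forall>k\<le>q. ip S (u k) x = 0"
        proof (intro allI impI)
          fix k assume "k \<le> q"
          then show "ip S (u k) x = 0" using q(2)[rule_format, of k] \<open>q < N\<close> by simp
        qed
        ultimately show ?thesis using u(2) False by simp
      qed
    qed
  qed
  from this[of "card S"] obtain u where u: "onf S {..<card S} u"
    "\<And>x q. q < card S \<Longrightarrow> \<forall>k\<le>q. ip S (u k) x = 0 \<Longrightarrow> ip S x (mv S M (u q)) = 0" by auto
  have lt: "fmx S M u p q = 0" if "q < p" "p < card S" for p q
    unfolding fmx_def by (rule u(2)) (use that u(1) in \<open>auto simp: onfD\<close>)
  have "fmx S M u p q = 0" if "p < card S" "q < card S" "p \<noteq> q" for p q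
    using lt[of p q] lt[of q p] sym[of u p q] that by (cases "p < q") auto
  then show ?thesis using u(1) by blast
qed

subsection \<open>Self-adjoint matrices of trace zero\<close>

lemma bnd_partial_perm:
  fixes d :: "'i \<Rightarrow> 'a::real_normed_field"
  assumes "finite S" "inj_on f {i\<in>S. P i}" "\<And>i. i \<in> S \<Longrightarrow> P i \<Longrightarrow> f i \<in> S"
    and "\<And>i. i \<in> S \<Longrightarrow> norm (d i) \<le> c" "0 \<le> c"
  shows "bnd S S (\<lambda>i j. if P i \<and> j = f i then d i else 0) c"
  unfolding bnd_def
proof
  fix x :: "'i \<Rightarrow> 'a"
  have mv: "mv S (\<lambda>i j. if P i \<and> j = f i then d i else 0) x i = (if P i then d i * x (f i) else 0)"
    if "i \<in> S" for i
    using that assms by (auto simp: mv_def if_distrib[of "\<lambda>z. z * _"] cong: if_cong)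
  have "(nrm S (mv S (\<lambda>i j. if P i \<and> j = f i then d i else 0) x))\<^sup>2
     = (\<Sum>i\<in>S. if P i then (norm (d i * x (f i)))\<^sup>2 else 0)"
    unfolding nrm_sq by (rule sum.cong) (auto simp: mv)
  also have "\<dots> = (\<Sum>i\<in>{i\<in>S. P i}. (norm (d i * x (f i)))\<^sup>2)"
    using assms(1) by (simp add: sum.inter_filter)
  also have "\<dots> \<le> (\<Sum>i\<in>{i\<in>S. P i}. c\<^sup>2 * (norm (x (f i)))\<^sup>2)"
    by (rule sum_mono) (use assms in \<open>auto simp: norm_mult power_mult_distrib intro!: mult_right_mono power_mono\<close>)
  also have "\<dots> = c\<^sup>2 * (\<Sum>i\<in>f ` {i\<in>S. P i}. (norm (x i))\<^sup>2)"
    by (simp add: sum.reindex[OF assms(2)] sum_distrib_left)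
  also have "\<dots> \<le> c\<^sup>2 * (nrm S x)\<^sup>2"
    unfolding nrm_sq by (intro mult_left_mono sum_mono2) (use assms in auto)
  finally have "(nrm S (mv S (\<lambda>i j. if P i \<and> j = f i then d i else 0) x))\<^sup>2 \<le> (c * nrm S x)\<^sup>2"
    by (simp add: power_mult_distrib)
  then show "nrm S (mv S (\<lambda>i j. if P i \<and> j = f i then d i else 0) x) \<le> c * nrm S x"
    by (rule power2_le_imp_le) (use assms in auto)
qed

text \<open>A diagonal matrix whose partial traces \<open>s\<close> are bounded is the commutator of the shift and a
  shift in the other direction with weights \<open>s\<close>.\<close>

lemma cm_diagonal:
  fixes \<kappa> :: "nat \<Rightarrow> 'a::real_normed_field"
  assumes s: "\<And>j. j \<le> n \<Longrightarrow> norm (\<Sum>i<j. \<kappa> i) \<le> \<nu>" and z: "(\<Sum>i<n. \<kappa> i) = 0"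
  shows "cm {..<n} (\<lambda>i j. if i = j then \<kappa> i else 0) 1 \<nu>"
proof -
  define s where "s j = (\<Sum>i<j. \<kappa> i)" for j
  have nu: "0 \<le> \<nu>" using s[of 0] by simp
  define B :: "nat \<Rightarrow> nat \<Rightarrow> 'a" where "B = (\<lambda>i j. if Suc i < n \<and> j = Suc i then 1 else 0)"
  define C where "C = (\<lambda>i j. if 0 < i \<and> j = i - 1 then s i else 0)"
  show ?thesis unfolding cm_def
  proof (intro exI conjI ballI)
    show "bnd {..<n} {..<n} B 1" unfolding B_def by (rule bnd_partial_perm) auto
    show "bnd {..<n} {..<n} C \<nu>" unfolding C_def
      by (rule bnd_partial_perm) (use assms nu in \<open>auto simp: inj_on_def s_def\<close>)
    fix i j assume ij: "i \<in> {..<n}" "j \<in> {..<n}"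
    have "mm {..<n} B C i j = (\<Sum>k<n. if k = Suc i then (if j = i then s (Suc i) else 0) else 0)"
      unfolding mm_def by (rule sum.cong) (auto simp: B_def C_def)
    also have "\<dots> = (if j = i \<and> Suc i < n then s (Suc i) else 0)"
      using ij by (simp add: sum.delta)
    \<comment> \<open>The shift has no entry in its last row. The missing term would be
      \<open>s n\<close>, which vanishes because the trace does.\<close>
    also have "\<dots> = (if i = j then s (Suc i) else 0)"
    proof -
      have "Suc i = n" if "\<not> Suc i < n" using that ij by auto
      then show ?thesis using z by (auto simp: s_def)
    qed
    finally have BC: "mm {..<n} B C i j = (if i = j then s (Suc i) else 0)" .
    have "mm {..<n} C B i j = (\<Sum>k<n. if k = i - 1 then (if i = j \<and> 0 < i then s i else 0) else 0)"
      unfolding mm_def by (rule sum.cong) (use ij in \<open>auto simp: B_def C_def\<close>)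
    also have "\<dots> = (if i = j then s i else 0)"
      using ij by (auto simp: sum.delta s_def)
    finally show "(if i = j then \<kappa> i else 0) = mm {..<n} B C i j - mm {..<n} C B i j"
      unfolding BC by (simp add: s_def)
  qed
qed

text \<open>A next term that keeps the sum in the interval exists: otherwise all remaining terms
  would have the strict sign of a sum that they are supposed to cancel. The start value
  \<open>s\<close> is there for the induction.\<close>

lemma bounded_partial_sums_ordering:
  fixes \<kappa> :: "'i \<Rightarrow> real"
  assumes "finite T" "\<And>i. i \<in> T \<Longrightarrow> \<bar>\<kappa> i\<bar> \<le> \<nu>" "\<bar>s\<bar> \<le> \<nu>" "s + (\<Sum>i\<in>T. \<kappa> i) = 0"
  shows "\<exists>\<sigma>. bij_betw \<sigma> {..<card T} T \<and> (\<forall>j\<le>card T. \<bar>s + (\<Sum>i<j. \<kappa> (\<sigma> i))\<bar> \<le> \<nu>)"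
  using assms
proof (induction "card T" arbitrary: T s)
  case 0
  then show ?case by (auto simp: bij_betw_def)
next
  case (Suc m)
  have "\<exists>t\<in>T. \<bar>s + \<kappa> t\<bar> \<le> \<nu>"
  proof (rule ccontr)
    assume "\<not> ?thesis"
    then have *: "\<bar>s + \<kappa> t\<bar> > \<nu>" if "t \<in> T" for t using that by force
    have ne: "T \<noteq> {}" using Suc by auto
    show False
    proof (cases "0 \<le> s")
      case True
      then have "0 < \<kappa> t" if "t \<in> T" for t using *[OF that] Suc.prems(2)[OF that] Suc.prems(3) by linarith
      then have "0 < (\<Sum>i\<in>T. \<kappa> i)" using Suc.prems ne by (intro sum_pos) auto
      then show False using True Suc.prems by simp
    next
      case False
      then have "0 < - \<kappa> t" if "t \<in> T" for t using *[OF that] Suc.prems(2)[OF that] Suc.prems(3) by linarith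
      then have "0 < (\<Sum>i\<in>T. - \<kappa> i)" using Suc.prems ne by (intro sum_pos) auto
      then show False using False Suc.prems by (simp add: sum_negf)
    qed
  qed
  then obtain t where t: "t \<in> T" "\<bar>s + \<kappa> t\<bar> \<le> \<nu>" by blast
  have "m = card (T - {t})" using Suc t by simp
  moreover have "s + \<kappa> t + (\<Sum>i\<in>T - {t}. \<kappa> i) = 0"
    using Suc.prems t by (simp add: sum.remove)
  ultimately obtain \<sigma> where \<sigma>: "bij_betw \<sigma> {..<m} (T - {t})"
    "\<forall>j\<le>m. \<bar>s + \<kappa> t + (\<Sum>i<j. \<kappa> (\<sigma> i))\<bar> \<le> \<nu>"
    using Suc(1)[of "T - {t}" "s + \<kappa> t"] Suc.prems t by auto
  define \<tau> where "\<tau> = case_nat t \<sigma>"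
  have "bij_betw \<tau> (insert 0 (Suc ` {..<m})) (insert t (T - {t}))"
  proof -
    have "bij_betw \<tau> (Suc ` {..<m}) (T - {t})"
    proof -
      have "\<tau> \<circ> Suc = \<sigma>" by (auto simp: \<tau>_def)
      then show ?thesis
        using \<sigma>(1) unfolding bij_betw_def by (metis inj_on_imageI image_comp)
    qed
    then have "bij_betw \<tau> (Suc ` {..<m} \<union> {0}) (T - {t} \<union> {\<tau> 0})"
      by (rule notIn_Un_bij_betw[rotated 2]) (auto simp: \<tau>_def)
    then show ?thesis by (simp add: \<tau>_def)
  qed
  moreover have "insert 0 (Suc ` {..<m}) = {..<Suc m}" "insert t (T - {t}) = T"
    using t by (auto simp: image_iff less_Suc_eq_0_disj)
  ultimately have "bij_betw \<tau> {..<card T} T" using Suc by simp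
  moreover have "\<bar>s + (\<Sum>i<j. \<kappa> (\<tau> i))\<bar> \<le> \<nu>" if "j \<le> card T" for j
  proof (cases j)
    case 0
    then show ?thesis using Suc by simp
  next
    case (Suc j')
    then have "(\<Sum>i<j. \<kappa> (\<tau> i)) = \<kappa> t + (\<Sum>i<j'. \<kappa> (\<sigma> i))"
      by (simp add: sum.lessThan_Suc_shift \<tau>_def del: sum.lessThan_Suc)
    then show ?thesis using \<sigma>(2) that Suc \<open>Suc m = card T\<close> by (simp add: add.assoc[symmetric])
  qed
  ultimately show ?case by blast
qed

lemma cm_self_adjoint:
  fixes M :: "'i \<Rightarrow> 'i \<Rightarrow> 'a::star_field"
  assumes fin: "finite S" and herm: "\<forall>i\<in>S. \<forall>j\<in>S. M j i = cj (M i j)"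
    and tr: "tr S M = 0" and M: "bnd S S M \<nu>" "0 \<le> \<nu>"
  shows "cm S M 1 \<nu>"
proof -
  obtain u where u: "onf S {..<card S} u" "\<forall>p<card S. \<forall>q<card S. p \<noteq> q \<longrightarrow> fmx S M u p q = 0"
    using spectral_basis[OF fin herm] by blast
  define \<kappa> where "\<kappa> p = rp (fmx S M u p p)" for p
  have real: "fmx S M u p p = of_real (\<kappa> p)" for p
    unfolding \<kappa>_def by (rule rp_self_adjoint) (unfold fmx_def, rule self_adjoint_form[OF herm, symmetric])
  have "\<bar>\<kappa> p\<bar> \<le> \<nu>" if "p \<in> {..<card S}" for p
    using bnd_entry[OF bnd_fmx[OF u(1) _ M(1)], of p p] that real[of p] by simp
  moreover have sum0: "(\<Sum>p<card S. \<kappa> p) = 0"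
  proof -
    have "(of_real (\<Sum>p<card S. \<kappa> p) :: 'a) = tr {..<card S} (fmx S M u)"
      by (simp add: tr_def real)
    also have "\<dots> = 0" using tr_fmx[OF u(1) fin, of M] tr by simp
    finally show ?thesis by (simp only: of_real_eq_0_iff)
  qed
  ultimately obtain \<sigma> where \<sigma>: "bij_betw \<sigma> {..<card S} {..<card S}"
     "\<And>j. j \<le> card S \<Longrightarrow> \<bar>\<Sum>i<j. \<kappa> (\<sigma> i)\<bar> \<le> \<nu>"
    using bounded_partial_sums_ordering[of "{..<card S}" \<kappa> \<nu> 0] M(2) by auto
  have "cm {..<card S} (\<lambda>i j. if i = j then of_real (\<kappa> (\<sigma> i)) else 0 :: 'a) 1 \<nu>"
  proof (rule cm_diagonal)
    fix j assume "j \<le> card S"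
    then have "norm (of_real (\<Sum>i<j. \<kappa> (\<sigma> i)) :: 'a) \<le> \<nu>" using \<sigma>(2) by (simp only: norm_of_real)
    then show "norm (\<Sum>i<j. of_real (\<kappa> (\<sigma> i)) :: 'a) \<le> \<nu>" by simp
  next
    have "(\<Sum>i<card S. \<kappa> (\<sigma> i)) = 0" using sum.reindex_bij_betw[OF \<sigma>(1), of \<kappa>] sum0 by simp
    then have "(of_real (\<Sum>i<card S. \<kappa> (\<sigma> i)) :: 'a) = 0" by simp
    then show "(\<Sum>i<card S. of_real (\<kappa> (\<sigma> i)) :: 'a) = 0" by simp
  qed
  then have "cm {..<card S} (\<lambda>i j. fmx S M u (\<sigma> i) (\<sigma> j)) 1 \<nu>"
  proof (subst cm_cong)
    fix i j assume ij: "i \<in> {..<card S}" "j \<in> {..<card S}"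
    then have "\<sigma> i < card S" "\<sigma> j < card S" "\<sigma> i = \<sigma> j \<longleftrightarrow> i = j"
      using \<sigma>(1) by (auto simp: bij_betw_def inj_on_def)
    then show "fmx S M u (\<sigma> i) (\<sigma> j) = (if i = j then of_real (\<kappa> (\<sigma> i)) else 0)"
      using u(2) real by auto
  qed
  then have "cm {..<card S} (fmx S M u) 1 \<nu>" by (rule cm_reindex[OF \<sigma>(1) finite_lessThan])
  then show ?thesis by (intro cm_transfer[OF u(1)]) (use fin in auto)
qed

subsection \<open>Real matrices\<close>

lemma rp_real [simp]: "rp (r :: real) = r"
  using rp_of_real[of r, where 'a = real] by simp

lemma cj_id [simp]: "cj (r :: real) = r"
  by (simp add: cj_real_def)

lemma ip_commute_real: "ip S x y = ip S y (x :: 'i \<Rightarrow> real)"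
  by (simp add: ip_def mult.commute)

lemma ip_Plus: "finite S \<Longrightarrow> ip (S <+> S) z V = ip S (\<lambda>i. z (Inl i)) (\<lambda>i. V (Inl i)) + ip S (\<lambda>i. z (Inr i)) (\<lambda>i. V (Inr i))"
  by (simp add: ip_def sum.Plus)

text \<open>A skew form is put into normal form by maximising it over pairs of vectors, that is, by
  maximising the quadratic form of the symmetric matrix with off-diagonal blocks \<open>K\<close> and \<open>K\<^sup>T\<close>.\<close>

lemma skew_maximal_pair:
  fixes K :: "'i \<Rightarrow> 'i \<Rightarrow> real" and v :: "'j \<Rightarrow> 'i \<Rightarrow> real"
  assumes fin: "finite S" "finite W" "Suc (card W) < card S"
    and sk: "\<forall>i j. K j i = - K i j"
  shows "\<exists>x y. nrm S x = 1 \<and> nrm S y = 1 \<and> ip S x y = 0 \<and> (\<forall>k\<in>W. ip S (v k) x = 0 \<and> ip S (v k) y = 0) \<and>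
    (\<forall>z. (\<forall>k\<in>W. ip S (v k) z = 0) \<longrightarrow> ip S x z = 0 \<longrightarrow> ip S y z = 0 \<longrightarrow>
       ip S z (mv S K y) = 0 \<and> ip S z (mv S K x) = 0)"
proof -
  note skew = sk[rule_format]
  define k where "k x y = ip S x (mv S K y)" for x y
  have ksk: "k y x = - k x y" for x y
  proof -
    have "k y x = ip S (mv S (adj K) y) x" unfolding k_def by (rule ip_adj)
    also have "adj K = (\<lambda>i j. - K i j)" by (intro ext) (simp add: adj_def skew[symmetric])
    also have "mv S (\<lambda>i j. - K i j) y = (\<lambda>i. - mv S K y i)" by (simp add: mv_def sum_negf)
    finally show ?thesis by (simp add: k_def ip_def sum_negf mult.commute)
  qed
  define G where "G p q = (case p of Inl i \<Rightarrow> (case q of Inl j \<Rightarrow> 0 | Inr j \<Rightarrow> K i j)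
     | Inr i \<Rightarrow> (case q of Inl j \<Rightarrow> K j i | Inr j \<Rightarrow> 0))" for p q
  have Gform: "ip (S <+> S) z (mv (S <+> S) G V) =
     k (\<lambda>i. z (Inl i)) (\<lambda>i. V (Inr i)) + k (\<lambda>i. V (Inl i)) (\<lambda>i. z (Inr i))" for z V
  proof -
    have "mv (S <+> S) G V (Inl i) = mv S K (\<lambda>i. V (Inr i)) i" for i
      using fin by (simp add: mv_def sum.Plus G_def)
    moreover have "mv (S <+> S) G V (Inr i) = - mv S K (\<lambda>i. V (Inl i)) i" for i
    proof -
      have "mv (S <+> S) G V (Inr i) = (\<Sum>j\<in>S. K j i * V (Inl j))"
        using fin by (simp add: mv_def sum.Plus G_def)
      also have "\<dots> = (\<Sum>j\<in>S. - (K i j * V (Inl j)))"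
        by (rule sum.cong, rule refl) (subst skew, simp)
      finally show ?thesis by (simp add: mv_def sum_negf)
    qed
    ultimately have "ip (S <+> S) z (mv (S <+> S) G V) = k (\<lambda>i. z (Inl i)) (\<lambda>i. V (Inr i)) - k (\<lambda>i. z (Inr i)) (\<lambda>i. V (Inl i))"
      using fin by (simp add: ip_Plus k_def) (simp add: ip_def sum_negf)
    then show ?thesis using ksk[of "\<lambda>i. V (Inl i)" "\<lambda>i. z (Inr i)"] by simp
  qed
  define g :: "'j + 'j \<Rightarrow> 'i + 'i \<Rightarrow> real" where
    "g = case_sum (\<lambda>j. case_sum (v j) (\<lambda>_. 0)) (\<lambda>j. case_sum (\<lambda>_. 0) (v j))"
  have ballP: "(\<forall>l\<in>W <+> W. Q l) \<longleftrightarrow> (\<forall>l\<in>W. Q (Inl l) \<and> Q (Inr l))" for Q :: "'j + 'j \<Rightarrow> bool"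
    by auto
  have gip: "(\<forall>l\<in>W <+> W. ip (S <+> S) (g l) V = 0) \<longleftrightarrow>
     (\<forall>l\<in>W. ip S (v l) (\<lambda>i. V (Inl i)) = 0 \<and> ip S (v l) (\<lambda>i. V (Inr i)) = 0)" for V
    unfolding ballP using fin by (simp add: g_def ip_Plus)
  have herm: "\<forall>p\<in>S <+> S. \<forall>q\<in>S <+> S. G q p = cj (G p q)"
    by (auto simp: G_def)
  have c: "card (W <+> W) < card (S <+> S)" using fin by (simp add: card_Plus)
  obtain V where V: "nrm (S <+> S) V = 1" "\<forall>l\<in>W <+> W. ip (S <+> S) (g l) V = 0"
    "\<forall>x. (\<forall>l\<in>W <+> W. ip (S <+> S) (g l) x = 0) \<longrightarrow> rp (ip (S <+> S) x (mv (S <+> S) G x)) \<le> rp (ip (S <+> S) V (mv (S <+> S) G V)) * (nrm (S <+> S) x)\<^sup>2"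
    "\<forall>x. (\<forall>l\<in>W <+> W. ip (S <+> S) (g l) x = 0) \<longrightarrow> ip (S <+> S) V x = 0 \<longrightarrow> ip (S <+> S) x (mv (S <+> S) G V) = 0"
    using maximizer[OF _ _ c herm, of g] fin by auto
  define x where "x = (\<lambda>i. V (Inl i))"
  define y where "y = (\<lambda>i. V (Inr i))"
  have xyW: "\<forall>l\<in>W. ip S (v l) x = 0 \<and> ip S (v l) y = 0"
    using V(2) unfolding gip x_def y_def .
  have first: "k a y + k x b = 0"
    if "\<forall>l\<in>W. ip S (v l) a = 0 \<and> ip S (v l) b = 0" "ip S x a + ip S y b = 0" for a b
  proof -
    have "\<forall>l\<in>W <+> W. ip (S <+> S) (g l) (case_sum a b) = 0" unfolding gip using that by simp
    moreover have "ip (S <+> S) V (case_sum a b) = 0"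
      using that fin by (simp add: ip_Plus x_def y_def)
    ultimately have "ip (S <+> S) (case_sum a b) (mv (S <+> S) G V) = 0" using V(4) by blast
    then show ?thesis by (simp add: Gform x_def y_def)
  qed
  have n1: "ip S x x + ip S y y = 1"
    using V(1) ip_self[of "S <+> S" V] fin by (simp add: ip_Plus x_def y_def)
  show ?thesis
  proof (cases "k x y = 0")
    \<comment> \<open>The maximum of the form is 0, so \<open>k\<close> vanishes on the whole
      complement and any orthonormal pair there will do.\<close>
    case True
    have max: "k a b \<le> 0" if "\<forall>l\<in>W. ip S (v l) a = 0 \<and> ip S (v l) b = 0" for a b
    proof -
      have "\<forall>l\<in>W <+> W. ip (S <+> S) (g l) (case_sum a b) = 0" unfolding gip using that by simp
      then have "ip (S <+> S) (case_sum a b) (mv (S <+> S) G (case_sum a b)) \<le>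
          ip (S <+> S) V (mv (S <+> S) G V) * (nrm (S <+> S) (case_sum a b))\<^sup>2"
        using V(3) by (metis rp_real)
      moreover have "ip (S <+> S) V (mv (S <+> S) G V) = 0"
        using True by (simp add: Gform x_def y_def)
      moreover have "ip (S <+> S) (case_sum a b) (mv (S <+> S) G (case_sum a b)) = 2 * k a b"
        by (simp add: Gform)
      ultimately show ?thesis by simp
    qed
    have k0: "k a b = 0" if "\<forall>l\<in>W. ip S (v l) a = 0 \<and> ip S (v l) b = 0" for a b
      using max[of a b] max[of b a] ksk[of a b] that by auto
    obtain w where w: "onf S {..<2::nat} w" "\<forall>l<2. \<forall>j\<in>W. ip S (v j) (w l) = 0"
      using null_family[OF fin(2,1), of 2 v] fin(3) by auto
    show ?thesis
      by (rule exI[of _ "w 0"], rule exI[of _ "w 1"])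
        (use w onf_nrm[OF w(1)] k0 in \<open>auto simp: onfD[OF w(1)] k_def\<close>)
  next
    case False
    \<comment> \<open>The first order condition is tested on the tangent variation (y - c x, - c y)
      with c = <x, y>; it gives 2 c k(x, y) = 0.\<close>
    have xy: "ip S x y = 0"
    proof -
      define c where "c = ip S x y"
      have "k (\<lambda>i. y i - c * x i) y + k x (\<lambda>i. - c * y i) = 0"
      proof (rule first)
        show "\<forall>l\<in>W. ip S (v l) (\<lambda>i. y i - c * x i) = 0 \<and> ip S (v l) (\<lambda>i. - c * y i) = 0"
          using xyW by (simp only: ip_diff_right ip_smult_right) simp
        show "ip S x (\<lambda>i. y i - c * x i) + ip S y (\<lambda>i. - c * y i) = 0"
        proof -
          have "ip S x (\<lambda>i. y i - c * x i) + ip S y (\<lambda>i. - c * y i) = c - c * (ip S x x + ip S y y)"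
            unfolding ip_diff_right ip_smult_right by (simp only: c_def distrib_left mult_minus_left)
          then show ?thesis using n1 by simp
        qed
      qed
      moreover have "k (\<lambda>i. y i - c * x i) y = - c * k x y"
        using ksk[of y y] by (simp add: k_def ip_diff_left ip_smult_left)
      moreover have "k x (\<lambda>i. - c * y i) = - c * k x y"
        unfolding k_def mv_smult ip_smult_right ..
      ultimately show ?thesis using False by (simp add: c_def)
    qed
    \<comment> \<open>Here the tangent variation is (|y|^2 x, - |x|^2 y).\<close>
    have eq: "ip S x x = ip S y y"
    proof -
      have "k (\<lambda>i. ip S y y * x i) y + k x (\<lambda>i. (- ip S x x) * y i) = 0"
      proof (rule first)
        show "\<forall>l\<in>W. ip S (v l) (\<lambda>i. ip S y y * x i) = 0 \<and> ip S (v l) (\<lambda>i. (- ip S x x) * y i) = 0"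
          using xyW by (simp only: ip_smult_right) simp
        show "ip S x (\<lambda>i. ip S y y * x i) + ip S y (\<lambda>i. - ip S x x * y i) = 0"
          by (simp only: ip_smult_right) simp
      qed
      then have "(ip S y y - ip S x x) * k x y = 0"
        unfolding k_def mv_smult ip_smult_right ip_smult_left by (simp add: algebra_simps)
      then show ?thesis using False by simp
    qed
    \<comment> \<open>The squared norms are equal with sum 1, hence both are 1/2.\<close>
    define X where "X = (\<lambda>i. sqrt 2 * x i)"
    define Y where "Y = (\<lambda>i. sqrt 2 * y i)"
    have XX: "ip S X X = 1" "ip S Y Y = 1"
      using n1 eq unfolding X_def Y_def ip_smult_left ip_smult_right by (simp_all add: mult.assoc[symmetric])
    have nX: "nrm S X = 1" "nrm S Y = 1"
      using XX nrm_nonneg[of S X] nrm_nonneg[of S Y] unfolding ip_self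
      by (simp_all add: power2_eq_1_iff)
    show ?thesis
    proof (rule exI[of _ X], rule exI[of _ Y], intro conjI allI impI nX)
      show "ip S X Y = 0" using xy unfolding X_def Y_def ip_smult_left ip_smult_right by simp
      show "\<forall>k\<in>W. ip S (v k) X = 0 \<and> ip S (v k) Y = 0"
        using xyW unfolding X_def Y_def ip_smult_right by simp
      fix z assume z: "\<forall>k\<in>W. ip S (v k) z = 0" "ip S X z = 0" "ip S Y z = 0"
      have z': "ip S x z = 0" "ip S y z = 0"
        using z unfolding X_def Y_def ip_smult_left by auto
      have "k z y = 0" using first[of z "\<lambda>_. 0"] z z' by (simp add: k_def mv_def)
      then show "ip S z (mv S K Y) = 0"
        unfolding Y_def mv_smult ip_smult_right k_def by simp
      have "k x z = 0" using first[of "\<lambda>_. 0" z] z z' by (simp add: k_def)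
      then have "k z x = 0" using ksk[of x z] by simp
      then show "ip S z (mv S K X) = 0"
        unfolding X_def mv_smult ip_smult_right k_def by simp
    qed
  qed
qed


lemma onf_case_sumD:
  assumes "onf S (T <+> R) (case_sum u w)"
  shows "onf S T u" "onf S R w" "\<And>p r. p \<in> T \<Longrightarrow> r \<in> R \<Longrightarrow> ip S (u p) (w r) = 0"
    "\<And>p r. p \<in> T \<Longrightarrow> r \<in> R \<Longrightarrow> ip S (w r) (u p) = 0"
proof -
  have *: "ip S (case_sum u w p) (case_sum u w q) = (if p = q then 1 else 0)"
    if "p \<in> T <+> R" "q \<in> T <+> R" for p q by (rule onfD[OF assms that])
  show "onf S T u" "onf S R w"
    using *[OF InlI InlI] *[OF InrI InrI] by (simp_all add: onf_def)
  show "ip S (u p) (w r) = 0" "ip S (w r) (u p) = 0" if "p \<in> T" "r \<in> R" for p r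
    using *[OF InlI InrI, OF that] *[OF InrI InlI, OF that(2,1)] by simp_all
qed

text \<open>Iterating the extremal pair yields the normal form of a skew matrix with 2 by 2 diagonal
  blocks. It is recorded as block triangularity; skewness supplies the other half.\<close>

lemma skew_pairs:
  fixes K :: "'i \<Rightarrow> 'i \<Rightarrow> real"
  assumes fin: "finite S" and sk: "\<forall>i j. K j i = - K i j"
  shows "2 * N \<le> card S \<Longrightarrow> \<exists>x y. onf S ({..<N} <+> {..<N}) (case_sum x y) \<and>
     (\<forall>c<N. \<forall>z. (\<forall>k\<le>c. ip S (x k) z = 0 \<and> ip S (y k) z = 0) \<longrightarrow>
       ip S z (mv S K (y c)) = 0 \<and> ip S z (mv S K (x c)) = 0)"
proof (induction N)
  case 0
  then show ?case by (auto simp: onf_def)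
next
  case (Suc N)
  then obtain x y where o: "onf S ({..<N} <+> {..<N}) (case_sum x y)" and xy:
     "\<And>c z. c < N \<Longrightarrow> \<forall>k\<le>c. ip S (x k) z = 0 \<and> ip S (y k) z = 0 \<Longrightarrow>
       ip S z (mv S K (y c)) = 0 \<and> ip S z (mv S K (x c)) = 0" by auto
  have "Suc (card ({..<N} <+> {..<N})) < card S" using Suc.prems by (simp add: card_Plus)
  then obtain a b where ab: "nrm S a = 1" "nrm S b = 1" "ip S a b = 0"
    "\<forall>k\<in>{..<N} <+> {..<N}. ip S (case_sum x y k) a = 0 \<and> ip S (case_sum x y k) b = 0"
    "\<forall>z. (\<forall>k\<in>{..<N} <+> {..<N}. ip S (case_sum x y k) z = 0) \<longrightarrow> ip S a z = 0 \<longrightarrow> ip S b z = 0 \<longrightarrow>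
       ip S z (mv S K b) = 0 \<and> ip S z (mv S K a) = 0"
    using skew_maximal_pair[OF fin _ _ sk, of "{..<N} <+> {..<N}" "case_sum x y"] by auto
  have abx: "ip S (x k) a = 0" "ip S (x k) b = 0" "ip S (y k) a = 0" "ip S (y k) b = 0" if "k < N" for k
    using ab(4) that by (metis InlI InrI lessThan_iff sum.case)+
  have ox: "ip S (x k) (x l) = (if k = l then 1 else 0)" "ip S (y k) (y l) = (if k = l then 1 else 0)"
    "ip S (x k) (y l) = 0" if "k < N" "l < N" for k l
    using onf_case_sumD[OF o] that by (auto simp: onfD)
  let ?x = "x(N := a)" and ?y = "y(N := b)"
  show ?case
  proof (rule exI[of _ ?x], rule exI[of _ ?y], intro conjI allI impI)
    have abx': "ip S a (x k) = 0" "ip S b (x k) = 0" "ip S a (y k) = 0" "ip S b (y k) = 0" if "k < N" for k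
      using abx[OF that] ip_commute_real by metis+
    have "onf S {..<Suc N} ?x" "onf S {..<Suc N} ?y"
      unfolding onf_def using ox abx abx' ab ip_self_1[of S a] ip_self_1[of S b]
      by (auto simp: less_Suc_eq)
    moreover have "ip S (?x k) (?y l) = 0" if "k < Suc N" "l < Suc N" for k l
      using that ox abx abx' ab by (auto simp: less_Suc_eq)
    ultimately show "onf S ({..<Suc N} <+> {..<Suc N}) (case_sum ?x ?y)"
      by (intro onf_case_sum) auto
    fix c z assume c: "c < Suc N" and z: "\<forall>k\<le>c. ip S (?x k) z = 0 \<and> ip S (?y k) z = 0"
    have "ip S z (mv S K (?y c)) = 0 \<and> ip S z (mv S K (?x c)) = 0"
    proof (cases "c = N")
      case True
      have "\<forall>k\<in>{..<N} <+> {..<N}. ip S (case_sum x y k) z = 0"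
      proof
        fix k assume "k \<in> {..<N} <+> {..<N}"
        then show "ip S (case_sum x y k) z = 0"
        proof (elim PlusE)
          fix l assume "k = Inl l" "l \<in> {..<N}"
          then show ?thesis using z[rule_format, of l] True by simp
        next
          fix l assume "k = Inr l" "l \<in> {..<N}"
          then show ?thesis using z[rule_format, of l] True by simp
        qed
      qed
      moreover have "ip S a z = 0" "ip S b z = 0" using z[rule_format, of N] True by auto
      ultimately show ?thesis using ab(5) True by auto
    next
      case False
      then have cN: "c < N" using c by simp
      have "\<forall>k\<le>c. ip S (x k) z = 0 \<and> ip S (y k) z = 0"
      proof (intro allI impI)
        fix k assume "k \<le> c"
        then show "ip S (x k) z = 0 \<and> ip S (y k) z = 0" using z[rule_format, of k] cN by simp
      qed
      then show ?thesis using xy[OF cN] False by simp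
    qed
    then show "ip S z (mv S K (?y c)) = 0" "ip S z (mv S K (?x c)) = 0" by auto
  qed
qed

text \<open>If no diagonal entry vanishes, trace zero gives entries of both signs, and on the arc
  between the two coordinate vectors the form has a zero by the intermediate value theorem.\<close>

lemma real_zero_vector:
  fixes M :: "'i \<Rightarrow> 'i \<Rightarrow> real"
  assumes fin: "finite S" "S \<noteq> {}" and tr: "tr S M = 0"
  shows "\<exists>v. nrm S v = 1 \<and> ip S v (mv S M v) = 0"
proof (cases "\<exists>i\<in>S. M i i = 0")
  case True
  then obtain i where i: "i \<in> S" "M i i = 0" by blast
  have "ip S (\<lambda>k. if k = i then 1 else 0) (mv S M (\<lambda>k. if k = i then 1 else 0)) = M i i"
    using fin i by (simp add: ip_def mv_unit if_distrib[of "\<lambda>z. z * _"] cong: if_cong)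
  then show ?thesis using i fin nrm_unit by metis
next
  case False
  have "\<exists>i\<in>S. M i i < 0"
  proof (rule ccontr)
    assume "\<not> ?thesis"
    then have "0 < M i i" if "i \<in> S" for i using False that by force
    then have "0 < tr S M" unfolding tr_def using fin by (intro sum_pos) auto
    then show False using tr by simp
  qed
  moreover have "\<exists>i\<in>S. M i i > 0"
  proof (rule ccontr)
    assume "\<not> ?thesis"
    then have "0 < - M i i" if "i \<in> S" for i using False that by force
    then have "0 < (\<Sum>i\<in>S. - M i i)" using fin by (intro sum_pos) auto
    then show False using tr by (simp add: tr_def sum_negf)
  qed
  ultimately obtain i j where ij: "i \<in> S" "j \<in> S" "M i i < 0" "M j j > 0" by blast
  then have ne: "i \<noteq> j" by auto
  define v where "v t = (\<lambda>k. if k = i then cos t else if k = j then sin t else 0)" for t :: real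
  have "nrm S (v t) = 1" for t
  proof -
    have "(nrm S (v t))\<^sup>2 = (\<Sum>k\<in>S. (if k = i then (cos t)\<^sup>2 else 0) + (if k = j then (sin t)\<^sup>2 else 0))"
      unfolding nrm_sq by (rule sum.cong) (use ne in \<open>auto simp: v_def\<close>)
    also have "\<dots> = 1" using fin ij by (simp add: sum.distrib)
    finally show ?thesis by (simp add: power2_eq_1_iff) (smt (verit) nrm_nonneg)
  qed
  moreover have "\<exists>t. 0 \<le> t \<and> t \<le> pi / 2 \<and> ip S (v t) (mv S M (v t)) = 0"
  proof (rule IVT')
    have "ip S (\<lambda>k. if k = l then 1 else 0) (mv S M (\<lambda>k. if k = l then 1 else 0)) = M l l" if "l \<in> S" for l
      using fin that by (simp add: ip_def mv_unit if_distrib[of "\<lambda>z. z * _"] cong: if_cong)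
    moreover have "v 0 = (\<lambda>k. if k = i then 1 else 0)" "v (pi / 2) = (\<lambda>k. if k = j then 1 else 0)"
      using ne by (auto simp: v_def)
    ultimately show "ip S (v 0) (mv S M (v 0)) \<le> 0" "0 \<le> ip S (v (pi / 2)) (mv S M (v (pi / 2)))"
      using ij by auto
    have "continuous_on {0..pi / 2} (\<lambda>t. v t k)" for k
      by (cases "k = i"; cases "k = j") (auto simp: v_def intro!: continuous_intros)
    then show "continuous_on {0..pi / 2} (\<lambda>t. ip S (v t) (mv S M (v t)))"
      unfolding ip_def mv_def by (auto intro!: continuous_intros)
  qed auto
  ultimately show ?thesis by blast
qed

text \<open>In the rotated pairs the skew part of \<open>M\<close> vanishes on both halves, and
  rotating by a quarter turn exchanges them; hence some angle makes both traces vanish.\<close>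

lemma cm_real_even:
  fixes M :: "'i \<Rightarrow> 'i \<Rightarrow> real"
  assumes fin: "finite S" and M: "bnd S S M 1" and tr0: "tr S M = 0" and even: "card S = 2 * m"
  shows "cm S M 1 12"
proof -
  define K where "K i j = M i j - M j i" for i j
  have Kf: "ip S x (mv S K y) = ip S x (mv S M y) - ip S y (mv S M x)" for x y
  proof -
    have "mv S K y = (\<lambda>i. mv S M y i - mv S (adj M) y i)"
      by (simp add: mv_def K_def adj_def left_diff_distrib sum_subtractf)
    then have "ip S x (mv S K y) = ip S x (mv S M y) - ip S x (mv S (adj M) y)"
      by (simp add: ip_diff_right)
    moreover have "ip S x (mv S (adj M) y) = ip S (mv S M x) y" unfolding ip_adj by simp
    ultimately show ?thesis by (simp add: ip_commute_real[of S y])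
  qed
  obtain x y where o: "onf S ({..<m} <+> {..<m}) (case_sum x y)" and xy:
     "\<And>c z. c < m \<Longrightarrow> \<forall>k\<le>c. ip S (x k) z = 0 \<and> ip S (y k) z = 0 \<Longrightarrow>
       ip S z (mv S K (y c)) = 0 \<and> ip S z (mv S K (x c)) = 0"
    using skew_pairs[OF fin, of K m] even by (auto simp: K_def)
  define a where "a u v = ip S u (mv S M v)" for u v
  have ox: "ip S (x k) (x l) = (if k = l then 1 else 0)" "ip S (y k) (y l) = (if k = l then 1 else 0)"
    "ip S (x k) (y l) = 0" "ip S (y k) (x l) = 0" if "k < m" "l < m" for k l
    using onf_case_sumD[OF o] that by (auto simp: onfD)
  \<comment> \<open>Vectors from different pairs are orthogonal for the skew part. Only the two
    members of one pair see it, so choosing one vector from the plane of each pair always gives a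
    symmetric compression.\<close>
  have sym1: "a (x k) (x l) = a (x l) (x k)" "a (y k) (y l) = a (y l) (y k)"
      "a (x k) (y l) = a (y l) (x k)" "a (y k) (x l) = a (x l) (y k)" if "l < k" "k < m" for k l
  proof -
    have "\<forall>j\<le>l. ip S (x j) (x k) = 0 \<and> ip S (y j) (x k) = 0" "\<forall>j\<le>l. ip S (x j) (y k) = 0 \<and> ip S (y j) (y k) = 0"
      using ox that by auto
    from xy[OF _ this(1)] xy[OF _ this(2)] that
    show "a (x k) (x l) = a (x l) (x k)" "a (y k) (y l) = a (y l) (y k)"
      "a (x k) (y l) = a (y l) (x k)" "a (y k) (x l) = a (x l) (y k)" by (simp_all add: Kf a_def)
  qed
  define X where "X \<theta> k = (\<lambda>i. cos \<theta> * x k i + sin \<theta> * y k i)" for \<theta> k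
  define Y where "Y \<theta> k = (\<lambda>i. (- sin \<theta>) * x k i + cos \<theta> * y k i)" for \<theta> k
  have aX: "a (X \<theta> k) (X \<theta> l) = cos \<theta> * cos \<theta> * a (x k) (x l) + cos \<theta> * sin \<theta> * (a (x k) (y l) + a (y k) (x l))
     + sin \<theta> * sin \<theta> * a (y k) (y l)" for \<theta> k l
    unfolding a_def X_def mv_add mv_smult ip_add_left ip_add_right ip_smult_left ip_smult_right by (simp add: algebra_simps)
  have aY: "a (Y \<theta> k) (Y \<theta> l) = sin \<theta> * sin \<theta> * a (x k) (x l) - cos \<theta> * sin \<theta> * (a (x k) (y l) + a (y k) (x l))
     + cos \<theta> * cos \<theta> * a (y k) (y l)" for \<theta> k l
    unfolding a_def Y_def mv_add mv_smult ip_add_left ip_add_right ip_smult_left ip_smult_right by (simp add: algebra_simps)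
  have symX: "a (X \<theta> k) (X \<theta> l) = a (X \<theta> l) (X \<theta> k)" "a (Y \<theta> k) (Y \<theta> l) = a (Y \<theta> l) (Y \<theta> k)"
    if "k < m" "l < m" for \<theta> k l
  proof -
    consider "l < k" | "l = k" | "k < l" by linarith
    then have "a (x k) (x l) = a (x l) (x k) \<and> a (y k) (y l) = a (y l) (y k) \<and>
       a (x k) (y l) + a (y k) (x l) = a (x l) (y k) + a (y l) (x k)"
    proof cases
      case 1
      from sym1[OF this that(1)] show ?thesis by linarith
    next
      case 3
      from sym1[OF this that(2)] show ?thesis by linarith
    qed simp
    then show "a (X \<theta> k) (X \<theta> l) = a (X \<theta> l) (X \<theta> k)" "a (Y \<theta> k) (Y \<theta> l) = a (Y \<theta> l) (Y \<theta> k)"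
      unfolding aX aY by simp_all
  qed
  have sc: "cos \<theta> * cos \<theta> + sin \<theta> * sin \<theta> = (1 :: real)" for \<theta>
    using sin_cos_squared_add2[of \<theta>] by (simp add: power2_eq_square)
  have oXY: "onf S ({..<m} <+> {..<m}) (case_sum (X \<theta>) (Y \<theta>))" for \<theta>
  proof (rule onf_case_sum)
    have sc': "sin \<theta> * sin \<theta> + cos \<theta> * cos \<theta> = 1" using sc[of \<theta>] by linarith
    show "onf S {..<m} (X \<theta>)" "onf S {..<m} (Y \<theta>)"
      unfolding onf_def X_def Y_def ip_add_left ip_add_right ip_smult_left ip_smult_right
      by (auto simp: ox sc sc')
    show "ip S (X \<theta> k) (Y \<theta> l) = 0" if "k \<in> {..<m}" "l \<in> {..<m}" for k l
      using that unfolding X_def Y_def ip_add_left ip_add_right ip_smult_left ip_smult_right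
      by (auto simp: ox)
  qed
  define g where "g \<theta> = (\<Sum>k<m. a (X \<theta> k) (X \<theta> k))" for \<theta>
  have trg: "g \<theta> + (\<Sum>k<m. a (Y \<theta> k) (Y \<theta> k)) = 0" for \<theta>
  proof -
    have "tr ({..<m} <+> {..<m}) (fmx S M (case_sum (X \<theta>) (Y \<theta>))) = 0"
      using tr_fmx[OF oXY fin] even tr0 by (simp add: card_Plus)
    then show ?thesis by (simp add: tr_def sum.Plus fmx_def g_def a_def)
  qed
  have "\<exists>\<theta>. g \<theta> = 0"
  proof -
    have c: "continuous_on A g" for A unfolding g_def aX by (intro continuous_intros)
    have "g (pi / 2) = - g 0" using trg[of 0] by (simp add: g_def aX aY)
    then show ?thesis
      using IVT'[of g 0 0 "pi / 2", OF _ _ _ c] IVT2'[of g "pi / 2" 0 0, OF _ _ _ c] pi_ge_zero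
      by (cases "g 0 \<le> 0") (auto intro: less_imp_le)
  qed
  then obtain \<theta> where g0: "g \<theta> = 0" by blast
  let ?T = "{..<m} <+> {..<m}"
  let ?u = "case_sum (X \<theta>) (Y \<theta>)"
  let ?F = "fmx S M ?u"
  have F: "bnd ?T ?T ?F 1" by (rule bnd_fmx[OF oXY _ M]) simp
  have B: "{p \<in> ?T. isl p = True} = Inl ` {..<m}" "{p \<in> ?T. isl p = False} = Inr ` {..<m}" by auto
  have "cm (Inl ` {..<m}) ?F 1 1"
  proof (rule cm_self_adjoint)
    show "\<forall>i\<in>Inl ` {..<m}. \<forall>j\<in>Inl ` {..<m}. ?F j i = cj (?F i j)"
      using symX by (auto simp: fmx_def a_def)
    show "tr (Inl ` {..<m}) ?F = 0"
      using g0 by (simp add: tr_def sum.reindex fmx_def g_def a_def)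
    show "bnd (Inl ` {..<m}) (Inl ` {..<m}) ?F 1"
      by (rule bnd_subset[OF F]) auto
  qed auto
  from cm_rescale[OF this, of "1 / 4"] have c1: "cm (Inl ` {..<m}) ?F (1 / 4) 4" by simp
  have "cm (Inr ` {..<m}) ?F 1 1"
  proof (rule cm_self_adjoint)
    show "\<forall>i\<in>Inr ` {..<m}. \<forall>j\<in>Inr ` {..<m}. ?F j i = cj (?F i j)"
      using symX by (auto simp: fmx_def a_def)
    show "tr (Inr ` {..<m}) ?F = 0"
      using g0 trg[of \<theta>] by (simp add: tr_def sum.reindex fmx_def a_def)
    show "bnd (Inr ` {..<m}) (Inr ` {..<m}) ?F 1"
      by (rule bnd_subset[OF F]) auto
  qed auto
  from cm_rescale[OF this, of "1 / 4"] have c2: "cm (Inr ` {..<m}) ?F (1 / 4) 4" by simp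
  \<comment> \<open>Radii 1/4 about the centres 1/2 and -1/2 leave the gap 1/2, so the off-diagonal
    blocks add 4 * 2 to the 4 of the halves.\<close>
  have "cm ?T ?F 1 (4 + (real (card (UNIV :: bool set)))\<^sup>2 * (1 / (1 / 2)))"
  proof (rule cm_blocks[OF _ _ _ F, where \<pi> = isl and \<beta> = "\<lambda>_. 1 / 4" and z = "\<lambda>s. if s then 1 / 2 else - 1 / 2"])
    fix s :: bool
    show "cm {p \<in> ?T. isl p = s} ?F (1 / 4) 4" using c1 c2 B by (cases s) auto
  qed auto
  then have "cm ?T ?F 1 12" by (simp add: UNIV_bool)
  then show ?thesis by (intro cm_transfer[OF oXY]) (use fin even in \<open>auto simp: card_Plus\<close>)
qed

text \<open>An odd dimension is made even by peeling off one vector with vanishing form; with \<eta>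
  = 1 the bounds 1 and 12 become 2 and 16.\<close>

lemma cm_real:
  fixes M :: "'i \<Rightarrow> 'i \<Rightarrow> real"
  assumes fin: "finite S" and M: "bnd S S M 1" and tr0: "tr S M = 0"
  shows "cm S M 2 16"
proof (cases "even (card S)")
  case True
  then obtain m where "card S = 2 * m" by blast
  from cm_real_even[OF assms this] show ?thesis by (rule cm_mono) auto
next
  case False
  then obtain m where m: "card S = 2 * m + 1" by (meson oddE)
  then have "S \<noteq> {}" by auto
  obtain v where v: "nrm S v = 1" "ip S v (mv S M v) = 0"
    using real_zero_vector[OF fin \<open>S \<noteq> {}\<close> tr0] by blast
  let ?u = "\<lambda>_ :: unit. v"
  have u: "onf S {()} ?u" using v by (simp add: onf_def ip_self_1)
  obtain w where w: "onf S {..<2 * m} w" "\<forall>k<2 * m. \<forall>j\<in>{()}. ip S (?u j) (w k) = 0"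
    using null_family[of "{()}" S "2 * m" ?u] fin m by auto
  have o: "onf S ({()} <+> {..<2 * m}) (case_sum ?u w)"
    by (rule onf_case_sum[OF u w(1)]) (use w in auto)
  have "tr ({()} <+> {..<2 * m}) (fmx S M (case_sum ?u w)) = 0"
    using tr_fmx[OF o fin] m tr0 by (simp add: card_Plus)
  then have "tr {..<2 * m} (fmx S M w) = 0"
    using v by (simp add: tr_def sum.Plus fmx_def)
  then have "cm {..<2 * m} (fmx S M w) 1 12"
    by (intro cm_real_even[of _ _ m] bnd_fmx[OF w(1) _ M]) auto
  then have "cm S M (1 + 1) (12 + 4 / 1)"
    by (intro cm_peel[OF fin _ _ _ M u w(1)]) (use m v w in \<open>auto simp: fmx_def\<close>)
  then show ?thesis by simp
qed

subsection \<open>Numerical ranges of complex matrices\<close>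

lemma cj_cnj [simp]: "cj (z :: complex) = cnj z"
  by (simp add: cj_complex_def)

text \<open>The form is normalised affinely so that its values at \<open>x\<close> and
  \<open>y\<close> are 0 and 1, and \<open>y\<close> is turned by a phase that makes the mixed term
  real. Along the segment between them the normalised form is real and continuous, so it takes every
  value in between. The version for a subspace \<open>U\<close> is what the greedy search for zero
  vectors needs.\<close>

lemma Toeplitz_Hausdorff:
  fixes M :: "'i \<Rightarrow> 'i \<Rightarrow> complex"
  assumes fin: "finite S"
    and U: "\<And>x y \<alpha> \<beta>. x \<in> U \<Longrightarrow> y \<in> U \<Longrightarrow> (\<lambda>i. \<alpha> * x i + \<beta> * y i) \<in> U"
  shows "convex {ip S x (mv S M x) | x. x \<in> U \<and> nrm S x = 1}" (is "convex ?W")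
proof (rule convexI)
  fix \<alpha> \<beta> and r t :: real
  assume "\<alpha> \<in> ?W" "\<beta> \<in> ?W" and rt: "0 \<le> r" "0 \<le> t" "r + t = 1"
  then obtain x y where x: "x \<in> U" "nrm S x = 1" "ip S x (mv S M x) = \<alpha>"
    and y: "y \<in> U" "nrm S y = 1" "ip S y (mv S M y) = \<beta>" by blast
  have r: "r = 1 - t" using rt by simp
  show "r *\<^sub>R \<alpha> + t *\<^sub>R \<beta> \<in> ?W"
  proof (cases "\<alpha> = \<beta>")
    case True
    then have "r *\<^sub>R \<alpha> + t *\<^sub>R \<beta> = \<alpha>" by (simp add: r scaleR_left_diff_distrib)
    then show ?thesis using x by blast
  next
    case False
    define g where "g = 1 / (\<beta> - \<alpha>)"
    have g: "(\<beta> - \<alpha>) * g = 1" using False by (simp add: g_def)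
    define b where "b u v = (ip S u (mv S M v) - \<alpha> * ip S u v) * g" for u v
    have b_sum: "b (\<lambda>i. p * u i + q * v i) (\<lambda>i. p * u i + q * v i) =
       cnj p * p * b u u + cnj p * q * b u v + cnj q * p * b v u + cnj q * q * b v v" for p q u v
      unfolding b_def mv_add mv_smult ip_add_left ip_add_right ip_smult_left ip_smult_right
      by (simp add: algebra_simps)
    have bx: "b x x = 0" using x by (simp add: b_def ip_self_1)
    have by1: "b y y = 1" using y g by (simp add: b_def ip_self_1)
    \<comment> \<open>The imaginary part of the mixed term e b(x, y) + cnj e b(y, x) equals that of
      e w; the phase makes e w real.\<close>
    define w where "w = b x y - cnj (b y x)"
    define e where "e = (if w = 0 then 1 else cnj w / of_real (norm w))"
    have e1: "norm e = 1" by (simp add: e_def norm_divide)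
    have ee: "cnj e * e = 1" using e1 complex_norm_square[of e] by (simp add: mult.commute)
    have ew: "Im (e * w) = 0"
      using complex_norm_square[of w] by (simp add: e_def mult.commute) 
    define \<rho> where "\<rho> = Re (e * b x y + cnj e * b y x)"
    have "Im (e * b x y + cnj e * b y x) = Im (e * w)"
      by (simp add: w_def algebra_simps)
    then have real: "e * b x y + cnj e * b y x = of_real \<rho>"
      using ew by (simp add: \<rho>_def complex_eq_iff)
    define z where "z s = (\<lambda>i. of_real (1 - s) * x i + (of_real s * e) * y i)" for s :: real
    have bz: "b (z s) (z s) = of_real (s\<^sup>2 + s * (1 - s) * \<rho>)" for s
    proof -
      have "b (z s) (z s) = of_real ((1 - s) * s) * (e * b x y + cnj e * b y x) + of_real (s * s) * (cnj e * e)"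
        unfolding z_def b_sum bx by1 by (simp add: algebra_simps)
      then show ?thesis unfolding real ee by (simp add: power2_eq_square algebra_simps)
    qed
    \<comment> \<open>If the segment met 0, \<open>x\<close> would be a unimodular multiple of
      \<open>y\<close> on \<open>S\<close>, and \<alpha> and \<beta> would coincide.\<close>
    have zpos: "nrm S (z s) \<noteq> 0" if s: "0 \<le> s" "s \<le> 1" for s
    proof
      assume "nrm S (z s) = 0"
      then have z0: "of_real (1 - s) * x i = (- (of_real s * e)) * y i" if "i \<in> S" for i
        using fin that by (simp add: nrm_eq_0_iff z_def eq_neg_iff_add_eq_0)
      have "nrm S (\<lambda>i. of_real (1 - s) * x i) = nrm S (\<lambda>i. (- (of_real s * e)) * y i)"
        by (rule nrm_cong) (use z0 in simp)
      then have "\<bar>1 - s\<bar> = \<bar>s\<bar>"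
        unfolding nrm_smult norm_minus_cancel norm_mult norm_of_real x(2) y(2) e1 by simp
      then have s2: "s = 1 / 2" using s by linarith
      have xy: "x i = (- e) * y i" if "i \<in> S" for i using z0[OF that] by (simp add: s2)
      have "mv S M x = mv S M (\<lambda>i. (- e) * y i)" by (rule mv_cong) (rule xy)
      then have "\<alpha> = ip S x (mv S M (\<lambda>i. (- e) * y i))" using x by simp
      also have "\<dots> = ip S (\<lambda>i. (- e) * y i) (mv S M (\<lambda>i. (- e) * y i))"
        by (rule ip_cong) (use xy in auto)
      also have "\<dots> = cnj e * e * \<beta>" unfolding mv_smult ip_smult_left ip_smult_right using y by simp
      finally show False using ee False by simp
    qed
    define f where "f s = (s\<^sup>2 + s * (1 - s) * \<rho>) / (nrm S (z s))\<^sup>2" for s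
    have "continuous_on {0..1} f"
      unfolding f_def nrm_sq
    proof (intro continuous_intros ballI)
      show "continuous_on {0..1} (\<lambda>s. z s i)" for i unfolding z_def by (intro continuous_intros)
      fix s :: real assume "s \<in> {0..1}"
      then show "(\<Sum>i\<in>S. (cmod (z s i))\<^sup>2) \<noteq> 0" using zpos[of s] by (simp flip: nrm_sq)
    qed
    moreover have "f 0 = 0" by (simp add: f_def)
    moreover have "f 1 = 1"
    proof -
      have "nrm S (z 1) = 1" unfolding z_def using y e1 nrm_smult[of S e y] by simp
      then show ?thesis by (simp add: f_def)
    qed
    ultimately obtain s where s: "0 \<le> s" "s \<le> 1" "f s = t"
      using IVT'[of f 0 t 1] rt by auto
    obtain c where c: "nrm S (\<lambda>i. c * z s i) = 1" using normalizing_factor[OF zpos[OF s(1,2)]] by blast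
    have cc: "cnj c * c * of_real ((nrm S (z s))\<^sup>2) = 1"
    proof -
      have "norm c * nrm S (z s) = 1" using c by (simp only: nrm_smult)
      then have "(norm c)\<^sup>2 * (nrm S (z s))\<^sup>2 = 1" by (simp flip: power_mult_distrib)
      then have "of_real ((norm c)\<^sup>2 * (nrm S (z s))\<^sup>2) = (1 :: complex)" by simp
      then show ?thesis using complex_norm_square[of c] by (simp add: mult.commute)
    qed
    define v where "v = (\<lambda>i. c * z s i)"
    have "v = (\<lambda>i. (c * of_real (1 - s)) * x i + (c * (of_real s * e)) * y i)"
      by (simp add: v_def z_def algebra_simps)
    then have vU: "v \<in> U" using U[OF x(1) y(1)] by simp
    have "b v v = cnj c * c * b (z s) (z s)"
      unfolding v_def b_def mv_smult ip_smult_left ip_smult_right by (simp add: algebra_simps)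
    also have "\<dots> = (cnj c * c * of_real ((nrm S (z s))\<^sup>2)) * of_real (f s)"
      unfolding bz f_def using zpos[OF s(1,2)] by (simp add: power2_eq_square)
    finally have "b v v = of_real t" using cc s by simp
    moreover have "(\<beta> - \<alpha>) * b v v = ip S v (mv S M v) - \<alpha>"
    proof -
      have "(\<beta> - \<alpha>) * b v v = ((\<beta> - \<alpha>) * g) * (ip S v (mv S M v) - \<alpha>)"
        using c ip_self_1[of S v] by (simp add: b_def v_def[symmetric] mult_ac)
      then show ?thesis using g by simp
    qed
    ultimately have "ip S v (mv S M v) = \<alpha> + t *\<^sub>R (\<beta> - \<alpha>)"
      by (simp add: scaleR_conv_of_real algebra_simps)
    moreover have "\<alpha> + t *\<^sub>R (\<beta> - \<alpha>) = r *\<^sub>R \<alpha> + t *\<^sub>R \<beta>"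
      by (simp add: r algebra_simps)
    ultimately have "r *\<^sub>R \<alpha> + t *\<^sub>R \<beta> = ip S v (mv S M v)" by simp
    moreover have "nrm S v = 1" using c by (simp add: v_def)
    ultimately show ?thesis using vU by blast
  qed
qed

text \<open>The normalised trace is a convex combination of diagonal entries, which are values of
  the form at unit vectors.\<close>

lemma average_vector:
  fixes M :: "'i \<Rightarrow> 'i \<Rightarrow> complex"
  assumes fin: "finite S" "S \<noteq> {}"
  shows "\<exists>v. nrm S v = 1 \<and> ip S v (mv S M v) = tr S M / of_nat (card S)"
proof -
  let ?W = "{ip S x (mv S M x) | x. x \<in> UNIV \<and> nrm S x = 1}"
  have cv: "convex ?W" by (rule Toeplitz_Hausdorff[OF fin(1)]) auto
  have Mi: "M i i \<in> ?W" if "i \<in> S" for i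
  proof -
    have "ip S (\<lambda>k. if k = i then 1 else 0) (mv S M (\<lambda>k. if k = i then 1 else 0)) = M i i"
      using fin that by (simp add: ip_def mv_unit if_distrib[of cnj] if_distrib[of "\<lambda>z. z * _"] cong: if_cong)
    then show ?thesis using nrm_unit[OF fin(1) that, where 'a = complex] by force
  qed
  have "(\<Sum>i\<in>S. (1 / real (card S)) *\<^sub>R M i i) \<in> ?W"
    by (rule convex_sum[OF fin(1) cv]) (use fin Mi in auto)
  moreover have "(\<Sum>i\<in>S. (1 / real (card S)) *\<^sub>R M i i) = tr S M / of_nat (card S)"
    by (simp add: tr_def scaleR_conv_of_real sum_divide_distrib)
  ultimately show ?thesis by auto
qed

lemma vector_split:
  fixes M :: "'i \<Rightarrow> 'i \<Rightarrow> 'a::star_field"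
  assumes fin: "finite S" and n: "card S = Suc n" and v: "nrm S v = 1"
  shows "\<exists>w. onf S {..<n} w \<and> (\<forall>k<n. ip S v (w k) = 0) \<and>
    tr {..<n} (fmx S M w) = tr S M - ip S v (mv S M v)"
proof -
  let ?u = "\<lambda>_ :: unit. v"
  have u: "onf S {()} ?u" using v by (simp add: onf_def ip_self_1)
  obtain w where w: "onf S {..<n} w" "\<forall>k<n. \<forall>j\<in>{()}. ip S (?u j) (w k) = 0"
    using null_family[of "{()}" S n ?u] fin n by auto
  have o: "onf S ({()} <+> {..<n}) (case_sum ?u w)"
    by (rule onf_case_sum[OF u w(1)]) (use w in auto)
  have "tr ({()} <+> {..<n}) (fmx S M (case_sum ?u w)) = tr S M"
    using tr_fmx[OF o fin] n by (simp add: card_Plus)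
  then have "tr {..<n} (fmx S M w) = tr S M - ip S v (mv S M v)"
    by (simp add: tr_def sum.Plus fmx_def algebra_simps)
  then show ?thesis using w by auto
qed

lemma cm_peel_vector:
  fixes M :: "'i \<Rightarrow> 'i \<Rightarrow> 'a::star_field"
  assumes fin: "finite S" and n: "card S = Suc n" and M: "bnd S S M 1"
    and v: "nrm S v = 1" "ip S v (mv S M v) = 0"
    and w: "onf S {..<n} w" "\<forall>k<n. ip S v (w k) = 0"
    and c: "cm {..<n} (fmx S M w) b c" "0 \<le> b" "0 \<le> c" "0 < \<eta>"
  shows "cm S M (b + \<eta>) (c + 4 / \<eta>)"
  by (rule cm_peel[OF fin _ _ _ M _ w(1) _ _ c, of "{()}" "\<lambda>_. v"])
    (use n v w in \<open>auto simp: onf_def ip_self_1 fmx_def\<close>)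

text \<open>The induction passes to the complement of a vector, whose matrix has another index type;
  hence the detour through matrices indexed by natural numbers.\<close>

lemma constant_diagonal_nat:
  fixes M :: "nat \<Rightarrow> nat \<Rightarrow> complex"
  shows "\<exists>u. onf {..<n} {..<n} u \<and> (\<forall>p<n. fmx {..<n} M u p p = tr {..<n} M / of_nat n)"
proof (induction n arbitrary: M)
  case 0
  then show ?case by (auto simp: onf_def)
next
  case (Suc n)
  let ?S = "{..<Suc n}"
  define \<mu> where "\<mu> = tr ?S M / of_nat (Suc n)"
  have tr: "tr ?S M = of_nat (Suc n) * \<mu>" by (simp add: \<mu>_def del: of_nat_Suc)
  obtain v where v: "nrm ?S v = 1" "ip ?S v (mv ?S M v) = \<mu>"
    using average_vector[of ?S M] by (auto simp: \<mu>_def)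
  obtain w where w: "onf ?S {..<n} w" "\<forall>k<n. ip ?S v (w k) = 0"
    "tr {..<n} (fmx ?S M w) = tr ?S M - \<mu>"
    using vector_split[of ?S n v M] v by auto
  obtain c where c: "onf {..<n} {..<n} c" "\<forall>p<n. fmx {..<n} (fmx ?S M w) c p p = tr {..<n} (fmx ?S M w) / of_nat n"
    using Suc.IH by blast
  define u where "u = case_nat v (\<lambda>p. lin {..<n} w (c p))"
  have wv: "ip ?S (w k) v = 0" if "k < n" for k
    using w(2) that by (metis cj_ip cj_0)
  have cross: "ip ?S v (lin {..<n} w d) = 0" "ip ?S (lin {..<n} w d) v = 0" for d
    using w(2) wv by (simp_all add: ip_lin_right ip_lin_left)
  have "onf ?S ?S u"
    unfolding onf_def
  proof (intro ballI)
    fix p q assume "p \<in> ?S" "q \<in> ?S"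
    then show "ip ?S (u p) (u q) = (if p = q then 1 else 0)"
      using cross v(1) c(1) w(1)
      by (cases p; cases q) (auto simp: u_def ip_self_1 ip_lin_lin onfD)
  qed
  moreover have "fmx ?S M u p p = \<mu>" if "p < Suc n" for p
  proof (cases p)
    case 0
    then show ?thesis using v by (simp add: fmx_def u_def)
  next
    case (Suc p')
    then have p': "p' < n" using that by simp
    have "fmx ?S M u p p = fmx ?S M (\<lambda>r. lin {..<n} w (c r)) p' p'"
      using Suc by (simp add: fmx_def u_def)
    \<comment> \<open>Removing a vector whose value is the average leaves the average
      unchanged.\<close>
    also have "\<dots> = (tr ?S M - \<mu>) / of_nat n"
      unfolding fmx_lin using c(2) w(3) p' by simp
    also have "\<dots> = \<mu>" using p' by (simp add: tr algebra_simps)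
    finally show ?thesis .
  qed
  ultimately show ?case by (auto simp: \<mu>_def)
qed

lemma bnd_reindex:
  fixes M :: "'i \<Rightarrow> 'i \<Rightarrow> 'a::star_field"
  assumes h: "bij_betw h T S" and "finite S" "bnd S S M c"
  shows "bnd T T (\<lambda>p q. M (h p) (h q)) c"
  unfolding bnd_def
proof
  fix x :: "'b \<Rightarrow> 'a"
  define y where "y i = x (inv_into T h i)" for i
  have yh: "y (h p) = x p" if "p \<in> T" for p
    using h that by (simp add: y_def bij_betw_def)
  have n: "nrm T (\<lambda>p. z (h p)) = nrm S z" for z :: "'i \<Rightarrow> 'a"
    unfolding nrm_def L2_set_def using sum.reindex_bij_betw[OF h, of "\<lambda>i. (norm (z i))\<^sup>2"] by simp
  have "mv T (\<lambda>p q. M (h p) (h q)) x = (\<lambda>p. mv S M y (h p))"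
  proof
    fix p
    have "mv S M y (h p) = (\<Sum>q\<in>T. M (h p) (h q) * y (h q))"
      unfolding mv_def by (rule sum.reindex_bij_betw[OF h, symmetric])
    then show "mv T (\<lambda>p q. M (h p) (h q)) x p = mv S M y (h p)" by (simp add: mv_def yh)
  qed
  then have "nrm T (mv T (\<lambda>p q. M (h p) (h q)) x) = nrm S (mv S M y)"
    using n[of "mv S M y"] by simp
  also have "\<dots> \<le> c * nrm S y" by (rule bndD[OF assms(3)])
  also have "nrm S y = nrm T x" unfolding n[of y, symmetric] by (rule nrm_cong) (rule yh)
  finally show "nrm T (mv T (\<lambda>p q. M (h p) (h q)) x) \<le> c * nrm T x" .
qed

text \<open>Peeling off one zero vector at a time with \<eta> = 1 costs 1 and 4 per dimension. This
  covers the dimensions below a fixed bound, where the induction starts.\<close>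

lemma cm_small:
  fixes M :: "'i \<Rightarrow> 'i \<Rightarrow> complex"
  assumes "finite S" "bnd S S M 1" "tr S M = 0"
  shows "cm S M (real (card S)) (4 * real (card S))"
proof -
  have nat: "cm {..<n} N (real n) (4 * real n)"
    if "bnd {..<n} {..<n} N 1" "tr {..<n} N = 0" for n and N :: "nat \<Rightarrow> nat \<Rightarrow> complex"
    using that
  proof (induction n arbitrary: N)
    case 0
    then show ?case by (intro cm_zero) auto
  next
    case (Suc n)
    let ?S = "{..<Suc n}"
    obtain v where v: "nrm ?S v = 1" "ip ?S v (mv ?S N v) = 0"
      using average_vector[of ?S N] Suc by auto
    obtain w where w: "onf ?S {..<n} w" "\<forall>k<n. ip ?S v (w k) = 0"
      "tr {..<n} (fmx ?S N w) = 0"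
      using vector_split[of ?S n v N] v Suc by auto
    have "cm {..<n} (fmx ?S N w) (real n) (4 * real n)"
      by (rule Suc.IH) (use w Suc in \<open>auto intro: bnd_fmx\<close>)
    then have "cm ?S N (real n + 1) (4 * real n + 4 / 1)"
      by (intro cm_peel_vector[OF _ _ _ v w(1,2)]) (use Suc in auto)
    then show ?case by (simp add: algebra_simps)
  qed
  obtain h where h: "bij_betw h {..<card S} S" using ex_bij_betw_nat_finite[OF assms(1)] by (auto simp: atLeast0LessThan)
  have "cm {..<card S} (\<lambda>p q. M (h p) (h q)) (real (card S)) (4 * real (card S))"
  proof (rule nat)
    show "tr {..<card S} (\<lambda>p q. M (h p) (h q)) = 0"
      using assms(3) sum.reindex_bij_betw[OF h, of "\<lambda>i. M i i"] by (simp add: tr_def)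
    show "bnd {..<card S} {..<card S} (\<lambda>p q. M (h p) (h q)) 1"
      by (rule bnd_reindex[OF h assms(1,2)])
  qed
  then show ?thesis by (rule cm_reindex[OF h assms(1)])
qed

text \<open>The discrete Fourier matrix, wanted for its entries of equal modulus: in such a basis
  every diagonal entry of a diagonal matrix is its average.\<close>

lemma Fourier_basis:
  assumes "0 < k"
  shows "\<exists>\<Gamma>. onf {..<k} {..<k} \<Gamma> \<and> (\<forall>j l. cmod (\<Gamma> j l) = 1 / sqrt (real k))"
proof -
  define \<omega> where "\<omega> = cis (2 * pi / real k)"
  define \<Gamma> where "\<Gamma> j l = \<omega> ^ (j * l) / of_real (sqrt (real k))" for j l
  have wk: "\<omega> ^ k = 1"
  proof -
    have "\<omega> ^ k = cis (real k * (2 * pi / real k))" unfolding \<omega>_def by (rule Complex.DeMoivre)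
    also have "real k * (2 * pi / real k) = 2 * pi" using assms by simp
    finally show ?thesis by simp
  qed
  have cw: "cnj \<omega> * \<omega> = 1" by (simp add: \<omega>_def cis_cnj cis_mult)
  have ne: "\<omega> ^ j \<noteq> \<omega> ^ j'" if "j < k" "j' < k" "j \<noteq> j'" for j j'
    using Complex.bij_betw_roots_unity[OF assms] that
    by (auto simp: \<omega>_def Complex.DeMoivre bij_betw_def inj_on_def mult_ac)
  have "onf {..<k} {..<k} \<Gamma>"
    unfolding onf_def
  proof (intro ballI)
    fix p q assume pq: "p \<in> {..<k}" "q \<in> {..<k}"
    define z where "z = cnj \<omega> ^ p * \<omega> ^ q"
    have sk: "complex_of_real (sqrt (real k)) * complex_of_real (sqrt (real k)) = of_nat k"
      by (simp flip: of_real_mult)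
    have "ip {..<k} (\<Gamma> p) (\<Gamma> q) = (\<Sum>l<k. z ^ l) / of_nat k"
      unfolding ip_def sum_divide_distrib
      by (rule sum.cong) (simp_all add: \<Gamma>_def z_def sk power_mult power_mult_distrib)
    also have "\<dots> = (if p = q then 1 else 0)"
    proof (cases "p = q")
      case True
      then have "z = 1" using cw by (simp add: z_def flip: power_mult_distrib)
      then show ?thesis using True assms by simp
    next
      case False
      have "z \<noteq> 1"
      proof
        assume "z = 1"
        have "\<omega> ^ p = \<omega> ^ p * z" using \<open>z = 1\<close> by simp
        also have "\<dots> = (cnj \<omega> * \<omega>) ^ p * \<omega> ^ q" by (simp add: z_def power_mult_distrib)
        finally have "\<omega> ^ p = \<omega> ^ q" using cw by simp
        then show False using ne[of p q] pq False by simp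
      qed
      moreover have "z ^ k = 1"
      proof -
        have "z ^ k = (cnj \<omega> ^ k) ^ p * (\<omega> ^ k) ^ q"
          by (simp add: z_def power_mult_distrib flip: power_mult) (simp add: mult.commute)
        also have "cnj \<omega> ^ k = 1" using wk by (metis complex_cnj_power complex_cnj_one)
        finally show ?thesis using wk by simp
      qed
      ultimately show ?thesis using False by (simp add: geometric_sum)
    qed
    finally show "ip {..<k} (\<Gamma> p) (\<Gamma> q) = (if p = q then 1 else 0)" .
  qed
  moreover have "cmod (\<Gamma> j l) = 1 / sqrt (real k)" for j l
    using assms by (simp add: \<Gamma>_def \<omega>_def norm_divide norm_power)
  ultimately show ?thesis by blast
qed

subsection \<open>Balanced groups\<close>

lemma sorted_enumeration:
  fixes \<kappa> :: "'i \<Rightarrow> real"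
  assumes "finite T"
  shows "\<exists>h. bij_betw h {..<card T} T \<and> (\<forall>i j. i \<le> j \<longrightarrow> j < card T \<longrightarrow> \<kappa> (h i) \<le> \<kappa> (h j))"
proof -
  obtain ys where ys: "set ys = T" "distinct ys" using finite_distinct_list[OF assms] by blast
  define xs where "xs = sort_key \<kappa> ys"
  have xs: "set xs = T" "distinct xs" "sorted (map \<kappa> xs)"
    using ys by (simp_all add: xs_def)
  have len: "length xs = card T" using xs distinct_card by metis
  have "bij_betw ((!) xs) {..<card T} T"
    by (rule bij_betw_nth[OF xs(2)]) (simp_all only: len xs(1))
  moreover have "\<kappa> (xs ! i) \<le> \<kappa> (xs ! j)" if "i \<le> j" "j < card T" for i j
    using sorted_nth_mono[OF xs(3), of i j] that len by simp
  ultimately show ?thesis by blast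
qed

text \<open>Sort by \<open>\<kappa>\<close> and let the groups be the residue classes of the position modulo \<open>m\<close>:
  the group sums interlace, so they differ by at most the length of the range of \<open>\<kappa>\<close>.\<close>

lemma balanced_groups:
  fixes \<kappa> :: "'i \<Rightarrow> real"
  assumes fin: "finite T" "card T = m * k" and k: "\<And>i. i \<in> T \<Longrightarrow> \<bar>\<kappa> i\<bar> \<le> 1"
  shows "\<exists>\<psi>. bij_betw \<psi> ({..<m} \<times> {..<k}) T \<and>
    (\<forall>c<m. \<bar>real m * (\<Sum>l<k. \<kappa> (\<psi> (c, l))) - (\<Sum>i\<in>T. \<kappa> i)\<bar> \<le> 2 * real m)"
proof -
  obtain h where h: "bij_betw h {..<card T} T" "\<And>i j. i \<le> j \<Longrightarrow> j < card T \<Longrightarrow> \<kappa> (h i) \<le> \<kappa> (h j)"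
    using sorted_enumeration[OF fin(1), of \<kappa>] by (elim exE conjE) (erule that, iprover)
  define x where "x i = \<kappa> (h i)" for i
  have xmono: "x i \<le> x j" if "i \<le> j" "j < m * k" for i j 
    unfolding x_def by (rule h(2)[OF that(1)]) (use that fin(2) in simp)
  have x1: "\<bar>x i\<bar> \<le> 1" if "i < m * k" for i 
    unfolding x_def by (rule k) (use bij_betwE[OF h(1)] that fin(2) in simp)
  define \<psi> where "\<psi> = (\<lambda>(c, l). h (l * m + c))"
  have pos: "l * m + c < m * k" if "c < m" "l < k" for c l
  proof -
    have "l * m + c < Suc l * m" using that by simp
    also have "\<dots> \<le> k * m" using that by (intro mult_le_mono1) simp
    finally show ?thesis by (simp add: mult.commute)
  qed
  have "bij_betw (\<lambda>(c, l). l * m + c) ({..<m} \<times> {..<k}) {..<card T}"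
  proof (rule bij_betw_byWitness[where f' = "\<lambda>i. (i mod m, i div m)"])
    show "(\<lambda>i. (i mod m, i div m)) ` {..<card T} \<subseteq> {..<m} \<times> {..<k}"
      using fin by (auto simp: less_mult_imp_div_less mult.commute intro!: mod_less_divisor) (metis gr0I mult_is_0 not_less0)
  qed (use pos fin in auto)
  from bij_betw_trans[OF this h(1)] have \<psi>: "bij_betw \<psi> ({..<m} \<times> {..<k}) T"
    by (simp add: \<psi>_def comp_def case_prod_beta' split_def)
  define G where "G c = (\<Sum>l<k. x (l * m + c))" for c
  have Gle: "G c' - G c \<le> 2" if cc: "c < m" "c' < m" for c c'
  proof (cases k)
    case 0
    then show ?thesis by (simp add: G_def)
  next
    case (Suc k')
    \<comment> \<open>Two groups differ at level \<open>l\<close> by at most the increase of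
      \<open>x\<close> from position l m to position (l + 1) m; the last interval ends at m k - 1,
      the last position. The increases telescope to the length of the range.\<close>
    define y where "y l = (if l = k then x (m * k - 1) else x (l * m))" for l
    have "x (l * m + c') - x (l * m + c) \<le> y (Suc l) - y l" if l: "l < k" for l
    proof -
      have "x (l * m) \<le> x (l * m + c)" by (rule xmono) (use pos[OF \<open>c < m\<close> l] in auto)
      moreover have "x (l * m + c') \<le> y (Suc l)"
      proof (cases "Suc l = k")
        case True
        then show ?thesis using pos[OF \<open>c' < m\<close> l] by (simp add: y_def) (rule xmono; simp)
      next
        case False
        then have "Suc l < k" using l by simp
        from pos[OF _ this, of 0] cc show ?thesis using False cc(2) by (simp add: y_def) (rule xmono; simp add: less_imp_le)
      qed
      ultimately show ?thesis using l by (simp add: y_def)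
    qed
    then have "G c' - G c \<le> (\<Sum>l<k. y (Suc l) - y l)"
      unfolding G_def sum_subtractf[symmetric] by (intro sum_mono) auto
    also have "\<dots> = y k - y 0" by (rule sum_lessThan_telescope)
    also have "\<dots> \<le> 2"
    proof -
      have "0 < m * k" using cc Suc by simp
      then show ?thesis using x1[of "m * k - 1"] x1[of 0] Suc by (auto simp: y_def abs_le_iff)
    qed
    finally show ?thesis .
  qed
  have Gsum: "(\<Sum>c<m. G c) = (\<Sum>i\<in>T. \<kappa> i)"
    using sum.reindex_bij_betw[OF \<psi>, of \<kappa>] by (simp add: \<psi>_def G_def x_def sum.cartesian_product split_def)
  have "\<bar>real m * G c - (\<Sum>i\<in>T. \<kappa> i)\<bar> \<le> 2 * real m" if "c < m" for c
  proof -
    have "real m * G c - (\<Sum>i\<in>T. \<kappa> i) = (\<Sum>c'<m. G c - G c')"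
      by (simp add: Gsum sum_subtractf)
    also have "\<bar>\<dots>\<bar> \<le> (\<Sum>c'<m. 2)"
      by (rule order_trans[OF sum_abs sum_mono]) (use Gle that in \<open>auto simp: abs_le_iff\<close>)
    finally show ?thesis by simp
  qed
  then show ?thesis using \<psi> by (intro exI[of _ \<psi>]) (auto simp: \<psi>_def G_def x_def)
qed

subsection \<open>Zero blocks versus thin forms\<close>

text \<open>On a subspace of codimension at most \<open>L\<close> the numerical range lies in a
  closed half plane with 0 on its boundary. The subspace is given by conditions rather than by a
  basis, so that thinness passes to compressions with the same \<open>L\<close>.\<close>

definition thin :: "'i set \<Rightarrow> ('i \<Rightarrow> 'i \<Rightarrow> complex) \<Rightarrow> nat \<Rightarrow> bool" where
  "thin S M L \<longleftrightarrow> (\<exists>g :: nat \<Rightarrow> 'i \<Rightarrow> complex. \<exists>\<zeta>. cmod \<zeta> = 1 \<and>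
     (\<forall>x. (\<forall>j<L. ip S (g j) x = 0) \<longrightarrow> 0 \<le> Re (\<zeta> * ip S x (mv S M x))))"

text \<open>By \<open>Toeplitz_Hausdorff\<close> the values at unit vectors of \<open>U\<close> form
  a convex set. As it misses 0, a line through 0 bounds it on one side, and homogeneity extends this
  to all of \<open>U\<close>.\<close>

lemma supporting_direction:
  fixes M :: "'i \<Rightarrow> 'i \<Rightarrow> complex"
  assumes fin: "finite S"
    and U: "\<And>x y \<alpha> \<beta>. x \<in> U \<Longrightarrow> y \<in> U \<Longrightarrow> (\<lambda>i. \<alpha> * x i + \<beta> * y i) \<in> U"
    and no: "\<And>v. v \<in> U \<Longrightarrow> nrm S v = 1 \<Longrightarrow> ip S v (mv S M v) \<noteq> 0"
  shows "\<exists>\<zeta>. cmod \<zeta> = 1 \<and> (\<forall>x\<in>U. 0 \<le> Re (\<zeta> * ip S x (mv S M x)))"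
proof -
  let ?W = "{ip S x (mv S M x) | x. x \<in> U \<and> nrm S x = 1}"
  have "convex ?W" by (rule Toeplitz_Hausdorff[OF fin U])
  moreover have "0 \<notin> ?W"
  proof
    assume "0 \<in> ?W"
    then obtain v where "v \<in> U" "nrm S v = 1" "0 = ip S v (mv S M v)" by blast
    then show False using no by metis
  qed
  ultimately obtain a where a: "a \<noteq> 0" "\<And>z. z \<in> ?W \<Longrightarrow> 0 \<le> inner a z"
    using separating_hyperplane_set_0[of ?W] by blast
  define \<zeta> where "\<zeta> = cnj a / of_real (cmod a)"
  have "cmod \<zeta> = 1" using a by (simp add: \<zeta>_def norm_divide)
  moreover have "0 \<le> Re (\<zeta> * ip S x (mv S M x))" if x: "x \<in> U" for x
  proof (cases "nrm S x = 0")
    case True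
    then have "ip S x (mv S M x) = 0" using fin by (simp add: nrm_eq_0_iff ip_def)
    then show ?thesis by simp
  next
    case False
    obtain c where c: "c \<noteq> 0" "nrm S (\<lambda>i. c * x i) = 1" using normalizing_factor[OF False] by blast
    have "(\<lambda>i. c * x i) \<in> U" using U[OF x x, of c 0] by simp
    then have "ip S (\<lambda>i. c * x i) (mv S M (\<lambda>i. c * x i)) \<in> ?W" using c by blast
    then have "0 \<le> inner a (cnj c * c * ip S x (mv S M x))"
      using a(2) unfolding mv_smult ip_smult_left ip_smult_right by (simp add: mult.assoc)
    moreover have "cnj c * c = of_real ((cmod c)\<^sup>2)" using complex_norm_square[of c] by (simp add: mult.commute)
    ultimately have "0 \<le> (cmod c)\<^sup>2 * inner a (ip S x (mv S M x))"
      by (simp only:) (simp add: inner_complex_def algebra_simps)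
    then have "0 \<le> inner a (ip S x (mv S M x))" using c by (simp add: zero_le_mult_iff)
    moreover have "Re (\<zeta> * z) = inner a z / cmod a" for z
      by (simp add: \<zeta>_def inner_complex_def diff_divide_distrib add_divide_distrib)
    ultimately show ?thesis by simp
  qed
  ultimately show ?thesis by blast
qed

lemma thin_fmx:
  assumes "thin S M L"
  shows "thin T (fmx S M w) L"
proof -
  obtain g \<zeta> where g: "cmod \<zeta> = 1" "\<forall>x. (\<forall>j<L. ip S (g j) x = 0) \<longrightarrow> 0 \<le> Re (\<zeta> * ip S x (mv S M x))"
    using assms unfolding thin_def by blast
  have form: "ip T x (mv T (fmx S M w) x) = ip S (lin T w x) (mv S M (lin T w x))" for x
    using fun_cong[OF fun_cong[OF fmx_lin[of S M T w "\<lambda>_ :: unit. x"]], of "()" "()"]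
    by (simp add: fmx_def[of S] fmx_def[of T])
  have lf: "ip T (\<lambda>p. ip S (w p) (g j)) x = ip S (g j) (lin T w x)" for j x
    by (simp add: ip_lin_right) (simp add: ip_def[of T] mult.commute flip: cj_cnj)
  show ?thesis unfolding thin_def
    by (rule exI[of _ "\<lambda>j p. ip S (w p) (g j)"], rule exI[of _ \<zeta>]) (use g in \<open>auto simp: lf form\<close>)
qed

lemma thin_mono: "thin S M L \<Longrightarrow> L \<le> L' \<Longrightarrow> thin S M L'"
  unfolding thin_def by (meson order_less_le_trans)

text \<open>A vector with vanishing form, orthogonal to the previous ones and to their images under \<open>M\<close>
  and its adjoint, is searched greedily; each step costs three linear conditions.\<close>

lemma zero_block_or_thin:
  fixes M :: "'i \<Rightarrow> 'i \<Rightarrow> complex"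
  assumes fin: "finite S"
  shows "(\<exists>f. onf S {..<N} f \<and> (\<forall>p<N. \<forall>q<N. fmx S M f p q = 0)) \<or> thin S M (3 * N)"
proof (induction N)
  case 0
  then show ?case by (auto simp: onf_def)
next
  case (Suc N)
  show ?case
  proof (cases "thin S M (3 * N)")
    case True
    then show ?thesis using thin_mono by fastforce
  next
    case False
    then obtain f where f: "onf S {..<N} f" "\<forall>p<N. \<forall>q<N. fmx S M f p q = 0" using Suc by blast
    define g where "g j = (if j < N then f j else if j < 2 * N then mv S (adj M) (f (j - N)) else mv S M (f (j - 2 * N)))" for j
    define U where "U = {x. \<forall>j<3 * N. ip S (g j) x = 0}"
    have "\<exists>v\<in>U. nrm S v = 1 \<and> ip S v (mv S M v) = 0"
    proof (rule ccontr)
      assume "\<not> ?thesis"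
      then have "\<exists>\<zeta>. cmod \<zeta> = 1 \<and> (\<forall>x\<in>U. 0 \<le> Re (\<zeta> * ip S x (mv S M x)))"
        by (intro supporting_direction[OF fin]) (auto simp: U_def ip_add_right ip_smult_right)
      then have "thin S M (3 * N)" unfolding thin_def U_def by blast
      then show False using False by simp
    qed
    then obtain v where v: "v \<in> U" "nrm S v = 1" "ip S v (mv S M v) = 0" by blast
    have vU: "ip S (g j) v = 0" if "j < 3 * N" for j using v(1) that by (simp add: U_def)
    have fv: "ip S (f p) v = 0" "fmx S M (f(N := v)) p N = 0" "ip S v (f p) = 0" "fmx S M (f(N := v)) N p = 0" if p: "p < N" for p
    proof -
      show 1: "ip S (f p) v = 0" using vU[of p] p by (simp add: g_def)
      then show "ip S v (f p) = 0" by (metis cj_ip cj_0)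
      have "ip S (f p) (mv S M v) = 0" unfolding ip_adj using vU[of "p + N"] p by (simp add: g_def)
      then show "fmx S M (f(N := v)) p N = 0" using p by (simp add: fmx_def)
      have "ip S (mv S M (f p)) v = 0" using vU[of "p + 2 * N"] p by (simp add: g_def)
      then have "ip S v (mv S M (f p)) = 0" by (metis cj_ip cj_0)
      then show "fmx S M (f(N := v)) N p = 0" using p by (simp add: fmx_def)
    qed
    have "onf S {..<Suc N} (f(N := v))"
      using f(1) fv v(2) by (auto simp: onf_def less_Suc_eq ip_self_1)
    moreover have "fmx S M (f(N := v)) p q = 0" if "p < Suc N" "q < Suc N" for p q
    proof -
      consider "p < N" "q < N" | "p = N" "q < N" | "p < N" "q = N" | "p = N" "q = N"
        using \<open>p < Suc N\<close> \<open>q < Suc N\<close> by linarith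
      then show ?thesis
      proof cases
        case 1
        then show ?thesis using f(2) fmx_cong[of "f(N := v)" p f q S M] by simp
      qed (use fv v(3) in \<open>auto simp: fmx_def\<close>)
    qed
    ultimately show ?thesis by blast
  qed
qed

subsection \<open>Pavings\<close>

text \<open>In \<open>u (c, j)\<close> the second index names the block and the first runs inside
  it. The blocks have equal size, so \<open>k\<close> must divide the dimension. Nothing is asked of
  the off-diagonal blocks, which Sylvester equations absorb.\<close>

definition paved :: "nat \<Rightarrow> real \<Rightarrow> 'i set \<Rightarrow> ('i \<Rightarrow> 'i \<Rightarrow> complex) \<Rightarrow> bool" where
  "paved k g S M \<longleftrightarrow> (\<exists>m u. card S = m * k \<and> onf S ({..<m} \<times> {..<k}) u \<and>
     (\<forall>j<k. tr {..<m} (\<lambda>c d. fmx S M u (c, j) (d, j)) = 0 \<and>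
        bnd {..<m} {..<m} (\<lambda>c d. fmx S M u (c, j) (d, j)) g))"

lemma paved_transfer:
  assumes v: "onf S T v" and "finite T" "card T = card S" and p: "paved k g T (fmx S M v)"
  shows "paved k g S M"
proof -
  obtain m u where u: "card T = m * k" "onf T ({..<m} \<times> {..<k}) u"
    "\<forall>j<k. tr {..<m} (\<lambda>c d. fmx T (fmx S M v) u (c, j) (d, j)) = 0 \<and>
        bnd {..<m} {..<m} (\<lambda>c d. fmx T (fmx S M v) u (c, j) (d, j)) g"
    using p unfolding paved_def by blast
  show ?thesis unfolding paved_def
    by (rule exI[of _ m], rule exI[of _ "\<lambda>r. lin T v (u r)"])
      (use u onf_lin[OF v _ u(2)] assms in \<open>simp add: fmx_lin\<close>)
qed

lemma grid_separated:
  fixes s j j' :: nat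
  assumes "j < s * s" "j' < s * s" "j \<noteq> j'"
  shows "1 / (2 * real s) \<le> cmod (Complex (real (j mod s)) (real (j div s)) / of_real (2 * real s) -
     Complex (real (j' mod s)) (real (j' div s)) / of_real (2 * real s))"
proof -
  have s: "s > 0" using assms by (cases s) auto
  define w where "w = Complex (real (j mod s) - real (j' mod s)) (real (j div s) - real (j' div s))"
  have "1 \<le> cmod w"
  proof (cases "j mod s = j' mod s")
    case True
    then have "j div s \<noteq> j' div s" using assms(3) by (metis div_mult_mod_eq)
    then have "1 \<le> \<bar>Im w\<bar>" by (auto simp: w_def)
    then show ?thesis using abs_Im_le_cmod order_trans by blast
  next
    case False
    then have "1 \<le> \<bar>Re w\<bar>" by (auto simp: w_def)
    then show ?thesis using abs_Re_le_cmod order_trans by blast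
  qed
  moreover have "Complex (real (j mod s)) (real (j div s)) / of_real (2 * real s) -
     Complex (real (j' mod s)) (real (j' div s)) / of_real (2 * real s) = w / of_real (2 * real s)"
    by (simp add: w_def complex_eq_iff diff_divide_distrib)
  ultimately show ?thesis using s by (simp add: norm_divide divide_right_mono)
qed

lemma cm_scaled:
  fixes N :: "'i \<Rightarrow> 'i \<Rightarrow> complex"
  assumes IH: "\<And>N :: 'i \<Rightarrow> 'i \<Rightarrow> complex. bnd T T N 1 \<Longrightarrow> tr T N = 0 \<Longrightarrow> cm T N 1 K"
    and N: "bnd T T N g" "tr T N = 0" "0 < g" "0 < \<beta>"
  shows "cm T N \<beta> (K * g / \<beta>)"
proof -
  have "cm T (\<lambda>i j. of_real (1 / g) * N i j) 1 K"
  proof (rule IH)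
    show "bnd T T (\<lambda>i j. of_real (1 / g) * N i j) 1"
      using bnd_smult[OF N(1), of "of_real (1 / g)"] N by (simp add: norm_divide)
    show "tr T (\<lambda>i j. of_real (1 / g) * N i j) = 0"
      using N(2) by (simp add: tr_def flip: sum_divide_distrib)
  qed
  from cm_smult[OF this, of "of_real g"] have "cm T N 1 (g * K)" using N by simp
  from cm_rescale[OF this N(4)] show ?thesis by (simp add: mult.commute)
qed

text \<open>The small blocks of a paving are placed at the points of a square grid in the unit disc: there is
  room for \<open>s\<^sup>2\<close> discs of radius of order \<open>1/s\<close>, while the blocks have norm of order \<open>1/s\<^sup>2\<close>.\<close>

lemma cm_paved:
  fixes M :: "'i \<Rightarrow> 'i \<Rightarrow> complex"
  assumes fin: "finite S" and M: "bnd S S M 1" and s: "2 \<le> s" and ne: "S \<noteq> {}" and g: "0 < g" "0 \<le> K"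
    and IH: "\<And>m (N :: nat \<Rightarrow> nat \<Rightarrow> complex). m < card S \<Longrightarrow> bnd {..<m} {..<m} N 1 \<Longrightarrow> tr {..<m} N = 0 \<Longrightarrow> cm {..<m} N 1 K"
    and p: "paved (s * s) g S M"
  shows "cm S M 1 (8 * real s * g * K + 4 * real s ^ 5)"
proof -
  obtain m u where u: "card S = m * (s * s)" "onf S ({..<m} \<times> {..<s * s}) u"
    "\<And>j. j < s * s \<Longrightarrow> tr {..<m} (\<lambda>c d. fmx S M u (c, j) (d, j)) = 0"
    "\<And>j. j < s * s \<Longrightarrow> bnd {..<m} {..<m} (\<lambda>c d. fmx S M u (c, j) (d, j)) g"
    using p unfolding paved_def by blast
  let ?T = "{..<m} \<times> {..<s * s}"
  let ?F = "fmx S M u"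
  have F: "bnd ?T ?T ?F 1" by (rule bnd_fmx[OF u(2) _ M]) simp
  have m: "m < card S"
  proof -
    have "0 < card S" using ne fin by (simp add: card_gt_0_iff)
    then have "0 < m" using u(1) by (cases m) auto
    moreover have "1 < s * s" using s by (metis less_1_mult one_less_numeral_iff order_less_le_trans semiring_norm(76))
    ultimately show ?thesis unfolding u(1) by simp
  qed
  have s0: "0 < real s" using s by simp
  define z where "z j = Complex (real (j mod s)) (real (j div s)) / of_real (2 * real s)" for j
  \<comment> \<open>The grid spacing 1/(2 s) and the radii 1/(8 s) leave the gap 1/(4 s). The
    diagonal blocks cost K g divided by the radius, the off-diagonal ones the squared number s^4 of
    pairs of labels times 4 s.\<close>
  have "cm ?T ?F 1 (8 * real s * g * K + (real (card {..<s * s}))\<^sup>2 * (1 / (1 / (4 * real s))))"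
  proof (rule cm_blocks[OF _ _ _ F, where \<pi> = snd and \<beta> = "\<lambda>_. 1 / (8 * real s)" and z = z])
    fix j assume j: "j \<in> {..<s * s}"
    have "cm {..<m} (\<lambda>c d. ?F (c, j) (d, j)) (1 / (8 * real s)) (K * g / (1 / (8 * real s)))"
      by (rule cm_scaled) (use IH[OF m] u(3,4) j g s0 in auto)
    then have "cm {..<m} (\<lambda>c d. ?F (c, j) (d, j)) (1 / (8 * real s)) (8 * real s * g * K)"
      by (simp add: mult_ac)
    moreover have "bij_betw (\<lambda>c. (c, j)) {..<m} {p \<in> ?T. snd p = j}"
      using j by (auto simp: bij_betw_def inj_on_def)
    ultimately show "cm {p \<in> ?T. snd p = j} ?F (1 / (8 * real s)) (8 * real s * g * K)"
      by (intro cm_reindex[of "\<lambda>c. (c, j)" "{..<m}"]) auto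
    have "j mod s < s" using s by simp
    moreover have "j div s < s" using j by (simp add: less_mult_imp_div_less)
    ultimately have "real (j mod s) \<le> real s - 1" "real (j div s) \<le> real s - 1"
      using s by linarith+
    moreover have "cmod (Complex (real (j mod s)) (real (j div s))) \<le> real (j mod s) + real (j div s)"
      using cmod_le[of "Complex (real (j mod s)) (real (j div s))"] by simp
    ultimately have "cmod (z j) \<le> (2 * (real s - 1)) / (2 * real s)"
      using s0 by (simp add: z_def norm_divide divide_right_mono)
    then show "cmod (z j) + 1 / (8 * real s) \<le> 1" using s0 by (simp add: field_simps)
  next
    fix i j assume ij: "i \<in> {..<s * s}" "j \<in> {..<s * s}" "i \<noteq> j"
    have "1 / (8 * real s) + 1 / (8 * real s) + 1 / (4 * real s) = 1 / (2 * real s)" using s0 by (simp add: field_simps)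
    then show "1 / (8 * real s) + 1 / (8 * real s) + 1 / (4 * real s) \<le> cmod (z i - z j)"
      using grid_separated[of i s j] ij by (simp add: z_def)
  qed (use s0 g in auto)
  moreover have "(real (card {..<s * s}))\<^sup>2 * (1 / (1 / (4 * real s))) = 4 * real s ^ 5"
    by (simp add: power2_eq_square eval_nat_numeral)
  ultimately have "cm ?T ?F 1 (8 * real s * g * K + 4 * real s ^ 5)" by (simp only:)
  then show ?thesis by (intro cm_transfer[OF u(2) fin]) (use u in auto)
qed

text \<open>\<open>M\<close> is a block on \<open>E\<close>, plus a diagonal skew part \<open>\<kappa>\<close> off \<open>E\<close>, plus this remainder.\<close>

definition remainder :: "'i set \<Rightarrow> ('i \<Rightarrow> real) \<Rightarrow> ('i \<Rightarrow> 'i \<Rightarrow> complex) \<Rightarrow> 'i \<Rightarrow> 'i \<Rightarrow> complex" where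
  "remainder E \<kappa> M = (\<lambda>i j. M i j - (if i \<in> E \<and> j \<in> E then M i j else if i = j then \<i> * of_real (\<kappa> i) else 0))"

lemma bnd_extend:
  fixes M :: "'i \<Rightarrow> 'i \<Rightarrow> 'a::star_field"
  assumes "bnd S' S' M c" "finite S" "S' \<subseteq> S" "0 \<le> c"
  shows "bnd S S (\<lambda>i j. if i \<in> S' \<and> j \<in> S' then M i j else 0) c"
  unfolding bnd_def
proof
  fix x :: "'i \<Rightarrow> 'a"
  let ?N = "\<lambda>i j. if i \<in> S' \<and> j \<in> S' then M i j else 0"
  have mv: "mv S ?N x i = (if i \<in> S' then mv S' M x i else 0)" for i
    unfolding mv_def using assms by (auto intro: sum.mono_neutral_cong_right)
  have "nrm S (mv S ?N x) = nrm S' (mv S ?N x)"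
    by (rule nrm_zero_outside) (use assms in \<open>auto simp: mv\<close>)
  also have "\<dots> = nrm S' (mv S' M x)" by (rule nrm_cong) (simp add: mv)
  also have "\<dots> \<le> c * nrm S' x" by (rule bndD[OF assms(1)])
  also have "\<dots> \<le> c * nrm S x" using assms by (intro mult_left_mono nrm_mono_set) auto
  finally show "nrm S (mv S ?N x) \<le> c * nrm S x" .
qed

text \<open>The vectors of the \<open>j\<close>-th block are the \<open>j\<close>-th basis vectors of all groups. In a group that meets
  \<open>E\<close> a flat basis spreads the \<open>E\<close>-part evenly over the \<open>k\<close> blocks, and the vanishing off-diagonal
  entries make all diagonal entries equal. In the other groups flatness is not needed, and a basis
  with constant diagonal is available. So all blocks get the same trace.\<close>

lemma paved_groups:
  fixes M :: "nat \<times> nat \<Rightarrow> nat \<times> nat \<Rightarrow> complex"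
  assumes k: "0 < k" and d: "d \<le> m"
    and I: "I = {..<m} \<times> {..<k}" and E: "E = {..<d} \<times> {0}"
    and M: "bnd I I M 1" and R: "bnd I I (remainder E \<kappa> M) \<rho>" and tr0: "tr I M = 0"
    and diag: "\<And>c l l'. c < d \<Longrightarrow> l < k \<Longrightarrow> l' < k \<Longrightarrow> l \<noteq> l' \<Longrightarrow> M (c, l) (c, l') = 0"
    and \<sigma>: "\<And>c. c < m \<Longrightarrow> \<bar>\<Sum>l<k. \<kappa> (c, l)\<bar> \<le> \<sigma>" and \<kappa>E: "\<And>c. c < d \<Longrightarrow> \<kappa> (c, 0) = 0"
    and nn: "0 \<le> \<rho>" "0 \<le> \<sigma>"
  shows "paved k ((1 + \<sigma>) / real k + 3 * \<rho>) I M"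
proof -
  obtain \<Gamma>0 where \<Gamma>0: "onf {..<k} {..<k} \<Gamma>0" "\<And>j l. cmod (\<Gamma>0 j l) = 1 / sqrt (real k)"
    using Fourier_basis[OF k] by blast
  define D where "D c = (\<lambda>l l'. M (c, l) (c, l'))" for c
  have "\<forall>c. \<exists>\<Gamma>. onf {..<k} {..<k} \<Gamma> \<and> (\<forall>p<k. fmx {..<k} (D c) \<Gamma> p p = tr {..<k} (D c) / of_nat k)"
    using constant_diagonal_nat by blast
  from choice[OF this] obtain \<Gamma>1 where \<Gamma>1: "\<And>c. onf {..<k} {..<k} (\<Gamma>1 c)"
    "\<And>c p. p < k \<Longrightarrow> fmx {..<k} (D c) (\<Gamma>1 c) p p = tr {..<k} (D c) / of_nat k" by blast
  define \<Gamma> where "\<Gamma> c = (if c < d then \<Gamma>0 else \<Gamma>1 c)" for c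
  have \<Gamma>: "onf {..<k} {..<k} (\<Gamma> c)" for c using \<Gamma>0 \<Gamma>1 by (simp add: \<Gamma>_def)
  define u where "u = (\<lambda>(c, j) (c', l). if c' = c then \<Gamma> c j l else 0)"
  have sumI: "(\<Sum>i\<in>I. f i) = (\<Sum>c<m. \<Sum>l<k. f (c, l))" for f :: "nat \<times> nat \<Rightarrow> complex"
    unfolding I by (simp add: sum.cartesian_product)
  have restrict: "(\<Sum>i\<in>I. (case i of (c', l) \<Rightarrow> if c' = c then f l else 0)) = (\<Sum>l<k. f l)" if "c < m" for c and f :: "nat \<Rightarrow> complex"
  proof -
    have "(\<Sum>c'<m. \<Sum>l<k. if c' = c then f l else 0) = (\<Sum>c'<m. if c' = c then \<Sum>l<k. f l else 0)"
      by (rule sum.cong) auto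
    then show ?thesis using that by (simp add: sumI)
  qed
  have ipu: "ip I (u (c, j)) x = (\<Sum>l<k. cnj (\<Gamma> c j l) * x (c, l))" if "c < m" for c j x
    unfolding ip_def restrict[OF that, symmetric] by (rule sum.cong) (auto simp: u_def)
  have mvu: "mv I N (u (c, j)) i = (\<Sum>l<k. N i (c, l) * \<Gamma> c j l)" if "c < m" for c j i and N :: "nat \<times> nat \<Rightarrow> nat \<times> nat \<Rightarrow> complex"
    unfolding mv_def restrict[OF that, symmetric] by (rule sum.cong) (auto simp: u_def)
  have entry: "fmx I N u (c, j) (c', j') = (\<Sum>l<k. \<Sum>l'<k. cnj (\<Gamma> c j l) * N (c, l) (c', l') * \<Gamma> c' j' l')"
    if "c < m" "c' < m" for c c' j j' and N :: "nat \<times> nat \<Rightarrow> nat \<times> nat \<Rightarrow> complex"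
    using that by (simp add: fmx_def ipu mvu sum_distrib_left mult.assoc)
  have onu: "onf I I u"
    unfolding onf_def
  proof (intro ballI)
    fix p q assume "p \<in> I" "q \<in> I"
    then obtain c j c' j' where pq: "p = (c, j)" "q = (c', j')" "c < m" "c' < m" "j < k" "j' < k" by (auto simp: I)
    have "ip I (u p) (u q) = (if c = c' then ip {..<k} (\<Gamma> c j) (\<Gamma> c j') else 0)"
      using pq by (simp add: ipu) (simp add: u_def ip_def)
    then show "ip I (u p) (u q) = (if p = q then 1 else 0)" using pq onfD[OF \<Gamma>, of j j' c] by auto
  qed
  define \<tau> where "\<tau> c = tr {..<k} (D c)" for c
  have gg: "cnj (\<Gamma> c j l) * \<Gamma> c j l = of_real ((cmod (\<Gamma> c j l))\<^sup>2)" for c j l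
    using complex_norm_square[of "\<Gamma> c j l"] by (simp add: mult.commute)
  have flat: "cnj (\<Gamma> c j l) * \<Gamma> c j l = 1 / of_nat k" if "c < d" for c j l
    unfolding gg using that k by (simp add: \<Gamma>_def \<Gamma>0 power_divide)
  have diag\<tau>: "fmx I M u (c, j) (c, j) = \<tau> c / of_nat k" if c: "c < m" and j: "j < k" for c j
  proof (cases "c < d")
    case True
    have "fmx I M u (c, j) (c, j) = (\<Sum>l<k. \<Sum>l'<k. if l = l' then M (c, l) (c, l) / of_nat k else 0)"
      unfolding entry[OF c c]
    proof (intro sum.cong refl)
      fix l l' assume "l \<in> {..<k}" "l' \<in> {..<k}"
      then show "cnj (\<Gamma> c j l) * M (c, l) (c, l') * \<Gamma> c j l' = (if l = l' then M (c, l) (c, l) / of_nat k else 0)"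
      proof (cases "l = l'")
        case True
        have "cnj (\<Gamma> c j l) * M (c, l) (c, l) * \<Gamma> c j l = (cnj (\<Gamma> c j l) * \<Gamma> c j l) * M (c, l) (c, l)"
          by (simp only: mult_ac)
        also have "\<dots> = M (c, l) (c, l) / of_nat k" unfolding flat[OF \<open>c < d\<close>] by simp
        finally show ?thesis using True by simp
      qed (use diag[OF True, of l l'] \<open>l \<in> {..<k}\<close> \<open>l' \<in> {..<k}\<close> in auto)
    qed
    then show ?thesis by (simp add: \<tau>_def tr_def D_def sum_divide_distrib)
  next
    case False
    have "fmx I M u (c, j) (c, j) = fmx {..<k} (D c) (\<Gamma>1 c) j j"
      unfolding entry[OF c c] using False by (simp add: fmx_def ip_def mv_def D_def \<Gamma>_def sum_distrib_left mult.assoc)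
    then show ?thesis using \<Gamma>1(2)[OF j] by (simp add: \<tau>_def)
  qed
  have "(\<Sum>c<m. \<tau> c) = 0" using tr0 by (simp add: tr_def sumI \<tau>_def D_def)
  then have trace: "tr {..<m} (\<lambda>c c'. fmx I M u (c, j) (c', j)) = 0" if "j < k" for j
    using diag\<tau> that by (simp add: tr_def flip: sum_divide_distrib)
  have bound: "bnd {..<m} {..<m} (\<lambda>c c'. fmx I M u (c, j) (c', j)) ((1 + \<sigma>) / real k + 3 * \<rho>)" if j: "j < k" for j
  proof -
    have onj: "onf I {..<m} (\<lambda>c. u (c, j))"
      using onu j by (auto simp: onf_def I)
    have R': "bnd {..<m} {..<m} (\<lambda>c c'. fmx I (remainder E \<kappa> M) u (c, j) (c', j)) \<rho>"
      using bnd_fmx[OF onj _ R] by (simp add: fmx_def)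
    \<comment> \<open>In a group only the coordinate l = 0 can lie in \<open>E\<close>. All groups
      that meet \<open>E\<close> share one flat basis, so entries between two such groups also get
      the weight 1/k. The diagonal skew part turns into the weighted group averages
      \<open>\<theta>\<close>.\<close>
    define X where "X = (\<lambda>c c'. if c \<in> {..<d} \<and> c' \<in> {..<d} then M (c, 0) (c', 0) else 0)"
    define \<theta> where "\<theta> c = (\<Sum>l<k. \<i> * of_real (\<kappa> (c, l)) * of_real ((cmod (\<Gamma> c j l))\<^sup>2))" for c
    have dec: "fmx I M u (c, j) (c', j) = 1 / of_nat k * X c c' + (if c = c' then \<theta> c else 0) +
       fmx I (remainder E \<kappa> M) u (c, j) (c', j)" if c: "c < m" "c' < m" for c c'
    proof -
      have Eiff: "(c, l) \<in> E \<longleftrightarrow> c < d \<and> l = 0" for c l by (auto simp: E)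
      have t: "cnj (\<Gamma> c j l) * M (c, l) (c', l') * \<Gamma> c' j l' =
          (if l = 0 then if l' = 0 then 1 / of_nat k * X c c' else 0 else 0) +
          (if l = l' then if c = c' then \<i> * of_real (\<kappa> (c, l)) * of_real ((cmod (\<Gamma> c j l))\<^sup>2) else 0 else 0) +
          cnj (\<Gamma> c j l) * remainder E \<kappa> M (c, l) (c', l') * \<Gamma> c' j l'" for l l'
      proof -
        have f0: "cnj (\<Gamma> c j 0) * \<Gamma> c' j 0 = 1 / of_nat k" if "c < d" "c' < d"
          using flat[OF that(1), of j 0] that by (simp add: \<Gamma>_def)
        consider "c < d" "c' < d" "l = 0" "l' = 0" | "\<not> (c < d \<and> c' < d \<and> l = 0 \<and> l' = 0)" by blast
        then show ?thesis
        proof cases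
          case 1
          then have "X c c' = M (c, 0) (c', 0)" by (simp add: X_def)
          moreover have "cnj (\<Gamma> c j 0) * M (c, 0) (c', 0) * \<Gamma> c' j 0 = 1 / of_nat k * M (c, 0) (c', 0)"
            using f0 1 by (metis mult.assoc mult.commute)
          ultimately show ?thesis using 1 \<kappa>E by (simp add: remainder_def Eiff)
        next
          case 2
          then have "(if l = 0 then if l' = 0 then 1 / of_nat k * X c c' else 0 else 0) = 0" by (auto simp: X_def)
          moreover have "remainder E \<kappa> M (c, l) (c', l') = M (c, l) (c', l') - (if c = c' \<and> l = l' then \<i> * of_real (\<kappa> (c, l)) else 0)"
            using 2 by (auto simp: remainder_def Eiff)
          ultimately show ?thesis
          proof (cases "c = c' \<and> l = l'")
            case True
            have key: "cnj (\<Gamma> c j l) * w * \<Gamma> c j l = w * of_real ((cmod (\<Gamma> c j l))\<^sup>2)" for w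
            proof -
              have "cnj (\<Gamma> c j l) * w * \<Gamma> c j l = w * (cnj (\<Gamma> c j l) * \<Gamma> c j l)" by (simp only: mult_ac)
              then show ?thesis unfolding gg .
            qed
            have "M (c, l) (c, l) = \<i> * of_real (\<kappa> (c, l)) + remainder E \<kappa> M (c, l) (c, l)"
              using \<open>remainder E \<kappa> M (c, l) (c', l') = _\<close> True by simp
            then have "cnj (\<Gamma> c j l) * M (c, l) (c, l) * \<Gamma> c j l =
                \<i> * of_real (\<kappa> (c, l)) * of_real ((cmod (\<Gamma> c j l))\<^sup>2) +
                cnj (\<Gamma> c j l) * remainder E \<kappa> M (c, l) (c, l) * \<Gamma> c j l"
              unfolding key by (simp only: distrib_right)
            then show ?thesis
              using True \<open>(if l = 0 then _ else 0) = 0\<close> by (simp only:) simp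
          qed auto
        qed
      qed
      have s0: "(\<Sum>l<k. \<Sum>l'<k. if l = 0 then if l' = 0 then a else 0 else 0) = a" for a :: complex
      proof -
        have "(\<Sum>l<k. \<Sum>l'<k. if l = 0 then if l' = 0 then a else 0 else 0) = (\<Sum>l<k. if l = 0 then a else 0)"
          by (rule sum.cong) (use k in auto)
        then show ?thesis using k by simp
      qed
      show ?thesis
        unfolding entry[OF c] t sum.distrib s0 by (simp add: \<theta>_def)
    qed
    have X: "bnd {..<m} {..<m} X 1"
    proof -
      have "bnd ({..<d} \<times> {0}) ({..<d} \<times> {0}) M 1"
        by (rule bnd_subset[OF M]) (use d k in \<open>auto simp: I\<close>)
      from bnd_reindex[OF _ _ this, of "\<lambda>c. (c, 0)" "{..<d}"]
      have "bnd {..<d} {..<d} (\<lambda>c c'. M (c, 0) (c', 0)) 1" by (auto simp: bij_betw_def inj_on_def)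
      then show ?thesis unfolding X_def by (rule bnd_extend) (use d in auto)
    qed
    \<comment> \<open>In a flat group the weights are 1/k and \<open>\<theta> c\<close> is a plain
      average. In the others the weights are unknown, but the diagonal entry is the average of the
      whole group; comparing it with the remainder costs \<rho> twice.\<close>
    have \<theta>: "cmod (\<theta> c) \<le> \<sigma> / real k + 2 * \<rho>" if c: "c < m" for c
    proof (cases "c < d")
      case True
      have "\<theta> c = (\<Sum>l<k. \<i> * of_real (\<kappa> (c, l))) * (1 / of_nat k)"
        unfolding \<theta>_def sum_distrib_right using flat[OF True, of j] gg by (intro sum.cong) auto
      also have "\<dots> = \<i> * of_real (\<Sum>l<k. \<kappa> (c, l)) / of_nat k" by (simp add: sum_distrib_left)
      finally have "cmod (\<theta> c) = \<bar>\<Sum>l<k. \<kappa> (c, l)\<bar> / real k"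
        by (simp only: norm_divide norm_mult norm_ii norm_of_real norm_of_nat mult_1_left)
      also have "\<dots> \<le> \<sigma> / real k" using \<sigma>[OF c] by (intro divide_right_mono) auto
      finally show ?thesis using nn by simp
    next
      case False
      have Rd: "cmod (remainder E \<kappa> M (c, l) (c, l)) \<le> \<rho>" if "l < k" for l
        by (rule bnd_entry[OF R]) (use that c in \<open>auto simp: I\<close>)
      have "\<tau> c = (\<Sum>l<k. \<i> * of_real (\<kappa> (c, l)) + remainder E \<kappa> M (c, l) (c, l))"
        unfolding \<tau>_def tr_def D_def using False by (intro sum.cong) (auto simp: remainder_def E)
      also have "\<dots> = \<i> * of_real (\<Sum>l<k. \<kappa> (c, l)) + (\<Sum>l<k. remainder E \<kappa> M (c, l) (c, l))"
        by (simp add: sum.distrib sum_distrib_left)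
      also have "cmod \<dots> \<le> \<bar>\<Sum>l<k. \<kappa> (c, l)\<bar> + (\<Sum>l<k. \<rho>)"
      proof (rule order_trans[OF norm_triangle_ineq], intro add_mono sum_norm_le)
        show "cmod (\<i> * of_real (\<Sum>l<k. \<kappa> (c, l))) \<le> \<bar>\<Sum>l<k. \<kappa> (c, l)\<bar>"
          by (simp only: norm_mult norm_ii norm_of_real mult_1_left order_refl)
      qed (use Rd in simp)
      also have "\<dots> \<le> \<sigma> + real k * \<rho>" using \<sigma>[OF c] by simp
      finally have "cmod (\<tau> c / of_nat k) \<le> (\<sigma> + real k * \<rho>) / real k"
        by (simp add: norm_divide divide_right_mono)
      also have "\<dots> = \<sigma> / real k + \<rho>" using k by (simp add: add_divide_distrib)
      finally have 1: "cmod (fmx I M u (c, j) (c, j)) \<le> \<sigma> / real k + \<rho>" using diag\<tau>[OF c j] by simp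
      have 2: "cmod (fmx I (remainder E \<kappa> M) u (c, j) (c, j)) \<le> \<rho>"
        by (rule bnd_entry[OF R']) (use c in auto)
      have "\<theta> c = fmx I M u (c, j) (c, j) - fmx I (remainder E \<kappa> M) u (c, j) (c, j)"
        using dec[OF c c] False by (simp add: X_def)
      then show ?thesis using norm_triangle_ineq4[of "fmx I M u (c, j) (c, j)" "fmx I (remainder E \<kappa> M) u (c, j) (c, j)"] 1 2
        by simp
    qed
    have "bnd {..<m} {..<m} (\<lambda>c c'. 1 / of_nat k * X c c' + (if c = c' then \<theta> c else 0) +
       fmx I (remainder E \<kappa> M) u (c, j) (c', j)) (norm (1 / of_nat k :: complex) * 1 + (\<sigma> / real k + 2 * \<rho>) + \<rho>)"
      by (intro bnd_add bnd_smult X bnd_diag R') (use \<theta> nn in auto)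
    then have "bnd {..<m} {..<m} (\<lambda>c c'. fmx I M u (c, j) (c', j)) (norm (1 / of_nat k :: complex) * 1 + (\<sigma> / real k + 2 * \<rho>) + \<rho>)"
      by (subst bnd_cong) (use dec in auto)
    then show ?thesis by (rule bnd_mono) (simp add: norm_divide add_divide_distrib)
  qed
  show ?thesis unfolding paved_def
    by (rule exI[of _ m], rule exI[of _ u]) (use trace bound onu I in auto)
qed

subsection \<open>Thin forms\<close>

lemma onf_perp_expand:
  fixes w :: "'k \<Rightarrow> 'i \<Rightarrow> 'a::star_field" and e :: "'l \<Rightarrow> 'i \<Rightarrow> 'a"
  assumes "onf S (W <+> D) (case_sum w e)" "finite S" "finite W" "finite D" "card W + card D = card S"
    and x: "\<forall>i\<in>D. ip S (e i) x = 0" and i: "i \<in> S"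
  shows "x i = lin W w (\<lambda>k. ip S (w k) x) i"
proof -
  have "x i = (\<Sum>p\<in>W <+> D. ip S (case_sum w e p) x * case_sum w e p i)"
    by (rule onf_expand) (use assms in \<open>auto simp: card_Plus\<close>)
  then show ?thesis using assms by (simp add: sum.Plus lin_def)
qed

lemma Re_form_le: "bnd S S M 1 \<Longrightarrow> \<bar>Re (ip S x (mv S M x))\<bar> \<le> (nrm S x)\<^sup>2" for M :: "'i \<Rightarrow> 'i \<Rightarrow> complex"
  using bnd_form[of S S M 1 x x] abs_Re_le_cmod[of "ip S x (mv S M x)"]
  by (simp add: power2_eq_square)

text \<open>A form with vanishing trace that is nonnegative up to few directions has a small nonnegative part
  as well, up to few directions: vectors with large value are split off greedily, and the trace
  bounds their number.\<close>

lemma one_sided_form: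
  fixes M :: "'i \<Rightarrow> 'i \<Rightarrow> complex" and g :: "nat \<Rightarrow> 'i \<Rightarrow> complex"
  assumes fin: "finite S" and M: "bnd S S M 1" and tr0: "Re (tr S M) = 0"
    and pos: "\<And>x. (\<forall>j<L. ip S (g j) x = 0) \<Longrightarrow> 0 \<le> Re (ip S x (mv S M x))" and t: "0 < t"
  shows "\<exists>d e. onf S {..<d::nat} e \<and> real d \<le> real L + real L / t \<and>
    (\<forall>x. (\<forall>i<d. ip S (e i) x = 0) \<longrightarrow>
       0 \<le> Re (ip S x (mv S M x)) \<and> Re (ip S x (mv S M x)) \<le> t * (nrm S x)\<^sup>2)"
proof -
  define q where "q x = Re (ip S x (mv S M x))" for x
  define P where "P l \<longleftrightarrow> (\<exists>v. onf S {..<l} v \<and> (\<forall>i<l. (\<forall>j<L. ip S (g j) (v i) = 0) \<and> t < q (v i)))" for l :: nat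
  have fam: "\<exists>w. onf S {..<card S - (L + l)} w \<and> (\<forall>k<card S - (L + l). \<forall>j<L. ip S (g j) (w k) = 0) \<and>
      (\<forall>k<card S - (L + l). \<forall>i<l. ip S (v i) (w k) = 0)" if v: "onf S {..<l} v" for l :: nat and v
  proof (cases "L + l \<le> card S")
    case True
    obtain w where w: "onf S {..<card S - (L + l)} w"
      "\<forall>k<card S - (L + l). \<forall>j\<in>{..<L} <+> {..<l}. ip S (case_sum g v j) (w k) = 0"
      using null_family[of "{..<L} <+> {..<l}" S "card S - (L + l)" "case_sum g v"] fin True
      by (auto simp: card_Plus)
    have "ip S (g j) (w k) = 0" if "k < card S - (L + l)" "j < L" for j k
      using w(2)[rule_format, OF that(1) InlI, of j] that by simp
    moreover have "ip S (v i) (w k) = 0" if "k < card S - (L + l)" "i < l" for i k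
      using w(2)[rule_format, OF that(1) InrI, of i] that by simp
    ultimately show ?thesis using w(1) by blast
  next
    case False
    then show ?thesis by (auto simp: onf_def)
  qed
  \<comment> \<open>Complete the \<open>l\<close> vectors to a basis by \<open>n\<close> vectors on
    which the form is nonnegative and by at most \<open>L\<close> others, where it is at least -1.
    Trace zero then gives l t \<le> L.\<close>
  have bound: "real l * t \<le> real L" if "P l" for l
  proof -
    obtain v where v: "onf S {..<l} v" "\<And>i j. i < l \<Longrightarrow> j < L \<Longrightarrow> ip S (g j) (v i) = 0" "\<And>i. i < l \<Longrightarrow> t < q (v i)"
      using \<open>P l\<close> unfolding P_def by blast
    define n where "n = card S - (L + l)"
    obtain w where w: "onf S {..<n} w" "\<forall>k<n. \<forall>j<L. ip S (g j) (w k) = 0" "\<forall>k<n. \<forall>i<l. ip S (v i) (w k) = 0"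
      using fam[OF v(1)] by (auto simp: n_def)
    have vw: "onf S ({..<l} <+> {..<n}) (case_sum v w)" by (rule onf_case_sum[OF v(1) w(1)]) (use w(3) in auto)
    have ln: "l + n \<le> card S" using onf_card_le[OF vw fin] by (simp add: card_Plus)
    define r where "r = card S - (l + n)"
    obtain y where y: "onf S {..<r} y" "\<forall>k<r. \<forall>j\<in>{..<l} <+> {..<n}. ip S (case_sum v w j) (y k) = 0"
      using null_family[of "{..<l} <+> {..<n}" S r "case_sum v w"] fin ln by (auto simp: card_Plus r_def)
    have all: "onf S (({..<l} <+> {..<n}) <+> {..<r}) (case_sum (case_sum v w) y)"
      by (rule onf_case_sum[OF vw y(1)]) (use y(2) in auto)
    have T: "tr (({..<l} <+> {..<n}) <+> {..<r}) (fmx S M (case_sum (case_sum v w) y)) = tr S M"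
      by (rule tr_fmx[OF all fin]) (use ln in \<open>auto simp: card_Plus r_def\<close>)
    have "(\<Sum>i<l. q (v i)) + (\<Sum>i<n. q (w i)) + (\<Sum>i<r. q (y i)) = 0"
      using arg_cong[OF T, of Re] tr0 by (simp add: tr_def sum.Plus fmx_def q_def)
    moreover have "real l * t \<le> (\<Sum>i<l. q (v i))"
      using sum_mono[of "{..<l}" "\<lambda>_. t" "\<lambda>i. q (v i)"] v(3) by (simp add: less_imp_le)
    moreover have "0 \<le> (\<Sum>i<n. q (w i))"
      unfolding q_def by (intro sum_nonneg pos) (use w in auto)
    moreover have "- real r \<le> (\<Sum>i<r. q (y i))"
    proof -
      have "- 1 \<le> q (y i)" if "i < r" for i
        using Re_form_le[OF M, of "y i"] onf_nrm[OF y(1), of i] that by (simp add: q_def)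
      then show ?thesis using sum_mono[of "{..<r}" "\<lambda>_. - 1" "\<lambda>i. q (y i)"] by simp
    qed
    moreover have "r \<le> L" by (simp add: r_def n_def)
    ultimately show ?thesis by linarith
  qed
  have P0: "P 0" by (simp add: P_def onf_def)
  have Pb: "P l \<Longrightarrow> l \<le> card S" for l
    using onf_card_le[OF _ fin, of "{..<l}"] unfolding P_def by fastforce
  \<comment> \<open>For maximal \<open>l\<close>, a vector orthogonal to all \<open>e i\<close>
    below lies in the span of \<open>w\<close>, hence is annihilated by all conditions and
    orthogonal to the \<open>v i\<close>. If its normalisation had a value above \<open>t\<close>,
    it would extend the family.\<close>
  define l where "l = Greatest P"
  have Pl: "P l" unfolding l_def by (rule GreatestI_nat[of P 0 "card S"]) (use P0 Pb in auto)
  have Pmax: "\<not> P (Suc l)" using Greatest_le_nat[of P "Suc l" "card S"] Pb by (auto simp: l_def)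
  obtain v where v: "onf S {..<l} v" "\<And>i j. i < l \<Longrightarrow> j < L \<Longrightarrow> ip S (g j) (v i) = 0" "\<And>i. i < l \<Longrightarrow> t < q (v i)"
    using Pl unfolding P_def by blast
  define n where "n = card S - (L + l)"
  obtain w where w: "onf S {..<n} w" "\<forall>k<n. \<forall>j<L. ip S (g j) (w k) = 0" "\<forall>k<n. \<forall>i<l. ip S (v i) (w k) = 0"
    using fam[OF v(1)] by (auto simp: n_def)
  define d where "d = card S - n"
  obtain e where e: "onf S {..<d} e" "\<forall>k<d. \<forall>j\<in>{..<n}. ip S (w j) (e k) = 0"
    using null_family[of "{..<n}" S d w] fin by (auto simp: d_def n_def)
  have we: "onf S ({..<n} <+> {..<d}) (case_sum w e)"
    by (rule onf_case_sum[OF w(1) e(1)]) (use e(2) in auto)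
  have "real d \<le> real L + real L / t"
  proof -
    have "d \<le> L + l" by (simp add: d_def n_def)
    moreover have "real l \<le> real L / t" using bound[OF Pl] t by (simp add: pos_le_divide_eq)
    ultimately show ?thesis by linarith
  qed
  moreover have "0 \<le> q x \<and> q x \<le> t * (nrm S x)\<^sup>2" if x: "\<forall>i<d. ip S (e i) x = 0" for x
  proof -
    have xe: "x i = lin {..<n} w (\<lambda>k. ip S (w k) x) i" if "i \<in> S" for i
      by (rule onf_perp_expand[OF we fin]) (use x that in \<open>auto simp: d_def n_def\<close>)
    have perp: "ip S h x = 0" if "\<forall>k<n. ip S h (w k) = 0" for h
    proof -
      have "ip S h x = ip S h (lin {..<n} w (\<lambda>k. ip S (w k) x))" by (rule ip_cong) (use xe in auto)
      then show ?thesis using that by (simp add: ip_lin_right)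
    qed
    have gx: "\<forall>j<L. ip S (g j) x = 0" using perp w(2) by blast
    have vx: "\<forall>i<l. ip S (v i) x = 0" using perp w(3) by blast
    have "q x \<le> t * (nrm S x)\<^sup>2"
    proof (cases "nrm S x = 0")
      case True
      then show ?thesis using Re_form_le[OF M, of x] by (simp add: q_def)
    next
      case False
      obtain c where c: "c \<noteq> 0" "nrm S (\<lambda>i. c * x i) = 1" using normalizing_factor[OF False] by blast
      define y where "y = (\<lambda>i. c * x i)"
      have "q y \<le> t"
      proof (rule ccontr)
        assume "\<not> q y \<le> t"
        have vy: "ip S (v i) y = 0" "ip S y (v i) = 0" if "i < l" for i
        proof -
          show "ip S (v i) y = 0" using vx that by (simp add: y_def ip_smult_right)
          then show "ip S y (v i) = 0" by (metis cj_ip cj_0)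
        qed
        have "onf S {..<Suc l} (v(l := y))"
          using v(1) vy c by (auto simp: onf_def less_Suc_eq ip_self_1 y_def[symmetric])
        moreover have "ip S (g j) y = 0" if "j < L" for j using gx that by (simp add: y_def ip_smult_right)
        ultimately have "P (Suc l)" unfolding P_def
          by (intro exI[of _ "v(l := y)"]) (use v \<open>\<not> q y \<le> t\<close> in \<open>auto simp: less_Suc_eq\<close>)
        then show False using Pmax by simp
      qed
      moreover have "q y = (cmod c)\<^sup>2 * q x"
      proof -
        have "ip S y (mv S M y) = (cnj c * c) * ip S x (mv S M x)"
          unfolding y_def mv_smult ip_smult_left ip_smult_right by simp
        also have "cnj c * c = of_real ((cmod c)\<^sup>2)" using complex_norm_square[of c] by (simp add: mult.commute)
        finally show ?thesis by (simp add: q_def)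
      qed
      ultimately have "(cmod c)\<^sup>2 * q x \<le> t" by simp
      then have "(cmod c)\<^sup>2 * q x * (nrm S x)\<^sup>2 \<le> t * (nrm S x)\<^sup>2" by (intro mult_right_mono) auto
      moreover have "cmod c * nrm S x = 1" using c(2) by (simp only: nrm_smult)
      then have "(cmod c)\<^sup>2 * (nrm S x)\<^sup>2 = 1" by (simp flip: power_mult_distrib)
      ultimately show ?thesis by (simp add: mult_ac)
    qed
    then show ?thesis using pos[OF gx] by (simp add: q_def)
  qed
  ultimately show ?thesis using e(1) unfolding q_def by blast
qed

text \<open>Polarisation.\<close>

lemma semidefinite_form_bound:
  fixes H :: "'i \<Rightarrow> 'i \<Rightarrow> complex"
  assumes fin: "finite S" and herm: "\<forall>i\<in>S. \<forall>j\<in>S. H j i = cj (H i j)"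
    and V: "\<And>x y \<alpha> \<beta>. x \<in> V \<Longrightarrow> y \<in> V \<Longrightarrow> (\<lambda>i. \<alpha> * x i + \<beta> * y i) \<in> V"
    and q: "\<And>x. x \<in> V \<Longrightarrow> 0 \<le> Re (ip S x (mv S H x)) \<and> Re (ip S x (mv S H x)) \<le> t * (nrm S x)\<^sup>2"
    and x: "x \<in> V" and y: "y \<in> V"
  shows "cmod (ip S x (mv S H y)) \<le> t * nrm S x * nrm S y"
proof (cases "nrm S x = 0 \<or> nrm S y = 0")
  case True
  then have "(\<forall>i\<in>S. x i = 0) \<or> (\<forall>i\<in>S. y i = 0)" using fin by (simp add: nrm_eq_0_iff)
  then have "ip S x (mv S H y) = 0" by (auto simp: ip_def mv_def)
  then show ?thesis using True by auto
next
  case False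
  obtain a where a: "nrm S (\<lambda>i. a * x i) = 1" using normalizing_factor False by blast
  obtain b where b: "nrm S (\<lambda>i. b * y i) = 1" using normalizing_factor False by blast
  define u where "u = (\<lambda>i. a * x i)"
  define w where "w = (\<lambda>i. b * y i)"
  have uV: "u \<in> V" "w \<in> V" using V[OF x x, of a 0] V[OF y y, of b 0] by (simp_all add: u_def w_def)
  define c where "c = ip S u (mv S H w)"
  define e where "e = (if c = 0 then 1 else cnj c / of_real (cmod c))"
  have e1: "cmod e = 1" by (simp add: e_def norm_divide)
  have ec: "e * c = of_real (cmod c)"
  proof (cases "c = 0")
    case False
    have "cnj c * c = of_real (cmod c) * of_real (cmod c)"
      using complex_norm_square[of c] by (simp add: power2_eq_square mult.commute)
    then show ?thesis using False by (simp add: e_def)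
  qed (simp add: e_def)
  define v where "v = (\<lambda>i. e * w i)"
  have vV: "v \<in> V" using V[OF uV(2,2), of e 0] by (simp add: v_def)
  have nv: "nrm S v = 1" "nrm S u = 1" using a b e1 by (simp_all add: v_def w_def u_def nrm_smult)
  have uv: "ip S u (mv S H v) = of_real (cmod c)" unfolding v_def mv_smult ip_smult_right c_def[symmetric] by (rule ec)
  have vu: "ip S v (mv S H u) = of_real (cmod c)"
    using self_adjoint_form[OF herm, of v u] uv by simp
  \<comment> \<open>The upper bound is used at u + v and the lower bound 0 at u - v; their
    difference is 4 |c| on one side and at most t |u + v|^2 \<le> 4 t on the other.\<close>
  have p: "ip S (\<lambda>i. u i + v i) (mv S H (\<lambda>i. u i + v i)) = ip S u (mv S H u) + ip S v (mv S H v) + 2 * of_real (cmod c)"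
    unfolding mv_add ip_add_left ip_add_right uv vu by simp
  have "mv S H (\<lambda>i. u i - v i) = (\<lambda>i. mv S H u i - mv S H v i)"
    by (simp add: mv_def algebra_simps sum_subtractf)
  then have m: "ip S (\<lambda>i. u i - v i) (mv S H (\<lambda>i. u i - v i)) = ip S u (mv S H u) + ip S v (mv S H v) - 2 * of_real (cmod c)"
    by (simp only: ip_diff_left ip_diff_right uv vu) simp
  have "(\<lambda>i. u i + v i) \<in> V" "(\<lambda>i. u i - v i) \<in> V" using V[OF uV(1) vV, of 1 1] V[OF uV(1) vV, of 1 "-1"] by simp_all
  from q[OF this(1)] q[OF this(2)] have
    "Re (ip S u (mv S H u)) + Re (ip S v (mv S H v)) + 2 * cmod c \<le> t * (nrm S (\<lambda>i. u i + v i))\<^sup>2"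
    "0 \<le> Re (ip S u (mv S H u)) + Re (ip S v (mv S H v)) - 2 * cmod c"
    unfolding p m by simp_all
  then have 4: "4 * cmod c \<le> t * (nrm S (\<lambda>i. u i + v i))\<^sup>2" by linarith
  have "0 \<le> t" using q[OF uV(1)] nv by auto
  have "nrm S (\<lambda>i. u i + v i) \<le> 2" using nrm_add[of S u v] nv by simp
  then have "(nrm S (\<lambda>i. u i + v i))\<^sup>2 \<le> 2\<^sup>2" by (intro power_mono) auto
  then have "t * (nrm S (\<lambda>i. u i + v i))\<^sup>2 \<le> t * 4" using \<open>0 \<le> t\<close> by (intro mult_left_mono) auto
  with 4 have ct: "cmod c \<le> t" by linarith
  have cab: "cmod c = cmod a * cmod b * cmod (ip S x (mv S H y))"
    unfolding c_def u_def w_def mv_smult ip_smult_left ip_smult_right by (simp add: norm_mult)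
  have ab: "cmod a * nrm S x = 1" "cmod b * nrm S y = 1" using a b by (simp_all only: nrm_smult)
  have "cmod c * nrm S x * nrm S y = cmod (ip S x (mv S H y)) * (cmod a * nrm S x) * (cmod b * nrm S y)"
    unfolding cab by (simp only: mult_ac)
  then have "cmod (ip S x (mv S H y)) = cmod c * nrm S x * nrm S y" unfolding ab by simp
  also have "\<dots> \<le> t * nrm S x * nrm S y" using ct by (intro mult_right_mono) auto
  finally show ?thesis .
qed

text \<open>The form bound controls <z, H x> only for z orthogonal to the \<open>e i\<close>. Since
  x is orthogonal to their images as well, H x is orthogonal to the \<open>e i\<close>, and testing
  it against y sees only the projection z of y.\<close>

lemma low_rank_part:
  fixes H :: "'i \<Rightarrow> 'i \<Rightarrow> complex"
  assumes fin: "finite S" and herm: "\<forall>i\<in>S. \<forall>j\<in>S. H j i = cj (H i j)" and e: "onf S {..<d::nat} e"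
    and q: "\<And>x. (\<forall>i<d. ip S (e i) x = 0) \<Longrightarrow>
       0 \<le> Re (ip S x (mv S H x)) \<and> Re (ip S x (mv S H x)) \<le> t * (nrm S x)\<^sup>2"
    and x: "\<forall>i<d. ip S (e i) x = 0 \<and> ip S (mv S H (e i)) x = 0" and t: "0 \<le> t"
  shows "nrm S (mv S H x) \<le> t * nrm S x"
proof (rule nrm_leI_ip)
  fix y
  define c where "c = (\<lambda>i. ip S (e i) y)"
  define z where "z = (\<lambda>i. y i - lin {..<d} e c i)"
  have ez: "ip S (e i) z = 0" if "i < d" for i
  proof -
    have "ip S (e i) (lin {..<d} e c) = (\<Sum>j<d. if i = j then c j else 0)"
      unfolding ip_lin_right by (rule sum.cong) (use that e in \<open>auto simp: onfD\<close>)
    then show ?thesis using that by (simp add: z_def ip_diff_right c_def)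
  qed
  have "ip S (e i) (mv S H x) = 0" if "i < d" for i
    using self_adjoint_form[OF herm, of "e i" x] x that cj_ip[of S x "mv S H (e i)"] by (metis cj_0)
  then have l0: "ip S (lin {..<d} e c) (mv S H x) = 0" by (simp add: ip_lin_left)
  have yz: "y = (\<lambda>i. z i + lin {..<d} e c i)" by (simp add: z_def)
  have "ip S y (mv S H x) = ip S z (mv S H x)"
    by (subst yz) (simp only: ip_add_left l0 add_0_right)
  moreover have "cmod (ip S z (mv S H x)) \<le> t * nrm S z * nrm S x"
    by (rule semidefinite_form_bound[OF fin herm, of "{x. \<forall>i<d. ip S (e i) x = 0}"])
      (use q ez x in \<open>auto simp: ip_add_right ip_smult_right\<close>)
  moreover have "nrm S z \<le> nrm S y"
  proof -
    have "ip S (lin {..<d} e c) z = 0" "ip S z (lin {..<d} e c) = 0"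
    proof -
      show "ip S (lin {..<d} e c) z = 0" using ez by (simp add: ip_lin_left)
      then show "ip S z (lin {..<d} e c) = 0" by (metis cj_ip cj_0)
    qed
    then have "ip S y y = ip S z z + ip S (lin {..<d} e c) (lin {..<d} e c)"
      by (subst (1 2) yz) (simp add: ip_add_left ip_add_right)
    then have "complex_of_real ((nrm S y)\<^sup>2) = of_real ((nrm S z)\<^sup>2 + (nrm S (lin {..<d} e c))\<^sup>2)"
      by (simp only: ip_self of_real_add)
    then have "(nrm S y)\<^sup>2 = (nrm S z)\<^sup>2 + (nrm S (lin {..<d} e c))\<^sup>2" by (simp only: of_real_eq_iff)
    then have "(nrm S z)\<^sup>2 \<le> (nrm S y)\<^sup>2" by simp
    then show ?thesis by (rule power2_le_imp_le) simp
  qed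
  ultimately show "cmod (ip S y (mv S H x)) \<le> t * nrm S x * nrm S y"
    using mult_left_mono[of "nrm S z" "nrm S y" "t * nrm S x"] t by (simp add: mult_ac)
qed (use t in auto)


lemma bnd_adj_block:
  fixes A :: "'i \<Rightarrow> 'i \<Rightarrow> 'a::star_field"
  assumes "bnd S S A c" "0 \<le> c" "\<And>i j. i \<in> S \<Longrightarrow> j \<in> S \<Longrightarrow> B i j = cj (A j i)"
  shows "bnd S S B c"
  using bnd_adj[OF assms(1,2)] by (subst bnd_cong[of S S B "adj A"]) (auto simp: adj_def assms(3))

lemma fmx_add: "fmx S (\<lambda>i j. A i j + B i j) u p q = fmx S A u p q + fmx S B u p q"
  by (simp add: fmx_def mv_def ip_def algebra_simps sum.distrib)

lemma fmx_smult: "fmx S (\<lambda>i j. z * A i j) u p q = z * fmx S A u p q"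
  by (simp add: fmx_def mv_def ip_def sum_distrib_left mult_ac)

lemma fmx_cong_mat: "(\<And>i j. i \<in> S \<Longrightarrow> j \<in> S \<Longrightarrow> A i j = B i j) \<Longrightarrow> fmx S A u = fmx S B u"
  unfolding fmx_def by (intro ext ip_cong mv_cong_mat) auto

lemma mv_diagonal: "finite S \<Longrightarrow> i \<in> S \<Longrightarrow> mv S (\<lambda>i j. if i = j then \<delta> i else 0) x i = \<delta> i * x i"
  by (simp add: mv_def if_distrib[of "\<lambda>z. z * _"] sum.delta cong: if_cong)

lemma fmx_self_adjoint:
  "\<forall>i\<in>S. \<forall>j\<in>S. H j i = cj (H i j) \<Longrightarrow> fmx S H u q p = cj (fmx S H u p q)"
  unfolding fmx_def by (rule self_adjoint_form)

lemma card_level_sets: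
  assumes "finite A" "finite Bs" "\<And>a. a \<in> A \<Longrightarrow> h a \<in> Bs"
  shows "card A = (\<Sum>\<beta>\<in>Bs. card {a\<in>A. h a = \<beta>})"
proof -
  have "A = (\<Union>\<beta>\<in>Bs. {a\<in>A. h a = \<beta>})" using assms by auto
  then have "card A = card (\<Union>\<beta>\<in>Bs. {a\<in>A. h a = \<beta>})" by simp
  also have "\<dots> = (\<Sum>\<beta>\<in>Bs. card {a\<in>A. h a = \<beta>})"
    by (rule card_UN_disjoint) (use assms in auto)
  finally show ?thesis .
qed

lemma ip_support:
  assumes "finite S" "B \<subseteq> S" "\<And>i. i \<notin> B \<Longrightarrow> y i = 0"
  shows "ip S x y = ip B x y"
  unfolding ip_def by (rule sum.mono_neutral_right) (use assms in auto)

lemma onf_level_sets: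
  fixes w :: "int \<Rightarrow> nat \<Rightarrow> 'i \<Rightarrow> 'a::star_field"
  assumes fin: "finite S" "A \<subseteq> S" and w: "\<And>\<beta>. onf {i\<in>A. bin i = \<beta>} {..<N \<beta>} (w \<beta>)"
    and supp: "\<And>\<beta> j i. j < N \<beta> \<Longrightarrow> i \<notin> {i\<in>A. bin i = \<beta>} \<Longrightarrow> w \<beta> j i = 0"
  shows "onf S (Sigma Bs (\<lambda>\<beta>. {..<N \<beta>})) (\<lambda>(\<beta>, j). w \<beta> j)"
  unfolding onf_def
proof (intro ballI)
  fix p q assume "p \<in> Sigma Bs (\<lambda>\<beta>. {..<N \<beta>})" "q \<in> Sigma Bs (\<lambda>\<beta>. {..<N \<beta>})"
  then obtain \<beta> j \<gamma> l where pq: "p = (\<beta>, j)" "q = (\<gamma>, l)" "j < N \<beta>" "l < N \<gamma>" by auto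
  have "ip S (w \<beta> j) (w \<gamma> l) = ip {i\<in>A. bin i = \<gamma>} (w \<beta> j) (w \<gamma> l)"
    by (rule ip_support) (use fin supp[OF pq(4)] in auto)
  also have "\<dots> = (if p = q then 1 else 0)"
  proof (cases "\<beta> = \<gamma>")
    case True
    then show ?thesis using pq onfD[OF w, of j \<gamma> l] by simp
  next
    case False
    then have "ip {i\<in>A. bin i = \<gamma>} (w \<beta> j) (w \<gamma> l) = 0"
      unfolding ip_def using supp[OF pq(3)] by (intro sum.neutral) auto
    then show ?thesis using False pq by simp
  qed
  finally show "ip S (case p of (\<beta>, j) \<Rightarrow> w \<beta> j) (case q of (\<beta>, j) \<Rightarrow> w \<beta> j) = (if p = q then 1 else 0)"
    using pq by simp
qed

text \<open>Basis vectors are taken inside the level sets of the eigenvalues of the skew part, orthogonal to the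
  exceptional directions \<open>e\<close> and their images under \<open>H\<close>; whatever is left is put into the small set \<open>E\<close>.\<close>

lemma thin_normal_form:
  fixes M H :: "'i \<Rightarrow> 'i \<Rightarrow> complex"
  assumes fin: "finite S" and k: "0 < k"
    and MH: "\<And>i j. i \<in> S \<Longrightarrow> j \<in> S \<Longrightarrow> M i j = H i j + (if i = j then \<i> * of_real (\<kappa>0 i) else 0)"
    and herm: "\<forall>i\<in>S. \<forall>j\<in>S. H j i = cj (H i j)" and e: "onf S {..<d::nat} e"
    and q: "\<And>x. (\<forall>i<d. ip S (e i) x = 0) \<Longrightarrow>
       0 \<le> Re (ip S x (mv S H x)) \<and> Re (ip S x (mv S H x)) \<le> t * (nrm S x)\<^sup>2"
    and \<kappa>0: "\<And>i. i \<in> S \<Longrightarrow> \<bar>\<kappa>0 i\<bar> \<le> 1" and t: "0 \<le> t" "t \<le> 1 / real k"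
  shows "\<exists>(T :: (nat + int \<times> nat) set) u E b. finite T \<and> card T = card S \<and> onf S T u \<and> E \<subseteq> T \<and>
    card E \<le> 2 * d * (2 * k + 1) \<and> (\<forall>p. \<bar>b p\<bar> \<le> int k) \<and>
    bnd T T (remainder E (\<lambda>p. real_of_int (b p) / real k) (fmx S M u)) (4 / real k)"
proof -
  \<comment> \<open>Rounding down to multiples of 1/k costs an error 1/k and leaves 2 k + 1 levels,
    a number independent of the dimension.\<close>
  define bin where "bin i = \<lfloor>real k * \<kappa>0 i\<rfloor>" for i
  define Bs where "Bs = {- int k..int k}"
  define SB where "SB \<beta> = {i\<in>S. bin i = \<beta>}" for \<beta>
  have binB: "bin i \<in> Bs" if "i \<in> S" for i
  proof -
    have "\<bar>real k * \<kappa>0 i\<bar> \<le> real k" using \<kappa>0[OF that] by (simp add: abs_mult mult_left_le)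
    then show ?thesis by (auto simp: bin_def Bs_def le_floor_iff floor_le_iff abs_le_iff)
  qed
  have finSB: "finite (SB \<beta>)" for \<beta> using fin by (simp add: SB_def)
  \<comment> \<open>Each level gives up 2 d dimensions, one for every \<open>e i\<close> and one for
    its image under \<open>H\<close>. Truncated subtraction lets a level with fewer elements
    contribute nothing; it falls into \<open>E\<close>.\<close>
  define N where "N \<beta> = card (SB \<beta>) - 2 * d" for \<beta>
  define g where "g = case_sum e (\<lambda>i. mv S H (e i))"
  have "\<exists>w. onf (SB \<beta>) {..<N \<beta>} w \<and> (\<forall>j<N \<beta>. \<forall>i. i \<notin> SB \<beta> \<longrightarrow> w j i = 0) \<and>
      (\<forall>j<N \<beta>. \<forall>l\<in>{..<d} <+> {..<d}. ip (SB \<beta>) (g l) (w j) = 0)" for \<beta>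
  proof (cases "2 * d \<le> card (SB \<beta>)")
    case True
    then show ?thesis by (intro null_family) (auto simp: finSB card_Plus N_def)
  next
    case False
    then show ?thesis by (auto simp: N_def onf_def)
  qed
  then have "\<forall>\<beta>. \<exists>w. onf (SB \<beta>) {..<N \<beta>} w \<and> (\<forall>j<N \<beta>. \<forall>i. i \<notin> SB \<beta> \<longrightarrow> w j i = 0) \<and>
      (\<forall>j<N \<beta>. \<forall>l\<in>{..<d} <+> {..<d}. ip (SB \<beta>) (g l) (w j) = 0)" by blast
  from choice[OF this] obtain w where w: "\<And>\<beta>. onf (SB \<beta>) {..<N \<beta>} (w \<beta>)"
    "\<And>\<beta> j i. j < N \<beta> \<Longrightarrow> i \<notin> SB \<beta> \<Longrightarrow> w \<beta> j i = 0"
    "\<And>\<beta> j l. j < N \<beta> \<Longrightarrow> l \<in> {..<d} <+> {..<d} \<Longrightarrow> ip (SB \<beta>) (g l) (w \<beta> j) = 0" by metis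
  define v where "v = (\<lambda>(\<beta>, j). w \<beta> j)"
  define V where "V = Sigma Bs (\<lambda>\<beta>. {..<N \<beta>})"
  have finV: "finite V" by (simp add: V_def Bs_def)
  have ipSB: "ip S x (w \<beta> j) = ip (SB \<beta>) x (w \<beta> j)" if "j < N \<beta>" for x \<beta> j
    by (rule ip_support) (use fin w(2)[OF that] in \<open>auto simp: SB_def\<close>)
  have onv: "onf S V v"
    unfolding V_def v_def by (rule onf_level_sets[OF fin subset_refl]) (use w in \<open>simp_all add: SB_def\<close>)
  have cardS: "card S = (\<Sum>\<beta>\<in>Bs. card (SB \<beta>))"
    unfolding SB_def by (rule card_level_sets) (use fin binB in \<open>auto simp: Bs_def\<close>)
  have cardV: "card V = (\<Sum>\<beta>\<in>Bs. N \<beta>)" by (simp add: V_def Bs_def)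
  have cB: "card Bs = 2 * k + 1" by (simp add: Bs_def)
  define d' where "d' = card S - card V"
  have d': "d' \<le> 2 * d * (2 * k + 1)"
  proof -
    have "card S \<le> (\<Sum>\<beta>\<in>Bs. N \<beta> + 2 * d)" unfolding cardS by (rule sum_mono) (simp add: N_def)
    also have "\<dots> = card V + 2 * d * (2 * k + 1)" by (simp add: sum.distrib cardV cB)
    finally show ?thesis by (simp add: d'_def)
  qed
  have Vle: "card V \<le> card S" by (rule onf_card_le[OF onv fin finV])
  obtain y where y: "onf S {..<d'} y" "\<forall>i<d'. \<forall>p\<in>V. ip S (v p) (y i) = 0"
    using null_family[OF finV fin, of d' v] Vle by (auto simp: d'_def)
  have yv: "ip S (y i) (v p) = 0" if "i < d'" "p \<in> V" for i p
    using y(2) that by (metis cj_ip cj_0)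
  define T where "T = {..<d'} <+> V"
  define u where "u = case_sum y v"
  define E where "E = (Inl ` {..<d'} :: (nat + int \<times> nat) set)"
  \<comment> \<open>Clamping makes the bound on \<open>b\<close> hold for all indices; on those from
    \<open>V\<close> it changes nothing.\<close>
  define b where "b p = (case p of Inl _ \<Rightarrow> 0 | Inr (\<beta>, j) \<Rightarrow> max (- int k) (min \<beta> (int k)))" for p :: "nat + int \<times> nat"
  have onu: "onf S T u" unfolding T_def u_def by (rule onf_case_sum[OF y(1) onv]) (use yv in auto)
  have finT: "finite T" by (simp add: T_def finV)
  have cardT: "card T = card S" using Vle finV by (simp add: T_def card_Plus d'_def)
  have bv: "b (Inr (\<beta>, j)) = \<beta>" if "(\<beta>, j) \<in> V" for \<beta> j
    using that by (auto simp: b_def V_def Bs_def)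
  let ?\<kappa> = "\<lambda>p. real_of_int (b p) / real k"
  define \<Delta> where "\<Delta> = (\<lambda>i j. if i = j then complex_of_real (\<kappa>0 i - real_of_int (bin i) / real k) else 0)"
  define D where "D = (\<lambda>i j. if i = j then complex_of_real (real_of_int (bin i) / real k) else 0)"
  have \<Delta>b: "bnd S S \<Delta> (1 / real k)"
    unfolding \<Delta>_def
  proof (rule bnd_diag[OF fin])
    fix i
    have "real_of_int (bin i) \<le> real k * \<kappa>0 i" "real k * \<kappa>0 i \<le> real_of_int (bin i) + 1"
      unfolding bin_def by linarith+
    then have "\<bar>real k * \<kappa>0 i - real_of_int (bin i)\<bar> / real k \<le> 1 / real k"
      by (intro divide_right_mono) auto
    moreover have "\<kappa>0 i - real_of_int (bin i) / real k = (real k * \<kappa>0 i - real_of_int (bin i)) / real k"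
      using k by (simp add: diff_divide_distrib)
    ultimately have "\<bar>\<kappa>0 i - real_of_int (bin i) / real k\<bar> \<le> 1 / real k"
      by (simp add: abs_divide)
    then show "cmod (complex_of_real (\<kappa>0 i - real_of_int (bin i) / real k)) \<le> 1 / real k"
      by (simp only: norm_of_real)
  qed simp
  have Dv: "mv S D (v p) i = of_real (?\<kappa> (Inr p)) * v p i" if p: "p \<in> V" and i: "i \<in> S" for p i
  proof -
    obtain \<beta> j where pj: "p = (\<beta>, j)" "j < N \<beta>" using p by (auto simp: V_def)
    have "mv S D (v p) i = complex_of_real (real_of_int (bin i) / real k) * v p i"
      unfolding D_def by (rule mv_diagonal[OF fin i])
    also have "\<dots> = of_real (?\<kappa> (Inr p)) * v p i"
    proof (cases "i \<in> SB \<beta>")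
      case True
      then show ?thesis using bv[of \<beta> j] p pj by (simp add: SB_def)
    next
      case False
      then show ?thesis using w(2)[OF pj(2)] pj by (simp add: v_def)
    qed
    finally show ?thesis .
  qed
  have Dr: "fmx S D u x (Inr p) = (if x = Inr p then of_real (?\<kappa> (Inr p)) else 0)" if p: "p \<in> V" and x: "x \<in> T" for x p
  proof -
    have "fmx S D u x (Inr p) = ip S (u x) (\<lambda>i. of_real (?\<kappa> (Inr p)) * u (Inr p) i)"
      unfolding fmx_def by (rule ip_cong) (use Dv[OF p] in \<open>auto simp: u_def\<close>)
    also have "\<dots> = of_real (?\<kappa> (Inr p)) * ip S (u x) (u (Inr p))" by (rule ip_smult_right)
    also have "ip S (u x) (u (Inr p)) = (if x = Inr p then 1 else 0)"
      by (rule onfD[OF onu x]) (use p in \<open>simp add: T_def InrI\<close>)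
    finally show ?thesis by simp
  qed
  have Dherm: "\<forall>i\<in>S. \<forall>j\<in>S. D j i = cj (D i j)" by (auto simp: D_def)
  have Dl: "fmx S D u (Inr p) x = (if x = Inr p then of_real (?\<kappa> (Inr p)) else 0)" if p: "p \<in> V" and x: "x \<in> T" for x p
    using fmx_self_adjoint[OF Dherm, of u "Inr p" x] Dr[OF p x] by simp
  \<comment> \<open>Columns in \<open>V\<close> are controlled by \<open>low_rank_part\<close>. The
    other entries outside the block on \<open>E\<close> have row in \<open>V\<close> and column in
    \<open>E\<close>; by self-adjointness they form the adjoint of the rows of \<open>A\<close> in
    \<open>E\<close>.\<close>
  define A where "A = (\<lambda>p q. if q \<in> Inr ` V then fmx S H u p q else 0)"
  define A' where "A' = (\<lambda>p q. if p \<in> Inr ` V \<and> q \<in> E then fmx S H u p q else 0)"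
  have A: "bnd T T A t"
    unfolding bnd_def
  proof
    fix c :: "nat + int \<times> nat \<Rightarrow> complex"
    define x where "x = lin V v (\<lambda>p. c (Inr p))"
    have "mv T A c p = ip S (u p) (mv S H x)" for p
    proof -
      have "mv T A c p = (\<Sum>q\<in>Inr ` V. fmx S H u p q * c q)"
        unfolding mv_def by (rule sum.mono_neutral_cong_right) (use finT in \<open>auto simp: A_def T_def\<close>)
      also have "\<dots> = (\<Sum>q\<in>V. fmx S H u p (Inr q) * c (Inr q))" by (simp add: sum.reindex)
      also have "\<dots> = ip S (u p) (mv S H x)"
        unfolding x_def lin_def mv_sum mv_smult ip_sum_right ip_smult_right
        by (simp add: fmx_def u_def mult.commute)
      finally show ?thesis .
    qed
    then have "mv T A c = mv S (adj (\<lambda>i p. u p i)) (mv S H x)"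
      by (auto simp: fun_eq_iff mv_def[of S "\<lambda>p i. cnj (u p i)"] adj_def ip_def)
    then have "nrm T (mv T A c) \<le> 1 * nrm S (mv S H x)"
      using bndD[OF bnd_adj[OF onf_bnd[OF onu finT]], of "mv S H x"] by simp
    also have "nrm S (mv S H x) \<le> t * nrm S x"
    proof (rule low_rank_part[OF fin herm e q _ t(1)])
      have "ip S (e i) (v p) = 0" "ip S (mv S H (e i)) (v p) = 0" if "i < d" "p \<in> V" for i p
      proof -
        obtain \<beta> j where pj: "p = (\<beta>, j)" "j < N \<beta>" using \<open>p \<in> V\<close> by (auto simp: V_def)
        show "ip S (e i) (v p) = 0" "ip S (mv S H (e i)) (v p) = 0"
          using w(3)[OF pj(2), of "Inl i"] w(3)[OF pj(2), of "Inr i"] that ipSB[OF pj(2)] pj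
          by (auto simp: v_def g_def)
      qed
      then show "\<forall>i<d. ip S (e i) x = 0 \<and> ip S (mv S H (e i)) x = 0"
        by (simp add: x_def ip_lin_right)
    qed
    also have "nrm S x = nrm V (\<lambda>p. c (Inr p))" unfolding x_def by (rule nrm_lin[OF onv finV])
    also have "nrm V (\<lambda>p. c (Inr p)) = nrm (Inr ` V) c"
      by (simp add: nrm_def L2_set_def sum.reindex)
    also have "\<dots> \<le> nrm T c" by (rule nrm_mono_set) (use finT in \<open>auto simp: T_def\<close>)
    finally show "nrm T (mv T A c) \<le> t * nrm T c" using t by (simp add: mult_left_mono)
  qed
  have A': "bnd T T A' t"
  proof -
    have "bnd T T (\<lambda>p q. if p \<in> E then A p q else 0) t"
      unfolding bnd_def
    proof
      fix c :: "nat + int \<times> nat \<Rightarrow> complex"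
      have "nrm T (mv T (\<lambda>p q. if p \<in> E then A p q else 0) c) \<le> 1 * nrm T (mv T A c)"
      proof (rule nrm_le_cw)
        fix p
        have "mv T (\<lambda>p q. if p \<in> E then A p q else 0) c p = (if p \<in> E then mv T A c p else 0)"
          by (simp add: mv_def)
        then show "cmod (mv T (\<lambda>p q. if p \<in> E then A p q else 0) c p) \<le> 1 * cmod (mv T A c p)" by simp
      qed simp
      then show "nrm T (mv T (\<lambda>p q. if p \<in> E then A p q else 0) c) \<le> t * nrm T c"
        using bndD[OF A, of c] by simp
    qed
    then show ?thesis
    proof (rule bnd_adj_block[OF _ t(1)])
      fix p q
      have h: "fmx S H u p q = cj (fmx S H u q p)" by (rule fmx_self_adjoint[OF herm])
      show "A' p q = cj (if q \<in> E then A q p else 0)"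
        unfolding A_def A'_def h by (simp del: cj_cnj)
    qed
  qed
  define Q where "Q = (\<lambda>p q. fmx S \<Delta> u p q - (if p \<in> E \<and> q \<in> E then fmx S \<Delta> u p q else 0))"
  have Q: "bnd T T Q (1 / real k + 1 / real k)"
    unfolding Q_def
  proof (rule bnd_diff)
    show \<Delta>u: "bnd T T (fmx S \<Delta> u) (1 / real k)" by (rule bnd_fmx[OF onu finT \<Delta>b])
    have "bnd E E (fmx S \<Delta> u) (1 / real k)"
      by (rule bnd_subset[OF \<Delta>u]) (auto simp: E_def T_def finV)
    then show "bnd T T (\<lambda>p q. if p \<in> E \<and> q \<in> E then fmx S \<Delta> u p q else 0) (1 / real k)"
      by (rule bnd_extend) (auto simp: E_def T_def finV)
  qed
  \<comment> \<open>The self-adjoint part contributes 2 t, and the rounding error 1/k counts twice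
    because its block on \<open>E\<close> is subtracted. With t \<le> 1/k the sum is at most
    4/k.\<close>
  have "bnd T T (\<lambda>p q. A p q + A' p q + \<i> * Q p q) (t + t + cmod \<i> * (1 / real k + 1 / real k))"
    by (intro bnd_add bnd_smult A A' Q)
  moreover have "remainder E ?\<kappa> (fmx S M u) p q = A p q + A' p q + \<i> * Q p q" if p: "p \<in> T" and q: "q \<in> T" for p q
  proof -
    have "fmx S M u p q = fmx S (\<lambda>i j. H i j + \<i> * (D i j + \<Delta> i j)) u p q"
    proof (rule fun_cong[OF fun_cong[OF fmx_cong_mat]])
      fix i j assume "i \<in> S" "j \<in> S"
      then show "M i j = H i j + \<i> * (D i j + \<Delta> i j)"
        using MH by (simp add: D_def \<Delta>_def)
    qed
    then have m: "fmx S M u p q = fmx S H u p q + \<i> * (fmx S D u p q + fmx S \<Delta> u p q)"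
      by (simp add: fmx_add fmx_smult)
    have T': "x \<in> E \<longleftrightarrow> x \<notin> Inr ` V" if "x \<in> T" for x using that by (auto simp: E_def T_def)
    show ?thesis
    proof (cases "p \<in> E \<and> q \<in> E")
      case True
      then show ?thesis using T'[OF q] T'[OF p] by (simp add: remainder_def A_def A'_def Q_def)
    next
      case False
      have Dpq: "fmx S D u p q = (if p = q then of_real (?\<kappa> p) else 0)"
      proof (cases "q \<in> Inr ` V")
        case True
        then show ?thesis using Dr[OF _ p] by auto
      next
        case False
        then have "p \<in> Inr ` V" using \<open>\<not> (p \<in> E \<and> q \<in> E)\<close> T'[OF p] T'[OF q] by blast
        then show ?thesis using Dl[OF _ q] by auto
      qed
      have "fmx S H u p q = A p q + A' p q"
        using False T'[OF p] T'[OF q] by (auto simp: A_def A'_def)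
      then show ?thesis using False
        by (simp add: remainder_def m Q_def Dpq) (auto simp: algebra_simps)
    qed
  qed
  ultimately have "bnd T T (remainder E ?\<kappa> (fmx S M u)) (t + t + cmod \<i> * (1 / real k + 1 / real k))"
    by (subst bnd_cong) auto
  then have "bnd T T (remainder E ?\<kappa> (fmx S M u)) (4 / real k)"
    by (rule bnd_mono) (use t in simp)
  moreover have "card E \<le> 2 * d * (2 * k + 1)" using d' by (simp add: E_def card_image)
  moreover have "\<forall>p. \<bar>b p\<bar> \<le> int k" by (auto simp: b_def split: sum.splits)
  moreover have "E \<subseteq> T" by (auto simp: E_def T_def)
  ultimately show ?thesis using finT cardT onu by blast
qed

subsection \<open>Grouping a matrix in normal form\<close>

lemma indicator_onf:
  fixes M :: "'i \<Rightarrow> 'i \<Rightarrow> 'a::star_field"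
  assumes "bij_betw h T S" "finite S"
  shows "onf S T (\<lambda>p i. if i = h p then 1 else 0 :: 'a)"
    and "\<And>p q. p \<in> T \<Longrightarrow> q \<in> T \<Longrightarrow> fmx S M (\<lambda>p i. if i = h p then 1 else 0) p q = M (h p) (h q)"
proof -
  have hS: "h p \<in> S" if "p \<in> T" for p using assms(1) that by (auto simp: bij_betw_def)
  have inj: "h p = h q \<longleftrightarrow> p = q" if "p \<in> T" "q \<in> T" for p q
    using assms(1) that by (auto simp: bij_betw_def inj_on_def)
  have ipu: "ip S (\<lambda>i. if i = s then 1 else 0) y = y s" if "s \<in> S" for s and y :: "'i \<Rightarrow> 'a"
    using assms(2) that by (simp add: ip_def if_distrib[of cj] if_distrib[of "\<lambda>z. z * _"] cong: if_cong)
  show "onf S T (\<lambda>p i. if i = h p then 1 else 0 :: 'a)"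
    unfolding onf_def using hS inj by (simp add: ipu)
  show "fmx S M (\<lambda>p i. if i = h p then 1 else 0) p q = M (h p) (h q)" if "p \<in> T" "q \<in> T" for p q
    using hS that assms(2) by (simp add: fmx_def ipu mv_unit)
qed

lemma paved_cong:
  assumes "\<And>i j. i \<in> S \<Longrightarrow> j \<in> S \<Longrightarrow> M i j = M' i j"
  shows "paved k g S M \<longleftrightarrow> paved k g S M'"
proof -
  have e: "(fmx S M :: (nat \<times> nat \<Rightarrow> _) \<Rightarrow> _) = fmx S M'"
    by (rule ext, rule fmx_cong_mat) (rule assms)
  show ?thesis unfolding paved_def e ..
qed

lemma paved_reindex:
  assumes h: "bij_betw h T S" and fin: "finite S" and p: "paved k g T (\<lambda>p q. M (h p) (h q))"
  shows "paved k g S M"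
proof (rule paved_transfer[OF indicator_onf(1)[OF h fin]])
  show "finite T" "card T = card S" using h fin bij_betw_finite bij_betw_same_card by blast+
  show "paved k g T (fmx S M (\<lambda>p i. if i = h p then 1 else 0))"
    using p by (subst paved_cong) (auto simp: indicator_onf(2)[OF h fin])
qed

text \<open>Trace zero expresses the sum by the diagonal entries on \<open>E\<close>, which are at
  most 1, and those of the remainder, which are at most \<rho>.\<close>

lemma skew_part_sum:
  fixes M :: "'i \<Rightarrow> 'i \<Rightarrow> complex"
  assumes fin: "finite S" "E \<subseteq> S" and M: "bnd S S M 1" and R: "bnd S S (remainder E \<kappa> M) \<rho>"
    and tr0: "tr S M = 0"
  shows "\<bar>\<Sum>i\<in>S - E. \<kappa> i\<bar> \<le> real (card E) + real (card S) * \<rho>"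
proof -
  have \<rho>: "0 \<le> \<rho>" if "i \<in> S" for i using bnd_entry[OF R fin(1,1) that that] norm_ge_zero order_trans by blast
  have "0 = (\<Sum>i\<in>E. M i i) + (\<Sum>i\<in>S - E. M i i)"
    using tr0 fin by (simp add: tr_def sum.subset_diff[of E S] add.commute)
  also have "(\<Sum>i\<in>S - E. M i i) = (\<Sum>i\<in>S - E. \<i> * of_real (\<kappa> i) + remainder E \<kappa> M i i)"
    by (rule sum.cong) (auto simp: remainder_def)
  also have "\<dots> = \<i> * of_real (\<Sum>i\<in>S - E. \<kappa> i) + (\<Sum>i\<in>S - E. remainder E \<kappa> M i i)"
    by (simp add: sum.distrib sum_distrib_left)
  finally have "\<i> * of_real (\<Sum>i\<in>S - E. \<kappa> i) = - ((\<Sum>i\<in>E. M i i) + (\<Sum>i\<in>S - E. remainder E \<kappa> M i i))"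
    by (simp add: eq_neg_iff_add_eq_0 algebra_simps)
  then have "\<bar>\<Sum>i\<in>S - E. \<kappa> i\<bar> = cmod ((\<Sum>i\<in>E. M i i) + (\<Sum>i\<in>S - E. remainder E \<kappa> M i i))"
    by (metis norm_minus_cancel norm_mult norm_ii norm_of_real mult_1_left)
  also have "\<dots> \<le> (\<Sum>i\<in>E. 1) + (\<Sum>i\<in>S - E. \<rho>)"
    by (intro order_trans[OF norm_triangle_ineq] add_mono sum_norm_le)
      (use bnd_entry[OF M fin(1,1)] bnd_entry[OF R fin(1,1)] fin in auto)
  also have "\<dots> \<le> real (card E) + (\<Sum>i\<in>S. \<rho>)"
    using sum_mono2[of S "S - E" "\<lambda>_. \<rho>"] fin \<rho> by auto
  finally show ?thesis by simp
qed

text \<open>Greedy correction: an element above the mean is added after a deficit and one below it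
  otherwise, so the error never exceeds 2. Repetitions are harmless, as each chosen element will
  only designate a level.\<close>

lemma near_mean_sequence:
  fixes \<kappa> :: "'i \<Rightarrow> real"
  assumes fin: "finite B" "B \<noteq> {}" and \<kappa>: "\<And>i. i \<in> B \<Longrightarrow> \<bar>\<kappa> i\<bar> \<le> 1"
  shows "\<exists>\<gamma>. (\<forall>l. \<gamma> l \<in> B) \<and> \<bar>(\<Sum>l<n. \<kappa> (\<gamma> l)) - real n * ((\<Sum>i\<in>B. \<kappa> i) / real (card B))\<bar> \<le> 2"
proof -
  define \<mu> where "\<mu> = (\<Sum>i\<in>B. \<kappa> i) / real (card B)"
  have cB: "real (card B) > 0" using fin by (simp add: card_gt_0_iff)
  have ex: "\<exists>i\<in>B. \<kappa> i \<le> \<mu>" "\<exists>i\<in>B. \<mu> \<le> \<kappa> i"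
  proof -
    show "\<exists>i\<in>B. \<kappa> i \<le> \<mu>"
    proof (rule ccontr)
      assume "\<not> ?thesis"
      then have "(\<Sum>i\<in>B. \<mu>) < (\<Sum>i\<in>B. \<kappa> i)" using fin by (intro sum_strict_mono) auto
      then show False using cB by (simp add: \<mu>_def)
    qed
    show "\<exists>i\<in>B. \<mu> \<le> \<kappa> i"
    proof (rule ccontr)
      assume "\<not> ?thesis"
      then have "(\<Sum>i\<in>B. \<kappa> i) < (\<Sum>i\<in>B. \<mu>)" using fin by (intro sum_strict_mono) auto
      then show False using cB by (simp add: \<mu>_def)
    qed
  qed
  then obtain i j where ij: "i \<in> B" "j \<in> B" "\<kappa> i \<le> \<mu>" "\<mu> \<le> \<kappa> j" by blast
  have \<mu>: "\<bar>\<mu>\<bar> \<le> 1" using ij \<kappa>[OF ij(1)] \<kappa>[OF ij(2)] by linarith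
  have "\<exists>\<gamma>. (\<forall>l. \<gamma> l \<in> B) \<and> \<bar>(\<Sum>l<n. \<kappa> (\<gamma> l)) - real n * \<mu>\<bar> \<le> 2"
  proof (induction n)
    case 0
    then show ?case using ij by auto
  next
    case (Suc n)
    then obtain \<gamma> where \<gamma>: "\<forall>l. \<gamma> l \<in> B" "\<bar>(\<Sum>l<n. \<kappa> (\<gamma> l)) - real n * \<mu>\<bar> \<le> 2" by blast
    define m where "m = (if (\<Sum>l<n. \<kappa> (\<gamma> l)) - real n * \<mu> \<le> 0 then j else i)"
    have "(\<Sum>l<Suc n. \<kappa> ((\<gamma>(n := m)) l)) = (\<Sum>l<n. \<kappa> (\<gamma> l)) + \<kappa> m" by simp
    moreover have "real (Suc n) * \<mu> = real n * \<mu> + \<mu>" by (simp add: algebra_simps)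
    ultimately have "\<bar>(\<Sum>l<Suc n. \<kappa> ((\<gamma>(n := m)) l)) - real (Suc n) * \<mu>\<bar> \<le> 2"
      using \<gamma>(2) ij \<kappa>[OF ij(1)] \<kappa>[OF ij(2)] \<mu> by (auto simp: m_def abs_le_iff)
    then show ?case using \<gamma>(1) ij by (intro exI[of _ "\<gamma>(n := m)"]) (auto simp: m_def)
  qed
  then show ?thesis by (simp add: \<mu>_def)
qed

text \<open>Once the earlier vectors are fixed, the orthogonality requirements on the next one are
  linear: two for each element of \<open>E\<close> and three for each earlier vector. The diagonal
  values of the form are left free, so no zero of a quadratic form has to be found.\<close>

lemma partner_sequence:
  fixes M :: "'i \<Rightarrow> 'i \<Rightarrow> complex"
  assumes fin: "finite S" "finite E" and sub: "\<And>t. t < N \<Longrightarrow> B t \<subseteq> S"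
    and big: "\<And>t. t < N \<Longrightarrow> 2 * card E + 3 * N < card (B t)"
  shows "\<exists>f. \<forall>t<N. nrm S (f t) = 1 \<and> (\<forall>i. i \<notin> B t \<longrightarrow> f t i = 0) \<and>
    (\<forall>a\<in>E. mv S M (f t) a = 0 \<and> mv S (adj M) (f t) a = 0) \<and>
    (\<forall>s<t. ip S (f s) (f t) = 0 \<and> fmx S M f s t = 0 \<and> fmx S M f t s = 0)"
proof -
  define Q where "Q f t \<longleftrightarrow> nrm S (f t) = 1 \<and> (\<forall>i. i \<notin> B t \<longrightarrow> f t i = 0) \<and>
    (\<forall>a\<in>E. mv S M (f t) a = 0 \<and> mv S (adj M) (f t) a = 0) \<and>
    (\<forall>s<t. ip S (f s) (f t) = 0 \<and> fmx S M f s t = 0 \<and> fmx S M f t s = 0)" for f :: "nat \<Rightarrow> 'i \<Rightarrow> complex" and t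
  have "\<exists>f. \<forall>t<n. Q f t" if "n \<le> N" for n
    using that
  proof (induction n)
    case 0
    then show ?case by simp
  next
    case (Suc n)
    then obtain f where f: "\<forall>t<n. Q f t" by auto
    have nN: "n < N" using Suc.prems by simp
    define J where "J = (E <+> E) <+> ({..<n} <+> ({..<n} <+> {..<n}))"
    define g where "g = case_sum (case_sum (\<lambda>a i. cnj (M a i)) (\<lambda>a i. M i a))
      (case_sum f (case_sum (\<lambda>s. mv S (adj M) (f s)) (\<lambda>s. mv S M (f s))))"
    have "card J = 2 * card E + 3 * n" using fin by (simp add: J_def card_Plus)
    then have "card J < card (B n)" using big[OF nN] nN by simp
    moreover have "finite (B n)" using finite_subset[OF sub[OF nN] fin(1)] .
    ultimately obtain v where v: "nrm (B n) v = 1" "\<forall>i. i \<notin> B n \<longrightarrow> v i = 0" "\<forall>j\<in>J. ip (B n) (g j) v = 0"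
      using null_vector[of J "B n" g] fin by (auto simp: J_def)
    have ipB: "ip S x v = ip (B n) x v" for x
      unfolding ip_def by (rule sum.mono_neutral_right) (use fin sub[OF nN] v(2) in auto)
    have "nrm S v = nrm (B n) v" by (rule nrm_zero_outside) (use fin sub[OF nN] v(2) in auto)
    then have nv: "nrm S v = 1" using v(1) by simp
    have g0: "ip S (g j) v = 0" if "j \<in> J" for j using v(3) that by (simp add: ipB)
    have a: "mv S M v a = 0" "mv S (adj M) v a = 0" if "a \<in> E" for a
      using g0[of "Inl (Inl a)"] g0[of "Inl (Inr a)"] that
      by (auto simp: J_def g_def ip_def mv_def adj_def)
    have s: "ip S (f s) v = 0" "ip S (f s) (mv S M v) = 0" "ip S v (mv S M (f s)) = 0" if "s < n" for s
    proof -
      show "ip S (f s) v = 0" using g0[of "Inr (Inl s)"] that by (auto simp: J_def g_def)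
      show "ip S (f s) (mv S M v) = 0" unfolding ip_adj using g0[of "Inr (Inr (Inl s))"] that by (auto simp: J_def g_def)
      have "ip S (mv S M (f s)) v = 0" using g0[of "Inr (Inr (Inr s))"] that by (auto simp: J_def g_def)
      then show "ip S v (mv S M (f s)) = 0" by (metis cj_ip cj_0)
    qed
    have "Q (f(n := v)) t" if "t < Suc n" for t
    proof (cases "t = n")
      case True
      then show ?thesis using nv v(2) a s by (auto simp: Q_def fmx_def)
    next
      case False
      then have "t < n" using that by simp
      then show ?thesis using f by (auto simp: Q_def fmx_def)
    qed
    then show ?case by blast
  qed
  from this[of N] show ?thesis by (simp add: Q_def)
qed

lemma fmx_sum: "fmx S M u p q = (\<Sum>i\<in>S. \<Sum>j\<in>S. cj (u p i) * M i j * u q j)"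
  by (simp add: fmx_def ip_def mv_def sum_distrib_left mult.assoc)

text \<open>A change of basis that mixes \<open>E\<close> only with itself and the other coordinates
  only within levels of \<kappa> preserves the block on \<open>E\<close> and the diagonal part,
  hence commutes with taking the remainder.\<close>

lemma remainder_fmx:
  fixes M :: "'i \<Rightarrow> 'i \<Rightarrow> complex"
  assumes fin: "finite S" and E: "E \<subseteq> S"
    and onu: "onf S T u" and p: "p \<in> T" and q: "q \<in> T" and E': "E' \<subseteq> T"
    and uE: "\<And>p i. p \<in> E' \<Longrightarrow> i \<in> S - E \<Longrightarrow> u p i = 0"
    and uT: "\<And>p i. p \<in> T - E' \<Longrightarrow> i \<in> S \<Longrightarrow> i \<in> E \<or> \<kappa> i \<noteq> \<kappa>' p \<Longrightarrow> u p i = 0"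
  shows "remainder E' \<kappa>' (fmx S M u) p q = fmx S (remainder E \<kappa> M) u p q"
proof -
  define X where "X = (\<lambda>i j. if i \<in> E \<and> j \<in> E then M i j else 0)"
  define D where "D = (\<lambda>i j. if i = j then if i \<in> E then 0 else \<i> * complex_of_real (\<kappa> i) else 0)"
  have "fmx S M u p q = fmx S (\<lambda>i j. (X i j + D i j) + remainder E \<kappa> M i j) u p q"
    by (intro fun_cong[OF fun_cong[OF fmx_cong_mat]]) (auto simp: X_def D_def remainder_def)
  then have dec: "fmx S M u p q = fmx S X u p q + fmx S D u p q + fmx S (remainder E \<kappa> M) u p q"
    by (simp only: fmx_add)
  have X: "fmx S X u p q = (if p \<in> E' \<and> q \<in> E' then fmx S M u p q else 0)"
  proof (cases "p \<in> E' \<and> q \<in> E'")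
    case True
    have key: "cnj (u p i) * X i j * u q j = cnj (u p i) * M i j * u q j" if "i \<in> S" "j \<in> S" for i j
      using uE[of p i] uE[of q j] True that by (auto simp: X_def)
    have "fmx S X u p q = fmx S M u p q"
      unfolding fmx_sum cj_cnj by (intro sum.cong refl, rule key)
    then show ?thesis using True by simp
  next
    case False
    have key: "cnj (u p i) * X i j * u q j = 0" if "i \<in> S" "j \<in> S" for i j
      using uT[of p i] uT[of q j] False p q that by (auto simp: X_def)
    have "fmx S X u p q = 0"
      unfolding fmx_sum cj_cnj by (intro sum.neutral ballI, rule key)
    then show ?thesis using False by auto
  qed
  have mvD: "mv S D x i = (if i \<in> E then 0 else \<i> * complex_of_real (\<kappa> i)) * x i" if "i \<in> S" for x i
    unfolding D_def by (rule mv_diagonal[OF fin that])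
  have D: "fmx S D u p q = (if p \<in> E' \<and> q \<in> E' then 0 else if p = q then \<i> * of_real (\<kappa>' p) else 0)"
  proof (cases "q \<in> E'")
    case True
    have "mv S D (u q) i = 0" if "i \<in> S" for i using mvD[OF that] uE[OF True, of i] that by auto
    then have "fmx S D u p q = 0" by (simp add: fmx_def ip_def)
    then show ?thesis using True by auto
  next
    case False
    have "mv S D (u q) i = \<i> * of_real (\<kappa>' q) * u q i" if "i \<in> S" for i
      using mvD[OF that] uT[of q i] False q that by auto
    then have "fmx S D u p q = ip S (u p) (\<lambda>i. \<i> * of_real (\<kappa>' q) * u q i)"
      unfolding fmx_def by (intro ip_cong) auto
    also have "\<dots> = \<i> * of_real (\<kappa>' q) * (if p = q then 1 else 0)"
      unfolding ip_smult_right onfD[OF onu p q] ..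
    finally show ?thesis using False by simp
  qed
  show ?thesis unfolding remainder_def[of E'] using dec X D by (auto split: if_splits)
qed


text \<open>Each element of \<open>E\<close> is grouped with k - 1 partners; the remaining vectors
  are grouped by \<open>balanced_groups\<close>. A partner has to meet many linear conditions and
  still lie in one level of \<kappa>, so that the normal form survives; hence only levels with
  enough elements supply partners. Trace zero makes the mean of \<kappa> of order 1/k, so that k - 1
  partners chosen near the mean have a bounded sum.\<close>

lemma paved_normal_form:
  fixes M :: "'i \<Rightarrow> 'i \<Rightarrow> complex"
  assumes fin: "finite S" and E: "E \<subseteq> S" and k: "0 < k" and b: "\<And>i. \<bar>b i\<bar> \<le> int k"
    and M: "bnd S S M 1" and R: "bnd S S (remainder E (\<lambda>i. real_of_int (b i) / real k) M) (4 / real k)"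
    and tr0: "tr S M = 0" and mk: "card S = m * k"
    and large: "2 * k * (card E + (2 * k + 1) * (3 * k * card E + 1)) \<le> card S"
  shows "paved k (24 / real k) S M"
proof -
  obtain k' where k': "k = Suc k'" using k by (cases k) auto
  define d where "d = card E"
  define n where "n = card S"
  define N where "N = k' * d"
  define \<rho> where "\<rho> = 4 / real k"
  define \<kappa> where "\<kappa> i = real_of_int (b i) / real k" for i
  have finE: "finite E" using E fin by (rule finite_subset)
  have \<kappa>1: "\<bar>\<kappa> i\<bar> \<le> 1" for i
  proof -
    have "\<bar>real_of_int (b i)\<bar> \<le> real k" using b[of i] by linarith
    then show ?thesis using k by (simp add: \<kappa>_def abs_divide)
  qed
  define Bs where "Bs = {- int k..int k}"
  have cB: "card Bs = 2 * k + 1" "finite Bs" by (simp_all add: Bs_def)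
  have bB: "b i \<in> Bs" for i using b[of i] by (auto simp: Bs_def)
  define SB where "SB \<beta> = {i\<in>S - E. b i = \<beta>}" for \<beta>
  have finSB: "finite (SB \<beta>)" for \<beta> using fin by (simp add: SB_def)
  \<comment> \<open>A bound for the number of linear conditions on a partner in
    \<open>partner_sequence\<close>.\<close>
  define c0 where "c0 = 2 * d + 3 * N"
  have c0: "c0 \<le> 3 * k * d" by (simp add: c0_def N_def k' algebra_simps)
  \<comment> \<open>Bounds the size of \<open>E\<close> together with all levels of at most
    \<open>c0\<close> elements. The hypothesis \<open>large\<close> keeps it below n / (2
    k).\<close>
  define P where "P = d + (2 * k + 1) * c0"
  have P: "2 * k * P + 2 * k \<le> n"
  proof -
    have "P + 1 \<le> d + (2 * k + 1) * (3 * k * d + 1)"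
      using mult_le_mono2[OF c0, of "2 * k + 1"] by (simp add: P_def algebra_simps)
    from mult_le_mono2[OF this, of "2 * k"] large show ?thesis by (simp add: d_def n_def algebra_simps)
  qed
  have n0: "0 < n" using P k by linarith
  have P2: "2 * P \<le> n"
  proof -
    have "2 * P \<le> 2 * k * P" using k by (simp add: k')
    then show ?thesis using P by linarith
  qed
  have Preal: "2 * real k * real P \<le> real n"
    using of_nat_mono[OF P, where 'a = real] by (simp add: algebra_simps)
  define Big where "Big = {i\<in>S - E. c0 < card (SB (b i))}"
  have small: "card (S - E - Big) \<le> (2 * k + 1) * c0"
  proof -
    have "card (S - E - Big) = (\<Sum>\<beta>\<in>Bs. card {i \<in> S - E - Big. b i = \<beta>})"
      by (rule card_level_sets) (use fin cB bB in auto)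
    also have "\<dots> \<le> (\<Sum>\<beta>\<in>Bs. c0)"
    proof (rule sum_mono)
      fix \<beta>
      show "card {i \<in> S - E - Big. b i = \<beta>} \<le> c0"
      proof (cases "card (SB \<beta>) \<le> c0")
        case True
        have "card {i \<in> S - E - Big. b i = \<beta>} \<le> card (SB \<beta>)"
          by (rule card_mono[OF finSB]) (auto simp: SB_def)
        then show ?thesis using True by simp
      next
        case False
        then have "{i \<in> S - E - Big. b i = \<beta>} = {}" by (auto simp: Big_def)
        then show ?thesis by (simp only: card.empty le0)
      qed
    qed
    finally show ?thesis by (simp add: cB)
  qed
  have BigS: "Big \<subseteq> S - E" by (auto simp: Big_def)
  have finBig: "finite Big" using BigS fin finite_subset by blast
  have cSE: "card (S - E) = n - d" using E finE by (simp add: card_Diff_subset n_def d_def)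
  have cardBig: "n \<le> 2 * card Big"
  proof -
    have "card (S - E - Big) = card (S - E) - card Big" using BigS finBig by (simp add: card_Diff_subset)
    then have "n - d - card Big \<le> (2 * k + 1) * c0" using small cSE by simp
    then show ?thesis using P2 by (simp add: P_def)
  qed
  have Rk: "bnd S S (remainder E \<kappa> M) \<rho>" using R by (simp add: \<kappa>_def[abs_def] \<rho>_def)
  have sumSE: "\<bar>\<Sum>i\<in>S - E. \<kappa> i\<bar> \<le> real d + real n * \<rho>"
    using skew_part_sum[OF fin E M Rk tr0] by (simp add: d_def n_def)
  have sumBig: "\<bar>\<Sum>i\<in>Big. \<kappa> i\<bar> \<le> real P + real n * \<rho>"
  proof -
    have "(\<Sum>i\<in>S - E. \<kappa> i) = (\<Sum>i\<in>S - E - Big. \<kappa> i) + (\<Sum>i\<in>Big. \<kappa> i)"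
      by (rule sum.subset_diff[OF BigS]) (use fin in simp)
    moreover have "\<bar>\<Sum>i\<in>S - E - Big. \<kappa> i\<bar> \<le> real ((2 * k + 1) * c0)"
    proof -
      have "\<bar>\<Sum>i\<in>S - E - Big. \<kappa> i\<bar> \<le> (\<Sum>i\<in>S - E - Big. 1)"
        by (rule order_trans[OF sum_abs sum_mono]) (use \<kappa>1 in auto)
      also have "\<dots> \<le> real ((2 * k + 1) * c0)" using small by (simp only: sum_constant mult_1_right of_nat_mono)
      finally show ?thesis .
    qed
    moreover have "real P = real d + real ((2 * k + 1) * c0)" by (simp add: P_def)
    ultimately show ?thesis using sumSE by linarith
  qed
  have Bigne: "Big \<noteq> {}" using cardBig n0 by auto
  obtain \<gamma> where \<gamma>: "\<And>l. \<gamma> l \<in> Big"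
    "\<bar>(\<Sum>l<k'. \<kappa> (\<gamma> l)) - real k' * ((\<Sum>i\<in>Big. \<kappa> i) / real (card Big))\<bar> \<le> 2"
    using near_mean_sequence[OF finBig Bigne, of \<kappa> k'] \<kappa>1 by blast
  \<comment> \<open>As \<open>Big\<close> contains at least half of the indices, k times the mean
    over it is at most 9 in modulus; the deviation from the mean adds 2.\<close>
  have \<gamma>11: "\<bar>\<Sum>l<k'. \<kappa> (\<gamma> l)\<bar> \<le> 11"
  proof -
    have cb: "real n / 2 \<le> real (card Big)" using of_nat_mono[OF cardBig, where 'a = real] by simp
    have "real k * \<bar>\<Sum>i\<in>Big. \<kappa> i\<bar> \<le> real k * (real P + real n * \<rho>)"
      using sumBig by (intro mult_left_mono) auto
    also have "\<dots> = real k * real P + 4 * real n" using k by (simp add: \<rho>_def algebra_simps)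
    also have "\<dots> \<le> real n / 2 + 4 * real n" using Preal by linarith
    also have "\<dots> \<le> 9 * real (card Big)" using cb by linarith
    finally have "real k * \<bar>\<Sum>i\<in>Big. \<kappa> i\<bar> \<le> 9 * real (card Big)" .
    moreover have "real k' * \<bar>\<Sum>i\<in>Big. \<kappa> i\<bar> \<le> real k * \<bar>\<Sum>i\<in>Big. \<kappa> i\<bar>"
      by (rule mult_right_mono) (auto simp: k')
    ultimately have "real k' * \<bar>\<Sum>i\<in>Big. \<kappa> i\<bar> / real (card Big) \<le> 9"
      using cb n0 by (simp add: pos_divide_le_eq)
    then have "\<bar>real k' * ((\<Sum>i\<in>Big. \<kappa> i) / real (card Big))\<bar> \<le> 9"
      by (simp add: abs_mult abs_divide)
    then show ?thesis using \<gamma>(2) by linarith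
  qed
  \<comment> \<open>Partner number t = c k' + (l - 1) takes position \<open>l\<close> in group
    \<open>c\<close>. All groups repeat one pattern of k' levels, hence the residue of t.\<close>
  define \<beta> where "\<beta> t = b (\<gamma> (t mod k'))" for t
  have "2 * card E + 3 * N < card (SB (\<beta> t))" for t
    using \<gamma>(1)[of "t mod k'"] by (auto simp: Big_def \<beta>_def c0_def d_def)
  then have "\<exists>f. \<forall>t<N. nrm S (f t) = 1 \<and> (\<forall>i. i \<notin> SB (\<beta> t) \<longrightarrow> f t i = 0) \<and>
    (\<forall>a\<in>E. mv S M (f t) a = 0 \<and> mv S (adj M) (f t) a = 0) \<and>
    (\<forall>s<t. ip S (f s) (f t) = 0 \<and> fmx S M f s t = 0 \<and> fmx S M f t s = 0)"
    by (intro partner_sequence[OF fin finE]) (auto simp: SB_def)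
  then obtain f where f: "\<And>t. t < N \<Longrightarrow> nrm S (f t) = 1" "\<And>t i. t < N \<Longrightarrow> i \<notin> SB (\<beta> t) \<Longrightarrow> f t i = 0"
    "\<And>t a. t < N \<Longrightarrow> a \<in> E \<Longrightarrow> mv S M (f t) a = 0" "\<And>t a. t < N \<Longrightarrow> a \<in> E \<Longrightarrow> mv S (adj M) (f t) a = 0"
    "\<And>t s. t < N \<Longrightarrow> s < t \<Longrightarrow> ip S (f s) (f t) = 0" "\<And>t s. t < N \<Longrightarrow> s < t \<Longrightarrow> fmx S M f s t = 0"
    "\<And>t s. t < N \<Longrightarrow> s < t \<Longrightarrow> fmx S M f t s = 0"
    by blast
  have f0: "ip S (f s) (f t) = 0 \<and> fmx S M f s t = 0" if "s < N" "t < N" "s \<noteq> t" for s t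
  proof (cases "s < t")
    case True
    then show ?thesis using f that by auto
  next
    case False
    then have "t < s" using that by simp
    then show ?thesis using f(5)[OF that(1)] f(7)[OF that(1)] by (metis cj_ip cj_0)
  qed
  have onF: "onf S {..<N} f" unfolding onf_def using f0 f(1) by (auto simp: ip_self_1)
  define F where "F \<alpha> = {t\<in>{..<N}. \<beta> t = \<alpha>}" for \<alpha>
  have ipf: "ip S x (f t) = ip (SB (\<beta> t)) x (f t)" if "t < N" for x t
    by (rule ip_support[OF fin]) (use f(2)[OF that] in \<open>auto simp: SB_def\<close>)
  have FS: "card (F \<alpha>) \<le> card (SB \<alpha>)" for \<alpha>
  proof (rule onf_card_le[of _ _ f])
    show "onf (SB \<alpha>) (F \<alpha>) f"
      unfolding onf_def
    proof (intro ballI)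
      fix s t assume "s \<in> F \<alpha>" "t \<in> F \<alpha>"
      then show "ip (SB \<alpha>) (f s) (f t) = (if s = t then 1 else 0)"
        using ipf[of t "f s"] onfD[OF onF, of s t] by (auto simp: F_def)
    qed
  qed (auto simp: finSB F_def)
  define N' where "N' \<alpha> = card (SB \<alpha>) - card (F \<alpha>)" for \<alpha>
  have "\<forall>\<alpha>. \<exists>w. onf (SB \<alpha>) {..<N' \<alpha>} w \<and> (\<forall>j<N' \<alpha>. \<forall>i. i \<notin> SB \<alpha> \<longrightarrow> w j i = 0) \<and>
      (\<forall>j<N' \<alpha>. \<forall>t\<in>F \<alpha>. ip (SB \<alpha>) (f t) (w j) = 0)"
  proof
    fix \<alpha>
    show "\<exists>w. onf (SB \<alpha>) {..<N' \<alpha>} w \<and> (\<forall>j<N' \<alpha>. \<forall>i. i \<notin> SB \<alpha> \<longrightarrow> w j i = 0) \<and>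
      (\<forall>j<N' \<alpha>. \<forall>t\<in>F \<alpha>. ip (SB \<alpha>) (f t) (w j) = 0)"
      by (rule null_family) (use FS[of \<alpha>] in \<open>auto simp: finSB F_def N'_def\<close>)
  qed
  from choice[OF this] obtain r where r: "\<And>\<alpha>. onf (SB \<alpha>) {..<N' \<alpha>} (r \<alpha>)"
    "\<And>\<alpha> j i. j < N' \<alpha> \<Longrightarrow> i \<notin> SB \<alpha> \<Longrightarrow> r \<alpha> j i = 0"
    "\<And>\<alpha> j t. j < N' \<alpha> \<Longrightarrow> t \<in> F \<alpha> \<Longrightarrow> ip (SB \<alpha>) (f t) (r \<alpha> j) = 0" by metis
  define RI where "RI = Sigma Bs (\<lambda>\<alpha>. {..<N' \<alpha>})"
  define rv where "rv = (\<lambda>(\<alpha>, j). r \<alpha> j)"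
  have finRI: "finite RI" by (simp add: RI_def cB)
  have onR: "onf S RI rv" unfolding RI_def rv_def
    by (rule onf_level_sets[OF fin, of "S - E"]) (use r in \<open>simp_all add: SB_def\<close>)
  have fr: "ip S (f t) (rv p) = 0" if t: "t < N" and p: "p \<in> RI" for t p
  proof -
    obtain \<alpha> j where pj: "p = (\<alpha>, j)" "j < N' \<alpha>" using p by (auto simp: RI_def)
    have "ip S (f t) (rv p) = ip (SB \<alpha>) (f t) (r \<alpha> j)"
      using ip_support[OF fin, of "SB \<alpha>" "r \<alpha> j"] r(2)[OF pj(2)] pj by (auto simp: rv_def SB_def)
    also have "\<dots> = 0"
    proof (cases "\<beta> t = \<alpha>")
      case True
      then show ?thesis using r(3)[OF pj(2)] t by (auto simp: F_def)
    next
      case False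
      then show ?thesis using f(2)[OF t] unfolding ip_def by (intro sum.neutral) (auto simp: SB_def)
    qed
    finally show ?thesis .
  qed
  define ind where "ind a = (\<lambda>i. if i = a then 1 else 0 :: complex)" for a :: 'i
  have ipind: "ip S (ind a) x = x a" if "a \<in> S" for a x
    using fin that by (simp add: ip_def ind_def if_distrib[of cnj] if_distrib[of "\<lambda>z. z * _"] cong: if_cong)
  define T where "T = E <+> ({..<N} <+> RI)"
  define u where "u = case_sum ind (case_sum f rv)"
  have fE: "f t a = 0" if "t < N" "a \<in> E" for t a using f(2)[OF that(1), of a] that by (auto simp: SB_def)
  have rE: "rv p a = 0" if "p \<in> RI" "a \<in> E" for p a
  proof -
    obtain \<alpha> j where pj: "p = (\<alpha>, j)" "j < N' \<alpha>" using \<open>p \<in> RI\<close> by (auto simp: RI_def)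
    then show ?thesis using r(2)[OF pj(2), of a] that by (auto simp: rv_def SB_def)
  qed
  have onu: "onf S T u" unfolding T_def u_def
  proof (rule onf_case_sum)
    show "onf S E ind" unfolding onf_def
    proof (intro ballI)
      fix a c assume "a \<in> E" "c \<in> E"
      then have "ip S (ind a) (ind c) = ind c a" using E by (intro ipind) auto
      then show "ip S (ind a) (ind c) = (if a = c then 1 else 0)" by (simp add: ind_def)
    qed
    show "onf S ({..<N} <+> RI) (case_sum f rv)" by (rule onf_case_sum[OF onF onR]) (use fr in auto)
    show "ip S (ind a) (case_sum f rv q) = 0" if "a \<in> E" "q \<in> {..<N} <+> RI" for a q
      using that E fE rE by (auto simp: ipind subset_iff)
  qed
  have finT: "finite T" using finE finRI by (simp add: T_def)
  have cardRI: "card RI + N = n - d"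
  proof -
    have "card (S - E) = (\<Sum>\<alpha>\<in>Bs. card (SB \<alpha>))"
      unfolding SB_def by (rule card_level_sets) (use fin cB bB in auto)
    also have "\<dots> = (\<Sum>\<alpha>\<in>Bs. N' \<alpha> + card (F \<alpha>))" by (rule sum.cong) (use FS in \<open>auto simp: N'_def\<close>)
    also have "\<dots> = card RI + (\<Sum>\<alpha>\<in>Bs. card (F \<alpha>))" by (simp add: sum.distrib RI_def cB)
    also have "(\<Sum>\<alpha>\<in>Bs. card (F \<alpha>)) = card {..<N}"
      unfolding F_def by (rule card_level_sets[symmetric]) (use cB bB in \<open>auto simp: \<beta>_def\<close>)
    finally show ?thesis by (simp add: cSE)
  qed
  have dn: "d \<le> n" using card_mono[OF fin E] by (simp add: d_def n_def)
  have cardT: "card T = card S" using cardRI dn finE finRI by (simp add: T_def card_Plus d_def n_def)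
  define E' where "E' = (Inl ` E :: ('i + nat + int \<times> nat) set)"
  define b' where "b' p = (case p of Inl a \<Rightarrow> 0 | Inr (Inl t) \<Rightarrow> \<beta> t | Inr (Inr (\<alpha>, j)) \<Rightarrow> \<alpha>)" for p :: "'i + nat + int \<times> nat"
  define \<kappa>' where "\<kappa>' p = real_of_int (b' p) / real k" for p
  define M' where "M' = fmx S M u"
  have TE: "E' \<subseteq> T" by (auto simp: E'_def T_def)
  have M'b: "bnd T T M' 1" unfolding M'_def by (rule bnd_fmx[OF onu finT M])
  have R': "bnd T T (remainder E' \<kappa>' M') \<rho>"
  proof -
    have "remainder E' \<kappa>' M' p q = fmx S (remainder E \<kappa> M) u p q" if "p \<in> T" "q \<in> T" for p q
      unfolding M'_def
    proof (rule remainder_fmx[OF fin E onu that TE])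
      fix p i assume "p \<in> E'" "i \<in> S - E"
      then show "u p i = 0" by (auto simp: E'_def u_def ind_def)
    next
      fix p i assume p: "p \<in> T - E'" and i: "i \<in> S" "i \<in> E \<or> \<kappa> i \<noteq> \<kappa>' p"
      have "p \<in> Inr ` ({..<N} <+> RI)" using p by (auto simp: T_def E'_def)
      then consider t where "p = Inr (Inl t)" "t < N" | \<alpha> j where "p = Inr (Inr (\<alpha>, j))" "j < N' \<alpha>"
        by (auto simp: RI_def)
      then show "u p i = 0"
      proof cases
        case 1
        then have "i \<notin> SB (\<beta> t)" using i by (auto simp: SB_def \<kappa>_def \<kappa>'_def b'_def)
        then show ?thesis using f(2) 1 by (simp add: u_def)
      next
        case 2
        then have "i \<notin> SB \<alpha>" using i by (auto simp: SB_def \<kappa>_def \<kappa>'_def b'_def)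
        then show ?thesis using r(2) 2 by (simp add: u_def rv_def)
      qed
    qed
    then show ?thesis using bnd_fmx[OF onu finT Rk] by (subst bnd_cong) auto
  qed
  have tr': "tr T M' = 0" unfolding M'_def using tr_fmx[OF onu fin finT cardT] tr0 by simp
  have sumRI: "\<bar>\<Sum>p\<in>RI. \<kappa>' (Inr (Inr p))\<bar> \<le> real (k * d) + real n * \<rho>"
  proof -
    have "\<bar>\<Sum>p\<in>T - E'. \<kappa>' p\<bar> \<le> real d + real n * \<rho>"
      using skew_part_sum[OF finT TE M'b R' tr'] finE cardT by (simp add: E'_def card_image d_def n_def)
    moreover have "T - E' = Inr ` ({..<N} <+> RI)" by (auto simp: T_def E'_def)
    then have "(\<Sum>p\<in>T - E'. \<kappa>' p) = (\<Sum>t<N. \<kappa>' (Inr (Inl t))) + (\<Sum>p\<in>RI. \<kappa>' (Inr (Inr p)))"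
      using finRI by (simp add: sum.reindex sum.Plus)
    moreover have "\<bar>\<Sum>t<N. \<kappa>' (Inr (Inl t))\<bar> \<le> (\<Sum>t<N. 1)"
      by (rule order_trans[OF sum_abs sum_mono]) (use \<kappa>1 in \<open>auto simp: \<kappa>'_def b'_def \<beta>_def \<kappa>_def\<close>)
    ultimately show ?thesis by (simp add: N_def k' algebra_simps)
  qed
  have kd: "2 * (k * d) \<le> n"
  proof -
    have "d \<le> P" by (simp add: P_def)
    from mult_le_mono2[OF this, of "2 * k"] P have "2 * k * d \<le> n" by linarith
    then show ?thesis by (simp only: mult.assoc)
  qed
  have nmk: "n = m * k" using mk by (simp add: n_def)
  have dm: "d \<le> m"
  proof -
    have "k * d \<le> m * k" using kd nmk by linarith
    then have "d * k \<le> m * k" by (simp only: mult.commute[of d k])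
    then show ?thesis using k by simp
  qed
  have cardRI': "card RI = (m - d) * k"
    using cardRI nmk k' by (simp add: N_def diff_mult_distrib algebra_simps)
  have \<kappa>'1: "\<bar>\<kappa>' (Inr (Inr p))\<bar> \<le> 1" if "p \<in> RI" for p
    using that k by (auto simp: \<kappa>'_def b'_def RI_def Bs_def abs_divide)
  obtain \<psi> where \<psi>: "bij_betw \<psi> ({..<m - d} \<times> {..<k}) RI"
    "\<And>c. c < m - d \<Longrightarrow> \<bar>real (m - d) * (\<Sum>l<k. \<kappa>' (Inr (Inr (\<psi> (c, l))))) - (\<Sum>p\<in>RI. \<kappa>' (Inr (Inr p)))\<bar> \<le> 2 * real (m - d)"
    using balanced_groups[OF finRI cardRI', of "\<lambda>p. \<kappa>' (Inr (Inr p))"] \<kappa>'1 by blast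
  \<comment> \<open>Trace zero is used again, in the new basis: the total over the remaining vectors
    is at most k d + n \<rho>. Spread over m - d groups, where n \<le> 2 (m - d) k, it gives at most
    9 per group, and the imbalance adds 2.\<close>
  have group11: "\<bar>\<Sum>l<k. \<kappa>' (Inr (Inr (\<psi> (c, l))))\<bar> \<le> 11" if c: "c < m - d" for c
  proof -
    let ?G = "\<Sum>l<k. \<kappa>' (Inr (Inr (\<psi> (c, l))))"
    have "\<bar>real (m - d) * ?G\<bar> \<le> 2 * real (m - d) + real (k * d) + real n * \<rho>"
      using \<psi>(2)[OF c] sumRI by linarith
    then have "real (m - d) * \<bar>?G\<bar> \<le> 2 * real (m - d) + real (k * d) + real n * \<rho>"
      by (simp only: abs_mult abs_of_nat)
    moreover have "real (k * d) + real n * \<rho> \<le> 9 * real (m - d)"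
    proof -
      have "(m - d) * k = n - k * d"
        unfolding nmk diff_mult_distrib by (simp only: mult.commute[of d k])
      then have "n \<le> 2 * ((m - d) * k)" using kd by linarith
      then have a: "real n \<le> 2 * (real (m - d) * real k)" by (metis of_nat_mono of_nat_mult of_nat_numeral)
      have "2 * k * (k * d) \<le> n"
      proof -
        have "k * d \<le> P"
        proof (cases d)
          case (Suc d')
          have "k * d \<le> (2 * k + 1) * (2 * d)" by (simp add: algebra_simps)
          also have "\<dots> \<le> (2 * k + 1) * c0" by (intro mult_le_mono2) (simp add: c0_def)
          finally show ?thesis by (simp add: P_def)
        qed simp
        from mult_le_mono2[OF this, of "2 * k"] P show ?thesis by linarith
      qed
      then have b: "2 * real k * real (k * d) \<le> real n" by (metis of_nat_mono of_nat_mult of_nat_numeral)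
      have "real k * (real (k * d) + real n * \<rho>) = real k * real (k * d) + 4 * real n"
        using k by (simp add: \<rho>_def algebra_simps)
      also have "\<dots> \<le> real k * (9 * real (m - d))" using a b by (simp add: algebra_simps)
      finally show ?thesis using k by simp
    qed
    ultimately have "real (m - d) * \<bar>?G\<bar> \<le> real (m - d) * 11" by linarith
    moreover have "0 < real (m - d)" using c by linarith
    ultimately show ?thesis by (rule mult_left_le_imp_le)
  qed
  obtain \<epsilon> where \<epsilon>: "bij_betw \<epsilon> {..<d} E"
    using ex_bij_betw_nat_finite[OF finE] by (auto simp: atLeast0LessThan d_def)
  \<comment> \<open>A group with c < d starts with its element of \<open>E\<close>, followed by the
    k - 1 partners; position l takes the partner l - 1.\<close>
  define \<Psi> where "\<Psi> = (\<lambda>(c, l). if c < d then (if l = 0 then Inl (\<epsilon> c) else Inr (Inl (c * k' + (l - 1)))) else Inr (Inr (\<psi> (c - d, l))))"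
  define I where "I = {..<m} \<times> {..<k}"
  have code: "c * k' + (l - 1) < N" if "c < d" "0 < l" "l < k" for c l
  proof -
    have "c * k' + (l - 1) < Suc c * k'" using that by (simp add: k')
    also have "\<dots> \<le> d * k'" using that by (intro mult_le_mono1) simp
    finally show ?thesis by (simp add: N_def mult.commute)
  qed
  have decode: "(c * k' + (l - 1)) div k' = c" "(c * k' + (l - 1)) mod k' = l - 1" if "0 < l" "l < k" for c l
    using that by (cases l; simp add: k')+
  have \<Psi>T: "\<Psi> ` I \<subseteq> T"
  proof
    fix p assume "p \<in> \<Psi> ` I"
    then obtain c l where cl: "p = \<Psi> (c, l)" "c < m" "l < k" by (auto simp: I_def)
    show "p \<in> T"
    proof (cases "c < d")
      case True
      then show ?thesis using cl \<epsilon> code[of c l] by (auto simp: \<Psi>_def T_def bij_betw_def)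
    next
      case False
      then have "\<psi> (c - d, l) \<in> RI" using \<psi>(1) cl by (auto simp: bij_betw_def)
      then show ?thesis using cl False by (simp add: \<Psi>_def T_def InrI)
    qed
  qed
  have \<Psi>inj: "inj_on \<Psi> I"
  proof (rule inj_onI)
    fix p q assume "p \<in> I" "q \<in> I" and eq: "\<Psi> p = \<Psi> q"
    then obtain c l c' l' where pq: "p = (c, l)" "q = (c', l')" "c < m" "l < k" "c' < m" "l' < k" by (auto simp: I_def)
    consider "c < d" "c' < d" "l = 0" "l' = 0" | "c < d" "c' < d" "0 < l" "0 < l'" | "\<not> c < d" "\<not> c' < d"
      using eq pq by (auto simp: \<Psi>_def split: if_splits)
    then show "p = q"
    proof cases
      case 1
      then show ?thesis using eq pq \<epsilon> by (auto simp: \<Psi>_def bij_betw_def inj_on_def)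
    next
      case 2
      then have e: "c * k' + (l - 1) = c' * k' + (l' - 1)" using eq pq by (simp add: \<Psi>_def)
      have "c = c'" using decode(1)[OF 2(3) pq(4), of c] decode(1)[OF 2(4) pq(6), of c'] e by simp
      moreover have "l - 1 = l' - 1"
        using trans[OF trans[OF sym[OF decode(2)[OF 2(3) pq(4), of c]] arg_cong[OF e, of "\<lambda>x. x mod k'"]] decode(2)[OF 2(4) pq(6), of c']] .
      ultimately show ?thesis using 2 pq by simp
    next
      case 3
      then have "\<psi> (c - d, l) = \<psi> (c' - d, l')" using eq pq by (simp add: \<Psi>_def)
      moreover have "(c - d, l) \<in> {..<m - d} \<times> {..<k}" "(c' - d, l') \<in> {..<m - d} \<times> {..<k}" using 3 pq by auto
      ultimately have "(c - d, l) = (c' - d, l')" using \<psi>(1) by (meson bij_betw_def inj_onD)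
      then show ?thesis using 3 pq by auto
    qed
  qed
  have \<Psi>: "bij_betw \<Psi> I T"
  proof -
    have "card (\<Psi> ` I) = card T" using card_image[OF \<Psi>inj] cardT nmk by (simp add: I_def n_def)
    then have "\<Psi> ` I = T" using card_subset_eq[OF finT \<Psi>T] by simp
    then show ?thesis using \<Psi>inj by (simp add: bij_betw_def)
  qed
  have \<Psi>E: "\<Psi> p \<in> E' \<longleftrightarrow> p \<in> {..<d} \<times> {0}" if "p \<in> I" for p
    using that \<epsilon> by (auto simp: \<Psi>_def E'_def bij_betw_def I_def split: if_splits)
  define M2 where "M2 p q = M' (\<Psi> p) (\<Psi> q)" for p q
  have "paved k ((1 + 11) / real k + 3 * \<rho>) I M2"
  proof (rule paved_groups[OF k dm I_def refl, where \<kappa> = "\<lambda>p. \<kappa>' (\<Psi> p)"])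
    show "bnd I I M2 1" unfolding M2_def by (rule bnd_reindex[OF \<Psi> finT M'b])
    have "remainder ({..<d} \<times> {0}) (\<lambda>p. \<kappa>' (\<Psi> p)) M2 p q = remainder E' \<kappa>' M' (\<Psi> p) (\<Psi> q)"
      if "p \<in> I" "q \<in> I" for p q
      using \<Psi>E[OF that(1)] \<Psi>E[OF that(2)] inj_on_eq_iff[OF \<Psi>inj that] by (simp add: remainder_def M2_def)
    then show "bnd I I (remainder ({..<d} \<times> {0}) (\<lambda>p. \<kappa>' (\<Psi> p)) M2) \<rho>"
      using bnd_reindex[OF \<Psi> finT R'] by (subst bnd_cong) auto
    show "tr I M2 = 0" using tr' sum.reindex_bij_betw[OF \<Psi>, of "\<lambda>p. M' p p"] by (simp add: tr_def M2_def)
  next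
    fix c l l' assume c: "c < d" and l: "l < k" "l' < k" "l \<noteq> l'"
    have cE: "\<epsilon> c \<in> E" "\<epsilon> c \<in> S" using \<epsilon> c E by (auto simp: bij_betw_def)
    show "M2 (c, l) (c, l') = 0"
    proof (cases "l = 0")
      case True
      then have "M2 (c, l) (c, l') = mv S M (f (c * k' + (l' - 1))) (\<epsilon> c)"
        using c l cE by (simp add: M2_def \<Psi>_def M'_def fmx_def u_def ipind)
      then show ?thesis using f(3)[OF code[OF c _ l(2)] cE(1)] True l by simp
    next
      case False
      show ?thesis
      proof (cases "l' = 0")
        case True
        have "M2 (c, l) (c, l') = ip S (f (c * k' + (l - 1))) (mv S M (ind (\<epsilon> c)))"
          using c l False True by (simp add: M2_def \<Psi>_def M'_def fmx_def u_def)
        also have "\<dots> = cj (ip S (ind (\<epsilon> c)) (mv S (adj M) (f (c * k' + (l - 1)))))"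
          unfolding cj_ip by (rule ip_adj)
        also have "\<dots> = 0" using f(4)[OF code[OF c _ l(1)] cE(1)] False cE by (simp add: ipind)
        finally show ?thesis .
      next
        case False
        have "c * k' + (l - 1) \<noteq> c * k' + (l' - 1)" using l \<open>l \<noteq> 0\<close> False by simp
        then have "fmx S M f (c * k' + (l - 1)) (c * k' + (l' - 1)) = 0"
          using f0 code[OF c _ l(1)] code[OF c _ l(2)] \<open>l \<noteq> 0\<close> False by blast
        then show ?thesis using c \<open>l \<noteq> 0\<close> False by (simp add: M2_def \<Psi>_def M'_def fmx_def u_def)
      qed
    qed
  next
    fix c assume c: "c < m"
    show "\<bar>\<Sum>l<k. \<kappa>' (\<Psi> (c, l))\<bar> \<le> 11"
    proof (cases "c < d")
      case True
      have "(\<Sum>l<k. \<kappa>' (\<Psi> (c, l))) = \<kappa>' (\<Psi> (c, 0)) + (\<Sum>l<k'. \<kappa>' (\<Psi> (c, Suc l)))"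
        unfolding k' by (rule sum.lessThan_Suc_shift)
      also have "\<kappa>' (\<Psi> (c, 0)) = 0" using True by (simp add: \<Psi>_def \<kappa>'_def b'_def)
      also have "(\<Sum>l<k'. \<kappa>' (\<Psi> (c, Suc l))) = (\<Sum>l<k'. \<kappa> (\<gamma> l))"
        by (rule sum.cong) (use True in \<open>auto simp: \<Psi>_def \<kappa>'_def b'_def \<beta>_def \<kappa>_def\<close>)
      finally show ?thesis using \<gamma>11 by simp
    next
      case False
      then show ?thesis using group11[of "c - d"] c by (simp add: \<Psi>_def)
    qed
  next
    fix c assume "c < d"
    then show "\<kappa>' (\<Psi> (c, 0)) = 0" by (simp add: \<Psi>_def \<kappa>'_def b'_def)
  qed (auto simp: \<rho>_def)
  \<comment> \<open>(1 + 11) / k + 3 (4 / k) = 24 / k.\<close>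
  then have "paved k (24 / real k) I M2" by (simp add: \<rho>_def)
  then have "paved k (24 / real k) T M'" unfolding M2_def by (rule paved_reindex[OF \<Psi> finT])
  then show ?thesis unfolding M'_def by (rule paved_transfer[OF onu finT cardT])
qed

subsection \<open>Thin matrices\<close>

lemma paved_unit_smult:
  assumes p: "paved k g S (\<lambda>i j. \<zeta> * M i j)" and z: "cmod \<zeta> = 1"
  shows "paved k g S M"
proof -
  have cz: "cnj \<zeta> * \<zeta> = 1"
    using z by (simp add: complex_norm_square[symmetric] mult.commute)
  from p obtain m u where u: "card S = m * k" "onf S ({..<m} \<times> {..<k}) u"
    and pc: "\<forall>j<k. tr {..<m} (\<lambda>c d. fmx S (\<lambda>i j. \<zeta> * M i j) u (c, j) (d, j)) = 0 \<and>
        bnd {..<m} {..<m} (\<lambda>c d. fmx S (\<lambda>i j. \<zeta> * M i j) u (c, j) (d, j)) g"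
    unfolding paved_def by blast
  have eq: "fmx S M u p q = cnj \<zeta> * fmx S (\<lambda>i j. \<zeta> * M i j) u p q" for p q
    using cz by (simp add: fmx_smult mult.assoc[symmetric])
  have "tr {..<m} (\<lambda>c d. fmx S M u (c, j) (d, j)) = 0 \<and>
        bnd {..<m} {..<m} (\<lambda>c d. fmx S M u (c, j) (d, j)) g" if "j < k" for j
  proof
    show "tr {..<m} (\<lambda>c d. fmx S M u (c, j) (d, j)) = 0"
      using pc that unfolding eq tr_def by (simp add: sum_distrib_left[symmetric])
    have "bnd {..<m} {..<m} (\<lambda>c d. fmx S (\<lambda>i j. \<zeta> * M i j) u (c, j) (d, j)) g"
      using pc that by blast
    from bnd_smult[OF this, of "cnj \<zeta>"] show "bnd {..<m} {..<m} (\<lambda>c d. fmx S M u (c, j) (d, j)) g"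
      unfolding eq using z by simp
  qed
  with u show ?thesis unfolding paved_def by blast
qed

lemma bnd_half_sum:
  fixes A B :: "'i \<Rightarrow> 'i \<Rightarrow> complex"
  assumes "bnd S S A 1" "bnd S S B 1" "cmod z = 1 / 2"
  shows "bnd S S (\<lambda>i j. z * (A i j + B i j)) 1" "bnd S S (\<lambda>i j. z * (A i j - B i j)) 1"
  using bnd_smult[OF bnd_add[OF assms(1,2)], of z] bnd_smult[OF bnd_diff[OF assms(1,2)], of z] assms(3)
  by simp_all

text \<open>Write M = H + i K with self-adjoint H and K. The real part of the form of
  \<open>M\<close> is the form of H, so the hypothesis concerns H alone; in an eigenbasis of K the
  matrix has the shape that \<open>thin_normal_form\<close> expects.\<close>

lemma one_sided_paved:
  fixes M :: "'i \<Rightarrow> 'i \<Rightarrow> complex"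
  assumes fin: "finite S" and M: "bnd S S M 1" and tr0: "tr S M = 0" and k: "0 < k"
    and e: "onf S {..<d::nat} e"
    and q: "\<And>x. (\<forall>i<d. ip S (e i) x = 0) \<Longrightarrow>
       0 \<le> Re (ip S x (mv S M x)) \<and> Re (ip S x (mv S M x)) \<le> (1 / real k) * (nrm S x)\<^sup>2"
    and mk: "card S = m * k"
    and large: "2 * k * (2 * d * (2 * k + 1) + (2 * k + 1) * (3 * k * (2 * d * (2 * k + 1)) + 1)) \<le> card S"
  shows "paved k (24 / real k) S M"
proof -
  define H where "H = (\<lambda>i j. (1/2) * (M i j + adj M i j))"
  define K where "K = (\<lambda>i j. (- \<i>/2) * (M i j - adj M i j))"
  have HK: "M i j = H i j + \<i> * K i j" for i j
    unfolding H_def K_def by (simp add: algebra_simps)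
  have Hh: "\<forall>i\<in>S. \<forall>j\<in>S. H j i = cj (H i j)" and Kh: "\<forall>i\<in>S. \<forall>j\<in>S. K j i = cj (K i j)"
    unfolding H_def K_def adj_def by (simp_all add: algebra_simps)
  have bK: "bnd S S K 1"
    unfolding K_def by (rule bnd_half_sum(2)[OF M bnd_adj[OF M]]) (simp_all add: norm_divide)
  let ?n = "card S" let ?T = "{..<card S}"
  obtain u where u: "onf S ?T u" and uK: "\<forall>p<?n. \<forall>r<?n. p \<noteq> r \<longrightarrow> fmx S K u p r = 0"
    using spectral_basis[OF fin Kh] by blast
  have cT: "finite ?T" "card ?T = card S" by simp_all
  define \<kappa>0 where "\<kappa>0 = (\<lambda>p. Re (fmx S K u p p))"
  have Kr: "fmx S K v p p = of_real (Re (fmx S K v p p))" for v :: "'c \<Rightarrow> 'i \<Rightarrow> complex" and p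
  proof -
    have "fmx S K v p p = cnj (fmx S K v p p)"
      using fmx_self_adjoint[OF Kh, of v p p] unfolding cj_cnj .
    then have "Im (fmx S K v p p) = 0" by (metis cnj.simps(2) equal_neg_zero)
    then show ?thesis by (simp add: complex_eq_iff)
  qed
  have fM: "fmx S M v p r = fmx S H v p r + \<i> * fmx S K v p r" for v :: "'c \<Rightarrow> 'i \<Rightarrow> complex" and p r
  proof -
    have "fmx S M v p r = fmx S (\<lambda>i j. H i j + \<i> * K i j) v p r" using HK by presburger
    then show ?thesis by (simp only: fmx_add fmx_smult)
  qed
  define M1 where "M1 = fmx S M u"
  define H1 where "H1 = fmx S H u"
  have M1: "M1 p r = H1 p r + (if p = r then \<i> * of_real (\<kappa>0 p) else 0)" if "p \<in> ?T" "r \<in> ?T" for p r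
    using that uK Kr[of u p] unfolding M1_def H1_def fM \<kappa>0_def by (cases "p = r") auto
  have H1: "\<forall>p\<in>?T. \<forall>r\<in>?T. H1 r p = cj (H1 p r)"
    unfolding H1_def using fmx_self_adjoint[OF Hh, of u] by blast
  have \<kappa>0: "\<bar>\<kappa>0 p\<bar> \<le> 1" if "p \<in> ?T" for p
  proof -
    have "cmod (fmx S K u p p) \<le> 1"
      using bnd_entry[OF bnd_fmx[OF u cT(1) bK] cT(1) cT(1) that that] .
    then show ?thesis unfolding \<kappa>0_def using abs_Re_le_cmod order_trans by blast
  qed
  define e' where "e' = (\<lambda>j p. ip S (u p) (e j))"
  have ex: "e j i = lin ?T u (e' j) i" if "i \<in> S" for j i
    unfolding e'_def lin_def using onf_expand[OF u fin cT that, of "e j"] .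
  have ipe: "ip S (e j) y = ip S (lin ?T u (e' j)) y" for j y
    by (rule ip_cong) (simp_all add: ex)
  have ipe2: "ip S (lin ?T u c) (e j) = ip S (lin ?T u c) (lin ?T u (e' j))" for j c
    by (rule ip_cong) (simp_all add: ex)
  have e'on: "onf ?T {..<d} e'"
    unfolding onf_def
  proof (intro ballI)
    fix a b assume ab: "a \<in> {..<d}" "b \<in> {..<d}"
    have "ip ?T (e' a) (e' b) = ip S (e a) (e b)"
      by (simp only: ipe ipe2 ip_lin_lin[OF u cT(1)])
    then show "ip ?T (e' a) (e' b) = (if a = b then 1 else 0)"
      using onfD[OF e ab] by simp
  qed
  have q': "0 \<le> Re (ip ?T x (mv ?T H1 x)) \<and> Re (ip ?T x (mv ?T H1 x)) \<le> (1 / real k) * (nrm ?T x)\<^sup>2"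
    if x: "\<forall>j<d. ip ?T (e' j) x = 0" for x
  proof -
    define y where "y = lin ?T u x"
    have y: "\<forall>j<d. ip S (e j) y = 0"
      using x unfolding y_def ipe by (simp add: ip_lin_lin[OF u cT(1)])
    have "ip ?T x (mv ?T H1 x) = fmx S H (\<lambda>r::unit. y) () ()"
      using fun_cong[OF fun_cong[OF fmx_lin[of S H ?T u "\<lambda>r::unit. x"]], of "()" "()"]
      unfolding H1_def y_def by (simp add: fmx_def)
    moreover have "ip S y (mv S M y) = fmx S H (\<lambda>r::unit. y) () () + \<i> * fmx S K (\<lambda>r::unit. y) () ()"
      using fM[of "\<lambda>r::unit. y" "()" "()"] by (simp add: fmx_def)
    then have "Re (ip S y (mv S M y)) = Re (fmx S H (\<lambda>r::unit. y) () ())"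
      using Kr[of "\<lambda>r::unit. y" "()"] by (metis Re_i_times add.right_neutral Im_complex_of_real plus_complex.simps(1) neg_equal_0_iff_equal)
    moreover have "nrm S y = nrm ?T x" unfolding y_def using nrm_lin[OF u cT(1)] .
    ultimately show ?thesis using q[OF y] by simp
  qed
  obtain T2 :: "(nat + int \<times> nat) set" and v E b where v: "finite T2" "card T2 = card ?T" "onf ?T T2 v" "E \<subseteq> T2"
    and cE: "card E \<le> 2 * d * (2 * k + 1)" and b: "\<forall>p. \<bar>b p\<bar> \<le> int k"
    and R: "bnd T2 T2 (remainder E (\<lambda>p. real_of_int (b p) / real k) (fmx ?T M1 v)) (4 / real k)"
    using thin_normal_form[OF cT(1) k M1 H1 e'on q' \<kappa>0] k
    by (auto simp del: lessThan_iff)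
  have bM1: "bnd ?T ?T M1 1" unfolding M1_def by (rule bnd_fmx[OF u cT(1) M])
  have tM1: "tr ?T M1 = 0" unfolding M1_def using tr_fmx[OF u fin cT] tr0 by simp
  have l2: "2 * k * (card E + (2 * k + 1) * (3 * k * card E + 1)) \<le> card T2"
  proof -
    have "2 * k * (card E + (2 * k + 1) * (3 * k * card E + 1)) \<le>
      2 * k * (2 * d * (2 * k + 1) + (2 * k + 1) * (3 * k * (2 * d * (2 * k + 1)) + 1))"
      by (intro mult_le_mono add_le_mono order_refl cE)
    then show ?thesis using large unfolding v(2) card_lessThan by (rule order_trans)
  qed
  have "paved k (24 / real k) T2 (fmx ?T M1 v)"
  proof (rule paved_normal_form[OF v(1,4) k _ bnd_fmx[OF v(3,1) bM1] R _ _ l2])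
    show "\<bar>b i\<bar> \<le> int k" for i using b by blast
    show "tr T2 (fmx ?T M1 v) = 0" using tr_fmx[OF v(3) cT(1) v(1,2)] tM1 by simp
    show "card T2 = m * k" using v(2) mk by simp
  qed
  from paved_transfer[OF v(3,1,2) this] have "paved k (24 / real k) ?T M1" .
  then show ?thesis unfolding M1_def by (rule paved_transfer[OF u cT])
qed

text \<open>The dimension demanded by \<open>one_sided_paved\<close> for d = L (k + 1), the number
  of exceptional directions that \<open>one_sided_form\<close> leaves for t = 1/k.\<close>

definition thin_dim :: "nat \<Rightarrow> nat \<Rightarrow> nat" where
  "thin_dim k L = 2 * k * (2 * (L * (k + 1)) * (2 * k + 1) +
     (2 * k + 1) * (3 * k * (2 * (L * (k + 1)) * (2 * k + 1)) + 1))"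

lemma thin_paved:
  fixes M :: "'i \<Rightarrow> 'i \<Rightarrow> complex"
  assumes fin: "finite S" and M: "bnd S S M 1" and tr0: "tr S M = 0" and k: "0 < k"
    and th: "thin S M L" and mk: "card S = m * k" and large: "thin_dim k L \<le> card S"
  shows "paved k (24 / real k) S M"
proof -
  obtain g :: "nat \<Rightarrow> 'i \<Rightarrow> complex" and \<zeta> where z: "cmod \<zeta> = 1"
    and pos: "\<forall>x. (\<forall>j<L. ip S (g j) x = 0) \<longrightarrow> 0 \<le> Re (\<zeta> * ip S x (mv S M x))"
    using th unfolding thin_def by blast
  define N where "N = (\<lambda>i j. \<zeta> * M i j)"
  have mvN: "mv S N x = (\<lambda>i. \<zeta> * mv S M x i)" for x
    unfolding N_def mv_def by (simp add: sum_distrib_left mult.assoc)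
  have ipN: "ip S x (mv S N y) = \<zeta> * ip S x (mv S M y)" for x y
    unfolding mvN by (rule ip_smult_right)
  have bN: "bnd S S N 1" unfolding N_def using bnd_smult[OF M, of \<zeta>] z by simp
  have tN: "tr S N = 0" using tr0 unfolding N_def tr_def by (simp add: sum_distrib_left[symmetric])
  obtain d e where de: "onf S {..<d::nat} e" and dl: "real d \<le> real L + real L / (1 / real k)"
    and q: "\<forall>x. (\<forall>i<d. ip S (e i) x = 0) \<longrightarrow>
       0 \<le> Re (ip S x (mv S N x)) \<and> Re (ip S x (mv S N x)) \<le> (1 / real k) * (nrm S x)\<^sup>2"
  proof -
    have "Re (tr S N) = 0" "0 < 1 / real k" using tN k by simp_all
    moreover have "0 \<le> Re (ip S x (mv S N x))" if "\<forall>j<L. ip S (g j) x = 0" for x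
      using pos that unfolding ipN by blast
    ultimately show thesis
      using one_sided_form[OF fin bN, of L g "1 / real k"] that by blast
  qed
  have "real d \<le> real (L * (k + 1))" using dl k by (simp add: field_simps)
  then have d: "d \<le> L * (k + 1)" by linarith
  have "2 * k * (2 * d * (2 * k + 1) + (2 * k + 1) * (3 * k * (2 * d * (2 * k + 1)) + 1)) \<le> thin_dim k L"
    unfolding thin_dim_def by (intro mult_le_mono add_le_mono order_refl d)
  then have "paved k (24 / real k) S N"
    using q large by (intro one_sided_paved[OF fin bN tN k de _ mk]) auto
  then show ?thesis unfolding N_def by (rule paved_unit_smult[OF _ z])
qed

text \<open>The induction hypothesis. Natural numbers as indices fix one type for all
  dimensions.\<close>

definition solved :: "nat \<Rightarrow> real \<Rightarrow> bool" where
  "solved n K \<longleftrightarrow> (\<forall>m<n. \<forall>N :: nat \<Rightarrow> nat \<Rightarrow> complex.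
     bnd {..<m} {..<m} N 1 \<longrightarrow> tr {..<m} N = 0 \<longrightarrow> cm {..<m} N 1 K)"

lemma solvedD:
  fixes N :: "nat \<Rightarrow> nat \<Rightarrow> complex"
  shows "solved n K \<Longrightarrow> m < n \<Longrightarrow> bnd {..<m} {..<m} N 1 \<Longrightarrow> tr {..<m} N = 0 \<Longrightarrow> cm {..<m} N 1 K"
  unfolding solved_def by blast

text \<open>A paving needs a dimension divisible by \<open>k\<close>. The surplus is removed by
  peeling off vectors with vanishing form, and compressions stay thin.\<close>

lemma cm_thin_shrink:
  fixes M :: "nat \<Rightarrow> nat \<Rightarrow> complex"
  assumes base: "\<And>N :: nat \<Rightarrow> nat \<Rightarrow> complex. bnd {..<n} {..<n} N 1 \<Longrightarrow> tr {..<n} N = 0 \<Longrightarrow>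
      thin {..<n} N L \<Longrightarrow> cm {..<n} N b c"
    and nn: "0 \<le> b" "0 \<le> c" "0 < \<eta>"
  shows "bnd {..<n + r} {..<n + r} M 1 \<Longrightarrow> tr {..<n + r} M = 0 \<Longrightarrow> thin {..<n + r} M L \<Longrightarrow>
    cm {..<n + r} M (b + real r * \<eta>) (c + real r * (4 / \<eta>))"
proof (induction r arbitrary: M)
  case 0
  then show ?case using base by simp
next
  case (Suc r)
  let ?S = "{..<n + Suc r}"
  have S: "finite ?S" "?S \<noteq> {}" "card ?S = Suc (n + r)" by auto
  obtain v where v: "nrm ?S v = 1" "ip ?S v (mv ?S M v) = 0"
    using average_vector[OF S(1,2), of M] Suc.prems(2) by auto
  obtain w where w: "onf ?S {..<n + r} w" "\<forall>k<n + r. ip ?S v (w k) = 0"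
    and tw: "tr {..<n + r} (fmx ?S M w) = 0"
    using vector_split[OF S(1,3) v(1), of M] v(2) Suc.prems(2) by auto
  have "cm {..<n + r} (fmx ?S M w) (b + real r * \<eta>) (c + real r * (4 / \<eta>))"
    by (rule Suc.IH[OF bnd_fmx[OF w(1) _ Suc.prems(1)] tw thin_fmx[OF Suc.prems(3)]]) simp
  from cm_peel_vector[OF S(1,3) Suc.prems(1) v w this _ _ nn(3)] nn
  have "cm ?S M (b + real r * \<eta> + \<eta>) (c + real r * (4 / \<eta>) + 4 / \<eta>)" by simp
  then show ?case by (simp add: algebra_simps add_divide_distrib)
qed

lemma nat_frame: "finite S \<Longrightarrow> \<exists>u :: nat \<Rightarrow> 'i \<Rightarrow> complex. onf S {..<card S} u"
  using null_family[of "{}::nat set" S "card S" "\<lambda>_ _. 0"] by auto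

text \<open>The paving norm 24/k leads to 8 s (24/k) K = 192 K / s, as k = s^2. Fewer than k vectors
  are peeled off before; with \<eta> = 1/k they cost at most 1 in the first bound and 4 k^2 in the
  second.\<close>

lemma cm_thin:
  fixes M :: "'i \<Rightarrow> 'i \<Rightarrow> complex"
  assumes fin: "finite S" and M: "bnd S S M 1" and tr0: "tr S M = 0" and k: "k = s * s" and s: "2 \<le> s"
    and th: "thin S M L" and large: "thin_dim k L + k \<le> card S" and K: "0 \<le> K" and IH: "solved (card S) K"
  shows "cm S M 2 (192 / real s * K + 4 * real s ^ 5 + 4 * (real k)\<^sup>2)"
proof -
  have k0: "0 < k" using k s by simp
  let ?r = "card S mod k" let ?m = "card S div k"
  have nr: "card S = ?m * k + ?r" by simp
  have rk: "?r < k" using k0 by simp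
  have td: "thin_dim k L \<le> ?m * k" using large nr rk by linarith
  have mp: "0 < ?m * k" using large nr rk k0 by linarith
  let ?c = "192 / real s * K + 4 * real s ^ 5"
  have c0: "0 \<le> ?c" using K by simp
  have base: "cm {..<?m * k} N 1 ?c" if N: "bnd {..<?m * k} {..<?m * k} N 1" "tr {..<?m * k} N = 0" "thin {..<?m * k} N L"
    for N :: "nat \<Rightarrow> nat \<Rightarrow> complex"
  proof -
    let ?S = "{..<?m * k}"
    have p: "paved (s * s) (24 / real k) ?S N"
      using thin_paved[OF _ N(1,2) k0 N(3), of ?m] td k by simp
    have "cm ?S N 1 (8 * real s * (24 / real k) * K + 4 * real s ^ 5)"
    proof (rule cm_paved[OF _ N(1) s _ _ K _ p])
      fix m' and N' :: "nat \<Rightarrow> nat \<Rightarrow> complex"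
      assume "m' < card ?S" "bnd {..<m'} {..<m'} N' 1" "tr {..<m'} N' = 0"
      moreover have "m' < card S" using calculation(1) by (simp only: card_lessThan) (metis div_mult_mod_eq le_add1 order_less_le_trans)
      ultimately show "cm {..<m'} N' 1 K" using solvedD[OF IH] by blast
    qed (use mp k0 in \<open>auto simp: lessThan_empty_iff\<close>)
    moreover have "8 * real s * (24 / real k) = 192 / real s" using k s by simp
    ultimately show ?thesis by (simp only:)
  qed
  obtain u :: "nat \<Rightarrow> 'i \<Rightarrow> complex" where u: "onf S {..<card S} u" using nat_frame[OF fin] by blast
  let ?N = "fmx S M u"
  have "bnd {..<card S} {..<card S} ?N 1" "tr {..<card S} ?N = 0" "thin {..<card S} ?N L"
    using bnd_fmx[OF u _ M] tr_fmx[OF u fin, of M] tr0 thin_fmx[OF th] by simp_all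
  then have "cm {..<card S} ?N (1 + real ?r * (1 / real k)) (?c + real ?r * (4 / (1 / real k)))"
    using cm_thin_shrink[of "?m * k" L 1 ?c "1 / real k" ?r ?N] base c0 k0 unfolding nr[symmetric] by auto
  moreover have "1 + real ?r * (1 / real k) \<le> 2" using rk k0 by (simp add: field_simps)
  moreover have "real ?r * (4 / (1 / real k)) \<le> 4 * (real k)\<^sup>2"
    using rk by (simp add: power2_eq_square mult_right_mono)
  ultimately have "cm {..<card S} ?N 2 (?c + 4 * (real k)\<^sup>2)"
    by (elim cm_mono) linarith+
  then show ?thesis using cm_transfer[OF u fin] by simp
qed

subsection \<open>A large zero block\<close>

lemma ip_unit:
  fixes y :: "'i \<Rightarrow> 'a::star_field"
  assumes "finite S" "j \<in> S"
  shows "ip S (\<lambda>i. if i = j then 1 else 0) y = y j"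
proof -
  have "ip S (\<lambda>i. if i = j then 1 else 0) y = (\<Sum>i\<in>S. if i = j then y i else 0)"
    unfolding ip_def by (rule sum.cong) auto
  then show ?thesis using assms by simp
qed

lemma ip_commute_zero: "ip S x y = 0 \<Longrightarrow> ip S y x = 0"
  by (metis cj_ip cj_0)

lemma fmx_zero_block:
  assumes "\<And>i j. i \<in> F \<Longrightarrow> j \<in> F \<Longrightarrow> M i j = 0"
    and "\<And>i. i \<in> S - F \<Longrightarrow> u p i = 0" "\<And>i. i \<in> S - F \<Longrightarrow> u q i = 0"
  shows "fmx S M u p q = 0"
  unfolding fmx_sum
proof (intro sum.neutral ballI)
  fix i j assume "i \<in> S" "j \<in> S"
  then show "cj (u p i) * M i j * u q j = 0" using assms by (cases "i \<in> F"; cases "j \<in> F") auto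
qed

text \<open>Each basis vector of \<open>E\<close> is grouped with \<open>k - 1\<close> vectors of \<open>F\<close> that are orthogonal to the images of
  \<open>E\<close> under \<open>M\<close> and its adjoint, which spreads the block on \<open>E\<close> over \<open>k\<close> blocks of norm \<open>1/k\<close>.\<close>

lemma cm_spread:
  fixes M :: "'i \<Rightarrow> 'i \<Rightarrow> complex"
  assumes fin: "finite S" and S: "S = F \<union> E" "F \<inter> E = {}" and M: "bnd S S M 1" and tr0: "tr S M = 0"
    and zero: "\<And>i j. i \<in> F \<Longrightarrow> j \<in> F \<Longrightarrow> M i j = 0" and large: "(k + 2) * card E \<le> card F"
    and k: "k = s * s" and s: "2 \<le> s" and K: "0 \<le> K" and IH: "solved (card S) K"
  shows "cm S M 2 (8 / real s * K + 4 * real s ^ 5 + 4)"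
proof (cases "E = {}")
  case True
  then show ?thesis using S zero K by (intro cm_zero) auto
next
  case False
  have finF: "finite F" "finite E" using fin S by auto
  have k0: "0 < k" using k s by simp
  define d where "d = card E"
  have d0: "0 < d" using False finF by (simp add: d_def card_gt_0_iff)
  obtain h where h: "bij_betw h {..<d} E"
    using ex_bij_betw_nat_finite[OF finF(2)] unfolding d_def atLeast0LessThan by blast
  have hE: "h c \<in> E" "h c \<in> S" "h c \<notin> F" if "c < d" for c
    using bij_betwE[OF h] that S by auto
  define N where "N = (k - 1) * d"
  have kd: "k * d = d + N" using k0 unfolding N_def by (cases k) auto
  define g where "g = case_sum (\<lambda>a i. cnj (M a i)) (\<lambda>a i. M i a)"
  have "card (E <+> E) + N \<le> card F"
    using large kd finF(2) unfolding d_def by (simp add: card_Plus algebra_simps)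
  then obtain w where w: "onf F {..<N} w" and w0: "\<forall>t<N. \<forall>i. i \<notin> F \<longrightarrow> w t i = 0"
    and gw: "\<forall>t<N. \<forall>j\<in>E <+> E. ip F (g j) (w t) = 0"
    using null_family[of "E <+> E" F N g] finF by auto
  have FS: "F \<subseteq> S" using S by auto
  have ipw: "ip S x (w t) = ip F x (w t)" if "t < N" for x t
    by (rule ip_support[OF fin FS]) (use w0 that in auto)
  have gl: "ip S (\<lambda>i. cnj (M a i)) (w t) = 0" "ip S (\<lambda>i. M i a) (w t) = 0" if "a \<in> E" "t < N" for a t
    using gw[rule_format, OF that(2), of "Inl a"] gw[rule_format, OF that(2), of "Inr a"] that
    unfolding ipw[OF that(2)] by (auto simp: g_def)
  define un where "un = (\<lambda>c i. if i = h c then 1 else 0 :: complex)"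
  define u where "u = (\<lambda>(c, l). if l = 0 then un c else w ((l - 1) * d + c))"
  define T where "T = {..<d} \<times> {..<k}"
  have idx: "(l - 1) * d + c < N" if "c < d" "l < k" "l \<noteq> 0" for c l
  proof -
    have "(l - 1) * d + c < (l - 1) * d + d" using that by simp
    also have "\<dots> = l * d" using that by (cases l) auto
    also have "\<dots> \<le> (k - 1) * d" using that by (intro mult_le_mono1) linarith
    finally show ?thesis unfolding N_def .
  qed
  have inj: "c = c' \<and> l = l'" if "c < d" "c' < d" "l \<noteq> 0" "l' \<noteq> 0" "(l - 1) * d + c = (l' - 1) * d + c'" for c c' l l'
  proof -
    have dm: "(a * d + b) mod d = b" "(a * d + b) div d = a" if "b < d" for a b
      using that by simp_all
    have "c = c'" "l - 1 = l' - 1"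
      using dm[OF that(1), of "l - 1"] dm[OF that(2), of "l' - 1"] that(5) by (simp_all only:)
    with that(3,4) show ?thesis by linarith
  qed
  have ipun: "ip S (un c) y = y (h c)" if "c < d" for c y
    unfolding un_def by (rule ip_unit[OF fin hE(2)[OF that]])
  have unun: "un c' (h c) = (if c = c' then 1 else 0)" if "c < d" "c' < d" for c c'
    using bij_betw_imp_inj_on[OF h] that unfolding un_def by (auto dest: inj_onD)
  have finT: "finite T" unfolding T_def by simp
  have onu: "onf S T u"
    unfolding onf_def
  proof (intro ballI)
    fix p q assume pq: "p \<in> T" "q \<in> T"
    obtain c l c' l' where e: "p = (c, l)" "q = (c', l')" by (cases p; cases q) blast
    have b: "c < d" "l < k" "c' < d" "l' < k" using pq e by (auto simp: T_def)
    consider "l = 0" "l' = 0" | "l = 0" "l' \<noteq> 0" | "l \<noteq> 0" "l' = 0" | "l \<noteq> 0" "l' \<noteq> 0" by blast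
    then show "ip S (u p) (u q) = (if p = q then 1 else 0)"
    proof cases
      case 1 then show ?thesis using ipun[OF b(1)] unun[OF b(1,3)] by (simp add: e u_def)
    next
      case 2
      have "w ((l' - 1) * d + c') (h c) = 0" using w0 idx[OF b(3,4) 2(2)] hE(3)[OF b(1)] by blast
      then show ?thesis using 2 ipun[OF b(1)] by (simp add: e u_def)
    next
      case 3
      have "w ((l - 1) * d + c) (h c') = 0" using w0 idx[OF b(1,2) 3(1)] hE(3)[OF b(3)] by blast
      then have "ip S (un c') (w ((l - 1) * d + c)) = 0" using ipun[OF b(3)] by simp
      from ip_commute_zero[OF this] show ?thesis using 3 by (simp add: e u_def)
    next
      case 4
      have "ip S (u p) (u q) = (if (l - 1) * d + c = (l' - 1) * d + c' then 1 else 0)"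
        using onfD[OF w, of "(l - 1) * d + c" "(l' - 1) * d + c'"] idx[OF b(1,2) 4(1)] idx[OF b(3,4) 4(2)] 4
        by (simp add: e u_def ipw)
      also have "\<dots> = (if p = q then 1 else 0)" using inj[OF b(1,3) 4] by (auto simp: e)
      finally show ?thesis .
    qed
  qed
  define M' where "M' = fmx S M u"
  have mvun: "mv S M (un c) = (\<lambda>i. M i (h c))" if "c < d" for c
    unfolding un_def by (rule ext, rule mv_unit[OF fin hE(2)[OF that]])
  have M'0: "M' (c, l) (c', l') = 0" if b: "c < d" "l < k" "c' < d" "l' < k" and ne: "l \<noteq> 0 \<or> l' \<noteq> 0" for c l c' l'
  proof -
    consider "l = 0" "l' \<noteq> 0" | "l \<noteq> 0" "l' = 0" | "l \<noteq> 0" "l' \<noteq> 0" using ne by blast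
    then show ?thesis
    proof cases
      case 1
      have "M' (c, l) (c', l') = ip S (\<lambda>i. cnj (M (h c) i)) (w ((l' - 1) * d + c'))"
        using 1 ipun[OF b(1)] by (simp add: M'_def fmx_def u_def ip_def mv_def)
      then show ?thesis using gl(1)[OF hE(1)[OF b(1)] idx[OF b(3,4) 1(2)]] by simp
    next
      case 2
      have "M' (c, l) (c', l') = ip S (w ((l - 1) * d + c)) (\<lambda>i. M i (h c'))"
        using 2 mvun[OF b(3)] by (simp add: M'_def fmx_def u_def)
      then show ?thesis using ip_commute_zero[OF gl(2)[OF hE(1)[OF b(3)] idx[OF b(1,2) 2(1)]]] by simp
    next
      case 3
      show ?thesis unfolding M'_def
        by (rule fmx_zero_block[OF zero])
          (use w0 idx[OF b(1,2) 3(1)] idx[OF b(3,4) 3(2)] 3 in \<open>auto simp: u_def\<close>)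
    qed
  qed
  have M'00: "M' (c, 0) (c, 0) = M (h c) (h c)" if "c < d" for c
    using ipun[OF that] mvun[OF that] by (simp add: M'_def fmx_def u_def)
  have "tr T M' = (\<Sum>c<d. \<Sum>l<k. M' (c, l) (c, l))"
    unfolding tr_def T_def by (simp add: sum.cartesian_product)
  also have "\<dots> = (\<Sum>c<d. M (h c) (h c))"
  proof (rule sum.cong[OF refl])
    fix c assume c: "c \<in> {..<d}"
    have "(\<Sum>l<k. M' (c, l) (c, l)) = (\<Sum>l\<in>{0}. M' (c, l) (c, l))"
      by (rule sum.mono_neutral_right) (use k0 M'0 c in auto)
    then show "(\<Sum>l<k. M' (c, l) (c, l)) = M (h c) (h c)" using M'00 c by simp
  qed
  also have "\<dots> = tr E M" unfolding tr_def by (rule sum.reindex_bij_betw[OF h])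
  also have "\<dots> = tr S M"
    unfolding tr_def by (rule sum.mono_neutral_left) (use fin S zero in auto)
  finally have trT: "tr T M' = 0" using tr0 by simp
  have bM': "bnd T T M' 1" unfolding M'_def by (rule bnd_fmx[OF onu finT M])
  \<comment> \<open>In the new basis only the block of the first vectors of the groups survives. The
    remainder is therefore zero even with \<kappa> = 0, and the paving has norm exactly as small as
    the spreading makes it, 1/k.\<close>
  have rem: "bnd T T (remainder ({..<d} \<times> {0}) (\<lambda>_. 0) M') 0"
  proof -
    have "remainder ({..<d} \<times> {0}) (\<lambda>_. 0) M' p q = 0" if "p \<in> T" "q \<in> T" for p q
      using that M'0[of "fst p" "snd p" "fst q" "snd q"] unfolding remainder_def T_def
      by (cases p; cases q) auto
    then have "bnd T T (remainder ({..<d} \<times> {0}) (\<lambda>_. 0) M') 0 \<longleftrightarrow> bnd T T (\<lambda>i j. 0 :: complex) 0"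
      by (intro bnd_cong)
    then show ?thesis using bnd_zero[of 0 T T] by simp
  qed
  have "paved k ((1 + 0) / real k + 3 * 0) T M'"
    by (rule paved_groups[OF k0 order_refl T_def refl bM' rem trT]) (use M'0 in auto)
  then have p: "paved (s * s) (1 / real k) T M'" using k by simp
  have cT: "card T = d * k" unfolding T_def by simp
  have dk: "d * k \<le> card S"
  proof -
    have "d * k \<le> (k + 2) * card E" by (simp add: d_def)
    also have "\<dots> \<le> card S" using large card_mono[OF fin FS] by linarith
    finally show ?thesis .
  qed
  have "cm T M' 1 (8 * real s * (1 / real k) * K + 4 * real s ^ 5)"
  proof (rule cm_paved[OF finT bM' s _ _ K _ p])
    fix m and N' :: "nat \<Rightarrow> nat \<Rightarrow> complex"
    assume "m < card T" "bnd {..<m} {..<m} N' 1" "tr {..<m} N' = 0"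
    then show "cm {..<m} N' 1 K" using solvedD[OF IH] dk cT by auto
  qed (use d0 k0 cT in auto)
  moreover have "8 * real s * (1 / real k) = 8 / real s" using k s by simp
  ultimately have cmT: "cm T M' 1 (8 / real s * K + 4 * real s ^ 5)" by (simp only:)
  obtain v where v: "onf S {..<card S - d * k} v" and v0: "\<forall>r<card S - d * k. \<forall>i. i \<notin> S \<longrightarrow> v r i = 0"
    and uv: "\<forall>r<card S - d * k. \<forall>p\<in>T. ip S (u p) (v r) = 0"
    using null_family[OF finT fin, of "card S - d * k" u] dk cT by auto
  \<comment> \<open>The coordinate vectors of \<open>E\<close> belong to the groups, so whatever is
    orthogonal to the groups is supported in \<open>F\<close>. It forms a zero block, to be peeled
    off with \<eta> = 1.\<close>
  have vE: "v r i = 0" if r: "r < card S - d * k" and i: "i \<in> S - F" for r i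
  proof -
    have "i \<in> E" using i S by auto
    then obtain c where c: "c < d" "i = h c" using h unfolding bij_betw_def by auto
    have "(c, 0) \<in> T" using c k0 by (simp add: T_def)
    then have "ip S (u (c, 0)) (v r) = 0" using uv r by blast
    then show ?thesis using ipun[OF c(1)] c by (simp add: u_def)
  qed
  have "cm S M (1 + 1) (8 / real s * K + 4 * real s ^ 5 + 4 / 1)"
  proof (rule cm_peel[OF fin _ finT _ M v onu])
    show "cm T (fmx S M u) 1 (8 / real s * K + 4 * real s ^ 5)" using cmT unfolding M'_def .
    show "ip S (v p) (u r) = 0" if "p \<in> {..<card S - d * k}" "r \<in> T" for p r
      using uv that by (auto intro: ip_commute_zero)
    show "fmx S M v p q = 0" if "p \<in> {..<card S - d * k}" "q \<in> {..<card S - d * k}" for p q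
      by (rule fmx_zero_block[OF zero]) (use vE that in auto)
  qed (use K dk cT in auto)
  then show ?thesis by simp
qed

subsection \<open>Peeling off zero blocks\<close>

lemma tr_complement:
  fixes M :: "'i \<Rightarrow> 'i \<Rightarrow> 'a::star_field"
  assumes fin: "finite S" "finite T" "finite R" and c: "card T + card R = card S"
    and u: "onf S T u" and w: "onf S R w" and uw: "\<And>p r. p \<in> T \<Longrightarrow> r \<in> R \<Longrightarrow> ip S (u p) (w r) = 0"
    and zero: "\<And>p. p \<in> T \<Longrightarrow> fmx S M u p p = 0"
  shows "tr R (fmx S M w) = tr S M"
proof -
  have "tr S M = tr (T <+> R) (fmx S M (case_sum u w))"
    using tr_fmx[OF onf_case_sum[OF u w uw] fin(1), of M] fin c by (simp add: card_Plus)
  also have "\<dots> = tr T (fmx S M u) + tr R (fmx S M w)"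
    unfolding tr_def using fin by (simp add: sum.Plus fmx_def)
  also have "tr T (fmx S M u) = 0" unfolding tr_def using zero by simp
  finally show ?thesis by simp
qed

lemma onf_append:
  fixes x :: "nat \<Rightarrow> 'i \<Rightarrow> 'a::star_field"
  assumes x: "onf S {..<a} x" and y: "onf S {..<b} y"
    and xy: "\<And>p q. p < a \<Longrightarrow> q < b \<Longrightarrow> ip S (x p) (y q) = 0"
  shows "onf S {..<a + b} (\<lambda>p. if p < a then x p else y (p - a))"
  unfolding onf_def
proof (intro ballI)
  fix p q assume pq: "p \<in> {..<a + b}" "q \<in> {..<a + b}"
  show "ip S (if p < a then x p else y (p - a)) (if q < a then x q else y (q - a)) = (if p = q then 1 else 0)"
    using pq onfD[OF x, of p q] onfD[OF y, of "p - a" "q - a"] xy[of p "q - a"]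
      ip_commute_zero[OF xy[of q "p - a"]]
    by (cases "p < a"; cases "q < a") auto
qed

lemma fmx_restrict:
  assumes "finite S" "R \<subseteq> S"
  shows "fmx S M (\<lambda>p i. if i \<in> R then f p i else 0) p q = fmx R M f p q"
proof -
  have "fmx S M (\<lambda>p i. if i \<in> R then f p i else 0) p q =
      (\<Sum>i\<in>S. \<Sum>j\<in>S. if i \<in> R \<and> j \<in> R then cj (f p i) * M i j * f q j else 0)"
    unfolding fmx_sum by (intro sum.cong) auto
  also have "\<dots> = (\<Sum>i\<in>R. \<Sum>j\<in>S. if i \<in> R \<and> j \<in> R then cj (f p i) * M i j * f q j else 0)"
    by (rule sum.mono_neutral_right) (use assms in auto)
  also have "\<dots> = (\<Sum>i\<in>R. \<Sum>j\<in>R. cj (f p i) * M i j * f q j)"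
  proof (rule sum.cong[OF refl])
    fix i assume "i \<in> R"
    then show "(\<Sum>j\<in>S. if i \<in> R \<and> j \<in> R then cj (f p i) * M i j * f q j else 0) =
      (\<Sum>j\<in>R. cj (f p i) * M i j * f q j)"
      by (intro sum.mono_neutral_cong_right) (use assms in auto)
  qed
  finally show ?thesis unfolding fmx_sum .
qed

lemma onf_restrict:
  assumes "finite S" "R \<subseteq> S" "onf R T f"
  shows "onf S T (\<lambda>p i. if i \<in> R then f p i else 0)"
  unfolding onf_def
proof (intro ballI)
  fix p q assume pq: "p \<in> T" "q \<in> T"
  have "ip S (\<lambda>i. if i \<in> R then f p i else 0) (\<lambda>i. if i \<in> R then f q i else 0) = ip R (f p) (f q)"
    unfolding ip_def by (intro sum.mono_neutral_cong_right) (use assms in auto)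
  then show "ip S (\<lambda>i. if i \<in> R then f p i else 0) (\<lambda>i. if i \<in> R then f q i else 0) = (if p = q then 1 else 0)"
    using onfD[OF assms(3) pq] by simp
qed

lemma solved_mono: "solved n K \<Longrightarrow> m \<le> n \<Longrightarrow> solved m K"
  unfolding solved_def using order_less_le_trans by blast

text \<open>The zero block on the first \<open>N1\<close> coordinates is kept while zero blocks of size \<open>N\<close> are peeled off
  the rest, until the rest is thin or small enough to be spread over the kept block. Every peeling
  costs \<open>\<eta>\<close> in the norm of the first factor, so \<open>\<eta>\<close> is later chosen as the inverse of the number of rounds.\<close>

lemma cm_rounds:
  fixes M :: "nat \<Rightarrow> nat \<Rightarrow> complex"
  assumes k: "k = s * s" and s: "2 \<le> s" and K: "0 \<le> K" and IH: "solved n K"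
    and W: "(k + 2) * W \<le> N1" "thin_dim k (3 * N) + k \<le> W" and \<eta>: "0 < \<eta>"
  shows "\<rho> \<le> W + j * N \<Longrightarrow> N1 + \<rho> \<le> n \<Longrightarrow> bnd {..<N1 + \<rho>} {..<N1 + \<rho>} M 1 \<Longrightarrow> tr {..<N1 + \<rho>} M = 0 \<Longrightarrow>
    \<forall>a<N1. \<forall>b<N1. M a b = 0 \<Longrightarrow>
    cm {..<N1 + \<rho>} M (2 + real (j + 1) * \<eta>)
      (192 / real s * K + 4 * real s ^ 5 + 4 * (real k)\<^sup>2 + real (j + 1) * (4 / \<eta>))"
proof (induction j arbitrary: \<rho> M)
  let ?c = "192 / real s * K + 4 * real s ^ 5 + 4 * (real k)\<^sup>2"
  have k1: "1 \<le> k" using k s by simp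
  have k2: "4 \<le> 4 * (real k)\<^sup>2" using k1 by simp
  have sp: "8 / real s * K \<le> 192 / real s * K" using K by (intro mult_right_mono divide_right_mono) auto
  have small: "cm {..<N1 + \<rho>} M (2 + real (j + 1) * \<eta>) (?c + real (j + 1) * (4 / \<eta>))"
    if "\<rho> \<le> W" "N1 + \<rho> \<le> n" "bnd {..<N1 + \<rho>} {..<N1 + \<rho>} M 1" "tr {..<N1 + \<rho>} M = 0"
      "\<forall>a<N1. \<forall>b<N1. M a b = 0" for \<rho> j and M :: "nat \<Rightarrow> nat \<Rightarrow> complex"
  proof -
    have "cm {..<N1 + \<rho>} M 2 (8 / real s * K + 4 * real s ^ 5 + 4)"
    proof (rule cm_spread[OF _ _ _ that(3,4) _ _ k s K])
      show "{..<N1 + \<rho>} = {..<N1} \<union> {N1..<N1 + \<rho>}" "{..<N1} \<inter> {N1..<N1 + \<rho>} = {}" by auto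
      have "(k + 2) * \<rho> \<le> (k + 2) * W" using that(1) by (rule mult_le_mono2)
      then show "(k + 2) * card {N1..<N1 + \<rho>} \<le> card {..<N1}" using W(1) by simp
      show "solved (card {..<N1 + \<rho>}) K" using solved_mono[OF IH] that(2) by simp
    qed (use that in auto)
    moreover have "0 \<le> real (j + 1) * \<eta>" "0 \<le> real (j + 1) * (4 / \<eta>)" using \<eta> by simp_all
    ultimately show ?thesis using k2 sp by (elim cm_mono) linarith+
  qed
  {
    case 0
    then show ?case using small[of \<rho> M 0] by simp
  next
    case (Suc j)
    show ?case
    proof (cases "\<rho> \<le> W")
      case True
      then show ?thesis using small[of \<rho> M "Suc j"] Suc.prems by blast
    next
      case False
      let ?S = "{..<N1 + \<rho>}" let ?R = "{N1..<N1 + \<rho>}"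
      have fin: "finite ?S" "finite ?R" and RS: "?R \<subseteq> ?S" by auto
      have cR: "card ?R = \<rho>" by simp
      have c0: "0 \<le> ?c" using K by simp
      consider f where "onf ?R {..<N} f" "\<forall>p<N. \<forall>q<N. fmx ?R M f p q = 0" | "thin ?R M (3 * N)"
        using zero_block_or_thin[OF fin(2), of N M] by blast
      then show ?thesis
      proof cases
        case 1
        have N\<rho>: "N \<le> \<rho>" using onf_card_le[OF 1(1) fin(2)] by simp
        obtain r where r: "onf ?R {..<\<rho> - N} r" and r0: "\<forall>q<\<rho> - N. \<forall>i. i \<notin> ?R \<longrightarrow> r q i = 0"
          and fr: "\<forall>q<\<rho> - N. \<forall>p\<in>{..<N}. ip ?R (f p) (r q) = 0"
          using null_family[of "{..<N}" ?R "\<rho> - N" f] N\<rho> cR by auto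
        define f' where "f' = (\<lambda>p i. if i \<in> ?R then f p i else 0)"
        define un where "un = (\<lambda>(p :: nat) (i :: nat). if i = p then 1 else 0 :: complex)"
        \<comment> \<open>The first \<open>N1\<close> coordinate vectors stay, so the matrix of the
          next round starts with the same zero block.\<close>
        define w where "w = (\<lambda>p. if p < N1 then un p else r (p - N1))"
        have ipr: "ip ?S x (r q) = ip ?R x (r q)" if "q < \<rho> - N" for x q
          by (rule ip_support[OF fin(1) RS]) (use r0 that in blast)
        have ipun: "ip ?S (un p) y = y p" if "p < N1" for p y
          unfolding un_def by (rule ip_unit) (use that in auto)
        have rS: "onf ?S {..<\<rho> - N} r"
          using r ipr unfolding onf_def by simp
        have unS: "onf ?S {..<N1} un"
          unfolding onf_def by (auto simp: ipun) (auto simp: un_def)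
        have w: "onf ?S {..<N1 + (\<rho> - N)} w"
          unfolding w_def by (rule onf_append[OF unS rS]) (use r0 ipun in auto)
        have f': "onf ?S {..<N} f'" unfolding f'_def by (rule onf_restrict[OF fin(1) RS 1(1)])
        have f'w: "ip ?S (f' p) (w q) = 0" if p: "p \<in> {..<N}" and q: "q \<in> {..<N1 + (\<rho> - N)}" for p q
        proof (cases "q < N1")
          case True
          then have "ip ?S (w q) (f' p) = 0" unfolding w_def using ipun[OF True] by (simp add: f'_def)
          then show ?thesis by (rule ip_commute_zero)
        next
          case False
          then have q': "q - N1 < \<rho> - N" using q by auto
          have "ip ?S (f' p) (w q) = ip ?R (f p) (r (q - N1))"
            using False ipr[OF q'] unfolding w_def by (simp add: f'_def ip_def)
          then show ?thesis using fr q' p by simp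
        qed
        have f'0: "fmx ?S M f' p q = 0" if "p \<in> {..<N}" "q \<in> {..<N}" for p q
          unfolding f'_def fmx_restrict[OF fin(1) RS] using 1(2) that by simp
        have cc: "card {..<N} + card {..<N1 + (\<rho> - N)} = card ?S" using N\<rho> by simp
        have "cm {..<N1 + (\<rho> - N)} (fmx ?S M w) (2 + real (j + 1) * \<eta>) (?c + real (j + 1) * (4 / \<eta>))"
        proof (rule Suc.IH)
          show "\<rho> - N \<le> W + j * N" "N1 + (\<rho> - N) \<le> n" using Suc.prems(1,2) by auto
          show "bnd {..<N1 + (\<rho> - N)} {..<N1 + (\<rho> - N)} (fmx ?S M w) 1"
            by (rule bnd_fmx[OF w _ Suc.prems(3)]) simp
          show "tr {..<N1 + (\<rho> - N)} (fmx ?S M w) = 0"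
            using tr_complement[OF fin(1) _ _ cc f' w f'w f'0] Suc.prems(4) by simp
          have "fmx ?S M w a b = M a b" if "a < N1" "b < N1" for a b
          proof -
            have "fmx ?S M w a b = ip ?S (un a) (mv ?S M (un b))" using that by (simp add: fmx_def w_def)
            also have "\<dots> = mv ?S M (un b) a" by (rule ipun[OF that(1)])
            also have "\<dots> = M a b" unfolding un_def by (rule mv_unit) (use that in auto)
            finally show ?thesis .
          qed
          then show "\<forall>a<N1. \<forall>b<N1. fmx ?S M w a b = 0" using Suc.prems(5) by simp
        qed
        from cm_peel[OF fin(1) _ _ cc Suc.prems(3) f' w f'w f'0 this _ _ \<eta>]
        have "cm ?S M (2 + real (j + 1) * \<eta> + \<eta>) (?c + real (j + 1) * (4 / \<eta>) + 4 / \<eta>)"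
          using \<eta> c0 by simp
        moreover have "2 + real (j + 1) * \<eta> + \<eta> = 2 + real (Suc j + 1) * \<eta>"
          "?c + real (j + 1) * (4 / \<eta>) + 4 / \<eta> = ?c + real (Suc j + 1) * (4 / \<eta>)"
          by (simp_all add: algebra_simps add_divide_distrib)
        ultimately show ?thesis by (simp only:)
      next
        case 2
        \<comment> \<open>A thin rest with more than \<open>W\<close> elements is solved on its own;
          its trace is zero because the kept block has zero diagonal. The kept block then joins it
          as a zero block.\<close>
        have "cm ?R M 2 ?c"
        proof (rule cm_thin[OF fin(2) _ _ k s 2 _ K])
          show "bnd ?R ?R M 1" by (rule bnd_subset[OF Suc.prems(3) RS RS fin(1,1)])
          have "tr ?R M = tr ?S M"
            unfolding tr_def by (rule sum.mono_neutral_left) (use Suc.prems(5) in auto)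
          then show "tr ?R M = 0" using Suc.prems(4) by simp
          show "thin_dim k (3 * N) + k \<le> card ?R" using W(2) False cR by linarith
          show "solved (card ?R) K" using solved_mono[OF IH] Suc.prems(2) cR by simp
        qed
        then have "cm ?S M (2 + \<eta>) (?c + 4 / \<eta>)"
          using Suc.prems(5) c0 \<eta> by (intro cm_two_blocks[OF fin(1) Suc.prems(3), of "{..<N1}" ?R]) auto
        moreover have "\<eta> \<le> real (Suc j + 1) * \<eta>" "4 / \<eta> \<le> real (Suc j + 1) * (4 / \<eta>)"
          using \<eta> mult_right_mono[of 1 "real (Suc j + 1)" \<eta>] mult_right_mono[of 1 "real (Suc j + 1)" "4 / \<eta>"] by simp_all
        ultimately show ?thesis by (elim cm_mono) linarith+
      qed
    qed
  }
qed

text \<open>The required dimension grows linearly with the number of conditions, so all sizes in the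
  peeling can be fixed multiples of \<open>N\<close>.\<close>

lemma thin_dim_mult: "1 \<le> N \<Longrightarrow> thin_dim k (L * N) + k \<le> (thin_dim k L + k) * N"
proof -
  assume N: "1 \<le> N"
  define e where "e = 2 * (L * (k + 1)) * (2 * k + 1)"
  have "thin_dim k (L * N) = 2 * k * (e * N + (2 * k + 1) * (3 * k * e * N + 1))"
    unfolding thin_dim_def e_def by (simp add: algebra_simps)
  also have "\<dots> \<le> 2 * k * (e * N + (2 * k + 1) * (3 * k * e * N + N))"
    by (intro mult_le_mono add_le_mono order_refl N)
  also have "\<dots> = thin_dim k L * N"
    unfolding thin_dim_def e_def by (simp add: algebra_simps)
  finally have "thin_dim k (L * N) \<le> thin_dim k L * N" .
  moreover have "k \<le> k * N" using N by simp
  ultimately show ?thesis unfolding add_mult_distrib by (rule add_le_mono)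
qed

text \<open>Everything is measured in units of N = n div n0: peeled zero blocks have size N, a rest
  of size at most W = Q N is spread, and the kept block has size N1 = (k + 2) W, as
  \<open>cm_spread\<close> demands. The choice of \<open>n0\<close> guarantees Q N1 \<le> n, which
  makes \<open>cm_thin\<close> applicable when already the search for the kept block ends in
  thinness.\<close>

lemma cm_step:
  fixes M :: "nat \<Rightarrow> nat \<Rightarrow> complex"
  assumes k: "k = s * s" and s: "2 \<le> s" and K: "0 \<le> K" and IH: "solved n K"
    and Q: "Q = thin_dim k 3 + k" and n0: "n0 = Q * (k + 2) * Q" and n: "n0 \<le> n"
    and M: "bnd {..<n} {..<n} M 1" and tr0: "tr {..<n} M = 0"
  shows "cm {..<n} M 4 (192 / real s * K + 4 * real s ^ 5 + 4 * (real k)\<^sup>2 + (2 * real n0 + 1) * (8 * real n0))"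
proof -
  let ?S = "{..<n}" let ?c = "192 / real s * K + 4 * real s ^ 5 + 4 * (real k)\<^sup>2"
  have "0 < k" using k s by simp
  then have Q0: "0 < Q" and n00: "0 < n0" using Q n0 by auto
  define N where "N = n div n0"
  define W where "W = Q * N"
  define N1 where "N1 = (k + 2) * W"
  have N: "1 \<le> N" using n n00 unfolding N_def by (simp add: div_greater_zero_iff Suc_le_eq)
  have QN: "Q * N1 \<le> n"
  proof -
    have "Q * N1 = N * n0" unfolding N1_def W_def n0 by (simp add: algebra_simps)
    also have "\<dots> \<le> n" unfolding N_def by (rule div_times_less_eq_dividend)
    finally show ?thesis .
  qed
  have N1: "1 \<le> N1" using N Q0 unfolding N1_def W_def by (simp add: Suc_le_eq)
  have c0: "0 \<le> ?c" using K by simp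
  consider f where "onf ?S {..<N1} f" "\<forall>p<N1. \<forall>q<N1. fmx ?S M f p q = 0" | "thin ?S M (3 * N1)"
    using zero_block_or_thin[of ?S N1 M] by blast
  then show ?thesis
  proof cases
    case 1
    have N1n: "N1 \<le> n" using onf_card_le[OF 1(1)] by simp
    obtain r where r: "onf ?S {..<n - N1} r" and fr: "\<forall>q<n - N1. \<forall>p\<in>{..<N1}. ip ?S (f p) (r q) = 0"
      using null_family[of "{..<N1}" ?S "n - N1" f] N1n by auto
    define w where "w = (\<lambda>p. if p < N1 then f p else r (p - N1))"
    have w: "onf ?S {..<N1 + (n - N1)} w"
      unfolding w_def by (rule onf_append[OF 1(1) r]) (use fr in auto)
    \<comment> \<open>Because n < 2 n0 N, at most 2 n0 rounds exhaust the rest. With this \<eta> the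
      2 n0 + 1 costs together raise the first bound by at most 2.\<close>
    define \<eta> where "\<eta> = 1 / (2 * real n0)"
    have \<eta>: "0 < \<eta>" using n00 by (simp add: \<eta>_def)
    have "cm {..<N1 + (n - N1)} (fmx ?S M w) (2 + real (2 * n0 + 1) * \<eta>) (?c + real (2 * n0 + 1) * (4 / \<eta>))"
    proof (rule cm_rounds[OF k s K IH _ _ \<eta>, of W N1 N])
      show "(k + 2) * W \<le> N1" by (simp add: N1_def)
      show "thin_dim k (3 * N) + k \<le> W" unfolding W_def Q by (rule thin_dim_mult[OF N])
      have "n < n0 * (N + 1)" using mult_div_mod_eq[of n0 n] mod_less_divisor[OF n00, of n] unfolding N_def
        distrib_left mult_1_right by linarith
      also have "\<dots> \<le> n0 * (2 * N)" using N by (intro mult_le_mono2) simp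
      finally show "n - N1 \<le> W + 2 * n0 * N" by simp
      show "N1 + (n - N1) \<le> n" using N1n by simp
      show "bnd {..<N1 + (n - N1)} {..<N1 + (n - N1)} (fmx ?S M w) 1"
        by (rule bnd_fmx[OF w _ M]) simp
      show "tr {..<N1 + (n - N1)} (fmx ?S M w) = 0" using tr_fmx[OF w] N1n tr0 by simp
      show "\<forall>a<N1. \<forall>b<N1. fmx ?S M w a b = 0" using 1(2) by (simp add: fmx_def w_def)
    qed
    then have "cm ?S M (2 + real (2 * n0 + 1) * \<eta>) (?c + real (2 * n0 + 1) * (4 / \<eta>))"
      using cm_transfer[OF w] N1n by simp
    moreover have "real (2 * n0 + 1) * \<eta> \<le> 2" "real (2 * n0 + 1) * (4 / \<eta>) = (2 * real n0 + 1) * (8 * real n0)"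
      using n00 by (simp_all add: \<eta>_def field_simps)
    ultimately show ?thesis by (elim cm_mono) linarith+
  next
    case 2
    have "thin_dim k (3 * N1) + k \<le> n" using thin_dim_mult[OF N1, of k 3] QN unfolding Q by linarith
    then have "cm ?S M 2 ?c"
      using cm_thin[OF _ M tr0 k s 2 _ K] IH by simp
    moreover have "0 \<le> (2 * real n0 + 1) * (8 * real n0)" by simp
    ultimately show ?thesis by (elim cm_mono) linarith+
  qed
qed

lemma cm_normalize:
  assumes "cm S M b c" "0 < b" "b * c \<le> K"
  shows "cm S M 1 K"
  using cm_rescale[OF assms(1), of "1 / b"] assms(2,3) by (auto elim!: cm_mono simp: mult.commute)

text \<open>The value of \<open>s\<close> makes the coefficient \<open>4 * 192 / s\<close> of the inductive constant equal to \<open>1/2\<close>.\<close>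

lemma cm_complex: "\<exists>K\<ge>0. \<forall>n. \<forall>M :: nat \<Rightarrow> nat \<Rightarrow> complex. bnd {..<n} {..<n} M 1 \<longrightarrow> tr {..<n} M = 0 \<longrightarrow> cm {..<n} M 1 K"
proof -
  define s :: nat where "s = 1536"
  define k where "k = s * s"
  define Q where "Q = thin_dim k 3 + k"
  define n0 where "n0 = Q * (k + 2) * Q"
  define c where "c = 4 * real s ^ 5 + 4 * (real k)\<^sup>2 + (2 * real n0 + 1) * (8 * real n0)"
  \<comment> \<open>Here 192 / s = 1/8, and normalising the first bound from 4 to 1 multiplies the
    second by 4. So K has to satisfy K/2 + 4 c \<le> K.\<close>
  define K where "K = 8 * c"
  have n0: "1 \<le> n0" unfolding n0_def Q_def k_def s_def by simp
  have c0: "16 * (real n0)\<^sup>2 \<le> c"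
  proof -
    have "(2 * real n0 + 1) * (8 * real n0) = 16 * (real n0)\<^sup>2 + 8 * real n0"
      by (simp add: algebra_simps power2_eq_square)
    moreover have "0 \<le> 4 * real s ^ 5" "0 \<le> 4 * (real k)\<^sup>2" by simp_all
    ultimately show ?thesis unfolding c_def by linarith
  qed
  have K0: "0 \<le> K" using c0 by (simp add: K_def order_trans[OF _ c0])
  have "cm {..<n} M 1 K" if "bnd {..<n} {..<n} M 1" "tr {..<n} M = 0" for n and M :: "nat \<Rightarrow> nat \<Rightarrow> complex"
    using that
  proof (induction n arbitrary: M rule: less_induct)
    case (less n)
    then have IH: "solved n K" unfolding solved_def by blast
    show ?case
    proof (cases "n0 \<le> n")
      case True
      have "cm {..<n} M 4 (192 / real s * K + c)"
        using cm_step[OF k_def _ K0 IH Q_def n0_def True less.prems] unfolding c_def by (simp add: s_def add.assoc)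
      moreover have "4 * (192 / real s * K + c) \<le> K" by (simp add: s_def K_def)
      ultimately show ?thesis by (intro cm_normalize) auto
    next
      case False
      \<comment> \<open>For the finitely many small dimensions the constant 4 n0^2 suffices; it is
        below K because c contains the term 16 n0^2.\<close>
      have "cm {..<n} M (real n) (4 * real n)" using cm_small[OF _ less.prems] by simp
      then have "cm {..<n} M (real n0) (4 * real n0)" using False by (elim cm_mono) auto
      moreover have "real n0 * (4 * real n0) \<le> K"
        using c0 zero_le_square[of "real n0"] unfolding K_def power2_eq_square by linarith
      ultimately show ?thesis using n0 by (intro cm_normalize) auto
    qed
  qed
  with K0 show ?thesis by blast
qed

subsection \<open>Matrices\<close>

lemma mult_mat_vec_mv:
  fixes B :: "nat \<Rightarrow> nat \<Rightarrow> 'a::comm_ring"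
  shows "mat n n (\<lambda>(i, j). B i j) *\<^sub>v vec n x = vec n (mv {..<n} B x)"
  by (rule eq_vecI) (auto simp: mv_def scalar_prod_def atLeast0LessThan)

lemma vec_l2norm_vec: "vec_l2norm (vec n x) = nrm {..<n} x"
  unfolding vec_l2norm_def nrm_def by (rule L2_set_cong) auto

lemma mat_opnorm_nonneg: "0 \<le> mat_opnorm (A :: 'a::real_normed_field mat)"
proof -
  have "vec_l2norm (A *\<^sub>v 0\<^sub>v (dim_col A)) \<le> mat_opnorm A"
    unfolding mat_opnorm_def by (rule cSUP_upper[OF _ mat_opnorm_bdd_above]) auto
  then show ?thesis using vec_l2norm_nonneg order_trans by blast
qed

lemma bnd_mat_opnorm:
  fixes A :: "'a::star_field mat"
  assumes A: "A \<in> carrier_mat n n"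
  shows "bnd {..<n} {..<n} (\<lambda>i j. A $$ (i, j)) (mat_opnorm A)"
  unfolding bnd_def
proof
  fix x :: "nat \<Rightarrow> 'a"
  have "A = mat n n (\<lambda>(i, j). A $$ (i, j))" using A by auto
  then have "A *\<^sub>v vec n x = vec n (mv {..<n} (\<lambda>i j. A $$ (i, j)) x)"
    using mult_mat_vec_mv[of n "\<lambda>i j. A $$ (i, j)" x] by simp
  then show "nrm {..<n} (mv {..<n} (\<lambda>i j. A $$ (i, j)) x) \<le> mat_opnorm A * nrm {..<n} x"
    using vec_l2norm_mult_le[of "vec n x" A] A by (simp add: vec_l2norm_vec)
qed

lemma mat_opnorm_le:
  fixes B :: "nat \<Rightarrow> nat \<Rightarrow> 'a::star_field"
  assumes B: "bnd {..<n} {..<n} B c" and c: "0 \<le> c"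
  shows "mat_opnorm (mat n n (\<lambda>(i, j). B i j)) \<le> c"
  unfolding mat_opnorm_def
proof (rule cSUP_least)
  show "{v \<in> carrier_vec (dim_col (mat n n (\<lambda>(i, j). B i j))). vec_l2norm v \<le> 1} \<noteq> {}"
    by (auto intro!: exI[of _ "0\<^sub>v n"])
  fix v :: "'a vec"
  assume "v \<in> {v \<in> carrier_vec (dim_col (mat n n (\<lambda>(i, j). B i j))). vec_l2norm v \<le> 1}"
  then have v: "v = vec n (\<lambda>i. v $ i)" and v1: "vec_l2norm v \<le> 1" by auto
  have "vec_l2norm (mat n n (\<lambda>(i, j). B i j) *\<^sub>v v) = nrm {..<n} (mv {..<n} B (\<lambda>i. v $ i))"
    by (subst v) (simp only: mult_mat_vec_mv vec_l2norm_vec)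
  also have "\<dots> \<le> c * nrm {..<n} (\<lambda>i. v $ i)" by (rule bndD[OF B])
  also have "\<dots> = c * vec_l2norm v" by (subst (2) v) (simp only: vec_l2norm_vec)
  also have "\<dots> \<le> c" using v1 c by (simp add: mult_left_le)
  finally show "vec_l2norm (mat n n (\<lambda>(i, j). B i j) *\<^sub>v v) \<le> c" .
qed

lemma commutator_mat:
  fixes A :: "'a::star_field mat"
  assumes A: "A \<in> carrier_mat n n" and c: "cm {..<n} (\<lambda>i j. A $$ (i, j)) b c" "0 \<le> b" "0 \<le> c"
  shows "\<exists>B\<in>carrier_mat n n. \<exists>C\<in>carrier_mat n n.
    A = B * C - C * B \<and> mat_opnorm B * mat_opnorm C \<le> b * c"
proof -
  obtain B C where BC: "\<forall>i\<in>{..<n}. \<forall>j\<in>{..<n}. A $$ (i, j) = mm {..<n} B C i j - mm {..<n} C B i j"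
    and B: "bnd {..<n} {..<n} B b" and C: "bnd {..<n} {..<n} C c"
    using c(1) unfolding cm_def by blast
  let ?B = "mat n n (\<lambda>(i, j). B i j)" let ?C = "mat n n (\<lambda>(i, j). C i j)"
  have "A = ?B * ?C - ?C * ?B"
  proof (rule eq_matI)
    fix i j assume "i < dim_row (?B * ?C - ?C * ?B)" "j < dim_col (?B * ?C - ?C * ?B)"
    then show "A $$ (i, j) = (?B * ?C - ?C * ?B) $$ (i, j)"
      using BC by (simp add: mm_def scalar_prod_def atLeast0LessThan)
  qed (use A in auto)
  moreover have "mat_opnorm ?B * mat_opnorm ?C \<le> b * c"
    by (intro mult_mono mat_opnorm_le B C c mat_opnorm_nonneg)
  ultimately show ?thesis by (intro bexI[of _ ?B] bexI[of _ ?C]) auto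
qed

text \<open>Homogeneity: divide by the norm and multiply the second factor back. Norm zero is
  treated apart, where all entries vanish.\<close>

lemma commutator_mat_of_unit_ball:
  fixes A :: "'a::star_field mat"
  assumes H: "\<And>n (M :: nat \<Rightarrow> nat \<Rightarrow> 'a). bnd {..<n} {..<n} M 1 \<Longrightarrow> tr {..<n} M = 0 \<Longrightarrow> cm {..<n} M b c"
    and nn: "0 \<le> b" "0 \<le> c" and A: "A \<in> carrier_mat n n" and tr0: "mat_trace A = 0"
  shows "\<exists>B\<in>carrier_mat n n. \<exists>C\<in>carrier_mat n n.
    A = B * C - C * B \<and> mat_opnorm B * mat_opnorm C \<le> b * c * mat_opnorm A"
proof -
  define \<nu> where "\<nu> = mat_opnorm A"
  have \<nu>: "0 \<le> \<nu>" unfolding \<nu>_def by (rule mat_opnorm_nonneg)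
  let ?M = "\<lambda>i j. A $$ (i, j)"
  have M: "bnd {..<n} {..<n} ?M \<nu>" unfolding \<nu>_def by (rule bnd_mat_opnorm[OF A])
  have "cm {..<n} ?M b (\<nu> * c)"
  proof (cases "\<nu> = 0")
    case True
    have "?M i j = 0" if "i \<in> {..<n}" "j \<in> {..<n}" for i j
      using bnd_entry[OF M _ _ that] True by simp
    then show ?thesis using nn \<nu> by (intro cm_zero) auto
  next
    case False
    let ?N = "\<lambda>i j. of_real (1 / \<nu>) * A $$ (i, j)"
    have "norm (of_real (1 / \<nu>) :: 'a) * \<nu> = 1"
      using False \<nu> by (simp only: norm_of_real) simp
    with bnd_smult[OF M, of "of_real (1 / \<nu>)"] have "bnd {..<n} {..<n} ?N 1" by (simp only:)
    moreover have "tr {..<n} ?N = of_real (1 / \<nu>) * mat_trace A"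
      using A unfolding tr_def mat_trace_def by (simp only: carrier_matD sum_distrib_left)
    then have "tr {..<n} ?N = 0" using tr0 by simp
    ultimately have "cm {..<n} (\<lambda>i j. of_real \<nu> * ?N i j) b (norm (of_real \<nu> :: 'a) * c)"
      by (intro cm_smult H)
    moreover have "norm (of_real \<nu> :: 'a) = \<nu>" using \<nu> by (simp only: norm_of_real abs_of_nonneg)
    moreover have "of_real \<nu> * ?N i j = ?M i j" for i j using False by simp
    ultimately show ?thesis by (simp only:)
  qed
  from commutator_mat[OF A this nn(1)] show ?thesis
    using nn(2) \<nu> by (simp add: \<nu>_def[symmetric] mult.assoc mult.commute[of c])
qed

theorem theorem1p1:
  shows "\<exists>K::real. K > 0 \<and>
    (\<forall>n\<ge>1. \<forall>A \<in> carrier_mat n n. mat_trace (A :: real mat) = 0 \<longrightarrow>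
      (\<exists>B \<in> carrier_mat n n. \<exists>C \<in> carrier_mat n n.
        A = B * C - C * B \<and> mat_opnorm B * mat_opnorm C \<le> K * mat_opnorm A)) \<and>
    (\<forall>n\<ge>1. \<forall>A \<in> carrier_mat n n. mat_trace (A :: complex mat) = 0 \<longrightarrow>
      (\<exists>B \<in> carrier_mat n n. \<exists>C \<in> carrier_mat n n.
        A = B * C - C * B \<and> mat_opnorm B * mat_opnorm C \<le> K * mat_opnorm A))"
proof -
  obtain K :: real where K: "0 \<le> K" and cx: "\<And>n (M :: nat \<Rightarrow> nat \<Rightarrow> complex).
      bnd {..<n} {..<n} M 1 \<Longrightarrow> tr {..<n} M = 0 \<Longrightarrow> cm {..<n} M 1 K"
    using cm_complex by blast
  \<comment> \<open>The real case contributes 2 * 16 = 32 and the complex case K; the sum dominates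
    both and is positive.\<close>
  have le: "2 * 16 * mat_opnorm A \<le> (K + 32) * mat_opnorm A" for A :: "real mat"
    using K mat_opnorm_nonneg[of A] by (intro mult_right_mono) auto
  have le': "1 * K * mat_opnorm A \<le> (K + 32) * mat_opnorm A" for A :: "complex mat"
    using mat_opnorm_nonneg[of A] by (intro mult_right_mono) auto
  show ?thesis
  proof (intro exI[of _ "K + 32"] conjI allI impI ballI)
    fix n and A :: "real mat"
    assume "A \<in> carrier_mat n n" "mat_trace A = 0"
    from commutator_mat_of_unit_ball[OF cm_real _ _ this] le[of A]
    show "\<exists>B\<in>carrier_mat n n. \<exists>C\<in>carrier_mat n n.
      A = B * C - C * B \<and> mat_opnorm B * mat_opnorm C \<le> (K + 32) * mat_opnorm A"
      by (meson finite_lessThan order_trans zero_le_numeral)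
  next
    fix n and A :: "complex mat"
    assume "A \<in> carrier_mat n n" "mat_trace A = 0"
    from commutator_mat_of_unit_ball[OF cx _ K this] le'[of A]
    show "\<exists>B\<in>carrier_mat n n. \<exists>C\<in>carrier_mat n n.
      A = B * C - C * B \<and> mat_opnorm B * mat_opnorm C \<le> (K + 32) * mat_opnorm A"
      by (meson order_trans zero_le_one)
  qed (use K in auto)
qed

end
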